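(* Let $\Phi^+$ be the set of positive roots of the rank $3$ universal Coxeter group $U_3$. Every biclosed set $R\subseteq\Phi^+$ is weakly separable. As a consequence, the extended weak order for $U_3$ (the poset of biclosed subsets of $\Phi^+$ ordered by containment) is a lattice.
   Context: $U_3=\langle s_1,s_2,s_3\mid s_1^2=s_2^2=s_3^2=\mathrm{id}\rangle$. Let $V=\mathbb{R}^3$ with basis $\Delta=\{\alpha_1,\alpha_2,\alpha_3\}$ and symmetric bilinear form $\langle\alpha_i,\alpha_j\rangle=1$ if $i=j$ and $-1$ if $i\neq j$. The group $U_3$ acts linearly on $V$ by $s_i(x)=x-2\langle\alpha_i,x\rangle\alpha_i$. The root system is $\Phi=\{w\cdot\alpha_i: w\in U_3,\ i\in\{1,2,3\}\}$. For $X\subseteq V$, $\mathrm{Span}_{\geq 0}X$ is the set of all nonnegative linear combinations of vectors in $X$, and $\Phi^+=\Phi\cap\mathrm{Span}_{\geq0}(\Delta)$ is the set of positive roots. A set $R\subseteq\Phi^+$ is closed if for all $\alpha,\beta\in R$ we have $\mathrm{Span}_{\geq0}\{\alpha,\beta\}\cap\Phi^+\subseteq R$. It is biclosed if both $R$ and $\Phi^+\setminus R$ are closed. A set $R\subseteq\Phi^+$ is weakly separable if $\mathrm{Span}_{\geq0}R\cap\mathrm{Span}_{\geq0}(\Phi^+\setminus R)=\{0\}$. The extended weak order of $U_3$ is the collection of biclosed subsets of $\Phi^+$, partially ordered by containment. *)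

theory Defs
  imports "HOL-Analysis.Analysis" "HOL-Algebra.Group_Action"
begin

section \<open>The universal Coxeter group of rank 3\<close>

text \<open>
  The group with presentation \<open>s1, s2, s3 | s1^2 = s2^2 = s3^2 = id\<close>. The generators are
  involutions, so every element is a word in the generators themselves and the group is the free
  monoid on them modulo the congruence generated by the relations. The index type \<open>3\<close> has
  exactly three elements.
\<close>

inductive word_eq :: "3 list \<Rightarrow> 3 list \<Rightarrow> bool" where
  refl: "word_eq xs xs"
| sym: "word_eq xs ys \<Longrightarrow> word_eq ys xs"
| trans: "word_eq xs ys \<Longrightarrow> word_eq ys zs \<Longrightarrow> word_eq xs zs"
| cancel: "word_eq (xs @ [i, i] @ ys) (xs @ ys)"

lemma word_eq_append_left: "word_eq xs ys \<Longrightarrow> word_eq (zs @ xs) (zs @ ys)"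
proof (induction rule: word_eq.induct)
  case (cancel xs i ys)
  then show ?case using word_eq.cancel[of "zs @ xs" i ys] by simp
qed (blast intro: word_eq.intros)+

lemma word_eq_append_right: "word_eq xs ys \<Longrightarrow> word_eq (xs @ zs) (ys @ zs)"
proof (induction rule: word_eq.induct)
  case (cancel xs i ys)
  then show ?case using word_eq.cancel[of xs i "ys @ zs"] by simp
qed (blast intro: word_eq.intros)+

lemma word_eq_rev_append: "word_eq (rev xs @ xs) []"
proof (induction xs)
  case (Cons i xs)
  have "word_eq (rev xs @ [i, i] @ xs) (rev xs @ xs)" by (rule word_eq.cancel)
  then show ?case using Cons by (auto intro: word_eq.trans)
qed (simp add: word_eq.refl)

quotient_type u3 = "3 list" / word_eq
  by (intro equivpI reflpI sympI transpI) (blast intro: word_eq.intros)+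

lift_definition u3_one :: u3 is "[]" .

lift_definition u3_mult :: "u3 \<Rightarrow> u3 \<Rightarrow> u3" is "(@)"
  by (blast intro: word_eq.trans word_eq_append_left word_eq_append_right)

lift_definition gen :: "3 \<Rightarrow> u3" is "\<lambda>i. [i]" .

definition U3 :: "u3 monoid" where
  "U3 = \<lparr>carrier = UNIV, mult = u3_mult, one = u3_one\<rparr>"

lemma U3_simps [simp]:
  "carrier U3 = UNIV" "mult U3 = u3_mult" "one U3 = u3_one"
  by (simp_all add: U3_def)

lemma U3_involution: "gen i \<otimes>\<^bsub>U3\<^esub> gen i = \<one>\<^bsub>U3\<^esub>"
  unfolding U3_simps by transfer (use word_eq.cancel[of "[]" _ "[]"] in simp)

lemma group_U3: "group U3"
proof (rule groupI; unfold U3_simps)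
  fix x y z
  show "u3_mult (u3_mult x y) z = u3_mult x (u3_mult y z)"
    by transfer (simp add: word_eq.refl)
  show "u3_mult u3_one x = x" by transfer (simp add: word_eq.refl)
  show "\<exists>y\<in>UNIV. u3_mult y x = u3_one"
    unfolding bex_UNIV by transfer (blast intro: word_eq_rev_append)
qed simp_all

lemma U3_induct [case_names one step]:
  assumes "P u3_one" "\<And>i u. P u \<Longrightarrow> P (u3_mult (gen i) u)"
  shows "P u"
proof (induction u rule: u3.abs_induct)
  case (1 xs)
  show ?case
  proof (induction xs)
    case (Cons i xs)
    have "u3_mult (gen i) (abs_u3 xs) = abs_u3 (i # xs)"
      by (simp add: gen.abs_eq u3_mult.abs_eq)
    then show ?case using assms(2)[OF Cons] by metis
  qed (use assms(1) in \<open>simp add: u3_one_def\<close>)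
qed

theorem U3_universal_property:
  assumes G: "group G"
    and f: "\<And>i::3. f i \<in> carrier G" "\<And>i. f i \<otimes>\<^bsub>G\<^esub> f i = \<one>\<^bsub>G\<^esub>"
  shows "\<exists>!h. h \<in> hom U3 G \<and> (\<forall>i. h (gen i) = f i)"
proof -
  interpret G: group G by (rule G)
  define p where "p xs = foldr (\<lambda>i. mult G (f i)) xs \<one>\<^bsub>G\<^esub>" for xs
  have p_closed: "p xs \<in> carrier G" for xs
    by (induction xs) (simp_all add: p_def f)
  have p_append: "p (xs @ ys) = p xs \<otimes>\<^bsub>G\<^esub> p ys" for xs ys
  proof (induction xs)
    case (Cons i xs)
    then show ?case using p_closed f by (simp add: p_def G.m_assoc)
  qed (use p_closed[of ys] in \<open>simp add: p_def\<close>)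
  have p_eq: "p xs = p ys" if "word_eq xs ys" for xs ys
    using that
  proof (induction rule: word_eq.induct)
    case (cancel xs i ys)
    have "p [i, i] = \<one>\<^bsub>G\<^esub>" by (simp add: p_def f)
    then show ?case using p_closed by (simp only: p_append G.l_one)
  qed simp_all
  define h where "h u = p (rep_u3 u)" for u
  have h_abs: "h (abs_u3 xs) = p xs" for xs
    unfolding h_def by (rule p_eq) (simp add: Quotient_rep_abs[OF Quotient_u3] word_eq.refl)
  show ?thesis
  proof (intro ex1I[of _ h] conjI allI)
    have "h (u3_mult x y) = h x \<otimes>\<^bsub>G\<^esub> h y" for x y
      by (induction x rule: u3.abs_induct, induction y rule: u3.abs_induct)
        (simp add: u3_mult.abs_eq h_abs p_append)
    then show "h \<in> hom U3 G" by (auto simp: hom_def h_def p_closed)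
    show "h (gen i) = f i" for i by (simp add: gen.abs_eq h_abs) (simp add: p_def f)
    fix k assume k: "k \<in> hom U3 G \<and> (\<forall>i. k (gen i) = f i)"
    interpret k: group_hom U3 G k
      using k by (intro group_hom.intro group_hom_axioms.intro group_U3 G) auto
    have step: "k (u3_mult (gen i) u) = f i \<otimes>\<^bsub>G\<^esub> k u" for i u
      using k.hom_mult[of "gen i" u] k by simp
    have step': "h (u3_mult (gen i) u) = f i \<otimes>\<^bsub>G\<^esub> h u" for i u
      using \<open>h \<in> hom U3 G\<close> \<open>\<And>i. h (gen i) = f i\<close> hom_mult[of h U3 G "gen i" u] by simp
    have "k u = h u" for u
    proof (induction u rule: U3_induct)
      case one
      have "h u3_one = \<one>\<^bsub>G\<^esub>" by (simp add: u3_one_def h_abs) (simp add: p_def)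
      then show ?case using k.hom_one by simp
    qed (simp add: step step')
    then show "k = h" by blast
  qed
qed


section \<open>The geometric representation and the root system\<close>

definition \<alpha> :: "3 \<Rightarrow> real^3" where
  "\<alpha> i = axis i 1"

definition \<Delta> :: "(real^3) set" where
  "\<Delta> = range \<alpha>"

definition form :: "real^3 \<Rightarrow> real^3 \<Rightarrow> real" where
  "form x y = (\<Sum>i\<in>UNIV. \<Sum>j\<in>UNIV. x $ i * y $ j * (if i = j then 1 else -1))"

lemma bilinear_form: "bilinear form"
  unfolding bilinear_def form_def
  by (auto intro!: linearI simp: sum.distrib sum_distrib_left algebra_simps)

lemma form_sym: "form x y = form y x"
  unfolding form_def by (subst sum.swap) (auto intro!: sum.cong)

lemma form_\<alpha>: "form (\<alpha> i) (\<alpha> j) = (if i = j then 1 else -1)"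
  using exhaust_3[of i] exhaust_3[of j]
  by (auto simp: form_def \<alpha>_def axis_def sum_3)

definition reflection :: "3 \<Rightarrow> real^3 \<Rightarrow> real^3" where
  "reflection i x = x - (2 * form (\<alpha> i) x) *\<^sub>R \<alpha> i"

lemma linear_reflection: "linear (reflection i)"
proof -
  have "linear (form (\<alpha> i))" using bilinear_form by (simp add: bilinear_def)
  then show ?thesis
    by (intro linearI) (simp_all add: reflection_def linear_add linear_scale algebra_simps)
qed

lemma reflection_involution: "reflection i (reflection i x) = x"
proof -
  have "linear (form (\<alpha> i))" using bilinear_form by (simp add: bilinear_def)
  then have "form (\<alpha> i) (reflection i x) = - form (\<alpha> i) x"
    by (simp add: reflection_def linear_diff linear_scale form_\<alpha>)
  then show ?thesis by (simp add: reflection_def[of i "reflection i x"]) (simp add: reflection_def)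
qed

lemma foldr_reflection_eq: "word_eq xs ys \<Longrightarrow> foldr reflection xs = foldr reflection ys"
  by (induction rule: word_eq.induct) (auto simp: reflection_involution fun_eq_iff)

lift_definition act :: "u3 \<Rightarrow> real^3 \<Rightarrow> real^3" is "foldr reflection"
  by (rule foldr_reflection_eq)

lemma act_gen: "act (gen i) = reflection i"
  by transfer simp

lemma act_one: "act u3_one = id"
  by transfer (simp add: fun_eq_iff)

lemma act_mult: "act (u3_mult u v) = act u \<circ> act v"
  by transfer (simp add: fun_eq_iff)

lemma linear_act: "linear (act u)"
proof (induction u rule: U3_induct)
  case one
  then show ?case by (metis act_one linear_id)
next
  case (step i u)
  then show ?case by (metis act_mult act_gen linear_compose linear_reflection)
qed

lemma group_action_act: "group_action U3 UNIV act"
proof -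
  have bij: "bij (act u)" for u
  proof (induction u rule: U3_induct)
    case one
    then show ?case by (metis act_one bij_id)
  next
    case (step i u)
    have "bij (reflection i)"
      by (rule involuntory_imp_bij) (rule reflection_involution)
    then show ?case by (metis step act_mult act_gen bij_comp)
  qed
  have mem: "act u \<in> Bij UNIV" for u
    by (simp add: Bij_def bij)
  have "act \<in> hom U3 (BijGroup UNIV)"
    by (auto simp: hom_def BijGroup_def mem act_mult compose_def fun_eq_iff)
  then show ?thesis
    by (intro group_action.intro group_hom.intro group_hom_axioms.intro group_U3 group_BijGroup)
qed

definition \<Phi> :: "(real^3) set" where
  "\<Phi> = {act w (\<alpha> i) | w i. w \<in> carrier U3}"

definition Span_nonneg :: "'a::real_vector set \<Rightarrow> 'a set" where
  "Span_nonneg X = {\<Sum>x\<in>F. c x *\<^sub>R x | F c. finite F \<and> F \<subseteq> X \<and> (\<forall>x\<in>F. 0 \<le> c x)}"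

definition \<Phi>_pos :: "(real^3) set" where
  "\<Phi>_pos = \<Phi> \<inter> Span_nonneg \<Delta>"


section \<open>Biclosed and weakly separable sets\<close>

definition closed_roots :: "(real^3) set \<Rightarrow> bool" where
  "closed_roots R \<longleftrightarrow> R \<subseteq> \<Phi>_pos \<and> (\<forall>x\<in>R. \<forall>y\<in>R. Span_nonneg {x, y} \<inter> \<Phi>_pos \<subseteq> R)"

definition biclosed :: "(real^3) set \<Rightarrow> bool" where
  "biclosed R \<longleftrightarrow> R \<subseteq> \<Phi>_pos \<and> closed_roots R \<and> closed_roots (\<Phi>_pos - R)"

definition weakly_separable :: "(real^3) set \<Rightarrow> bool" where
  "weakly_separable R \<longleftrightarrow>
     R \<subseteq> \<Phi>_pos \<and> Span_nonneg R \<inter> Span_nonneg (\<Phi>_pos - R) = {0}"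

definition extended_weak_order :: "(real^3) set gorder" where
  "extended_weak_order = \<lparr>carrier = {R. biclosed R}, eq = (=), le = (\<subseteq>)\<rparr>"

end

theory Submission
  imports Defs
begin

text \<open>
  A functional on \<open>V\<close> is a real binary quadratic form, and the roots are then the oriented edges of
  Conway's topograph. Concretely, \<open>rt v w\<close> below is the symmetric product of two vectors
  \<open>v\<close>, \<open>w\<close> of the integer lattice of rank two, written in the basis \<open>\<Delta>\<close>. Its norm is the square of
  the determinant \<open>dt v w\<close>, so that \<open>\<Phi>\<close> consists of the \<open>rt v w\<close> with \<open>{v, w}\<close> an edge of the Farey
  tessellation, and a functional \<open>F\<close> takes the value \<open>F \<bullet> rt v v\<close> at the Farey vertex \<open>v\<close>. A
  biclosed set \<open>R\<close> amounts to the set \<open>\<Psi> = R \<union> -(\<Phi>_pos - R)\<close>, which chooses one of each two opposite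
  roots and is closed in every plane, an orientation of the Farey edges. Weak separability of
  \<open>R\<close> means that \<open>\<Psi>\<close> satisfies no nontrivial nonnegative linear relation.

  The edges at a vertex \<open>v\<close> lie on a line, the pencil \<open>rt v u + k rt v v\<close>, along which \<open>\<Psi>\<close> changes
  at most once (\<open>nonneg_or_nonpos\<close>). This gives \<open>v\<close> a sign, which is the sign of the quadratic form
  if \<open>\<Psi>\<close> comes from one. Conway's climbing argument (\<open>climb\<close>) shows that beyond an edge that leads
  upwards from two nonnegative vertices every vertex is positive. Hence, if there are both positive
  and negative vertices, the projective line falls into an arc with the positive ones and an arc with
  the negative ones (\<open>splits_pos\<close>), and a product \<open>f\<close> of two real linear forms has the right sign at all
  vertices. It has the right sign on all edges too: if \<open>f\<close> is positive on a root and \<open>\<Psi>\<close> contains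
  the opposite root, then the reflection in this root moves some vertex with \<open>f > 0\<close> to one with
  \<open>f < 0\<close>, whereas closedness in the plane of the root and an edge of a suitable pencil makes the
  reflection keep positive vertices from becoming negative (\<open>no_reversal\<close>). So a nonnegative relation in \<open>\<Psi>\<close> lives in the plane
  where \<open>f\<close> vanishes, and there closedness excludes it. If no vertex is negative (or, symmetrically, none is positive), then every
  chamber has at most one negative wall. Crossing this wall lowers the heights of all
  roots of \<open>\<Psi>\<close> that are negative for the chamber, so that after finitely many steps a given finite part of
  \<open>\<Psi>\<close> consists of roots that are positive for one chamber (\<open>one_descent_functional\<close>).

  For the lattice property it suffices to interpolate: if the biclosed sets \<open>R\<close> and \<open>S\<close> lie in the
  biclosed sets \<open>T1\<close> and \<open>T2\<close>, then some biclosed \<open>Q\<close> lies between \<open>R \<union> S\<close> and \<open>T1 \<inter> T2\<close>. A minimal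
  upper bound of \<open>R\<close> and \<open>S\<close>, which exists by Zorn's lemma, is then the least one. On a finite
  set of roots the four biclosed sets are given by four vectors, which are linearly
  dependent. Evaluating the relation at one root of each of \<open>R - S\<close>, \<open>S - R\<close>, \<open>T1 - T2\<close>, \<open>T2 - T1\<close> and at a
  simple root about which all four sets agree, one sees that a positive combination of the
  vectors of \<open>R\<close> and one of the \<open>Ti\<close> equals a positive combination of the vectors of \<open>S\<close> and the other
  \<open>Ti\<close> (\<open>crossing_functional\<close>). This common vector is positive on \<open>R\<close> and \<open>S\<close> and negative outside
  \<open>T1\<close> and outside \<open>T2\<close>.
\<close>

section \<open>Roots as edges of the Farey tessellation\<close>

lemma form_eq: "form x y = x$1*y$1 + x$2*y$2 + x$3*y$3 - x$1*y$2 - x$2*y$1 - x$1*y$3 - x$3*y$1 - x$2*y$3 - x$3*y$2"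
  by (simp add: form_def sum_3 algebra_simps)

lemma form_simple:
  "form (\<alpha> i) x = 2 * x$i - (x$1 + x$2 + x$3)"
  using exhaust_3[of i] by (auto simp: form_eq \<alpha>_def axis_def)

lemma reflection_nth: "reflection i x $ j = (if j = i then 2 * (x$1 + x$2 + x$3) - 3 * x$i else x$j)"
  unfolding reflection_def form_simple by (simp add: \<alpha>_def axis_def)

lemma form_reflection: "form (reflection i x) (reflection i y) = form x y"
  using exhaust_3[of i] by (auto simp: form_eq reflection_nth algebra_simps)

definition dt :: "int \<times> int \<Rightarrow> int \<times> int \<Rightarrow> int" where
  "dt v w = fst v * snd w - snd v * fst w"

text \<open>
  The symmetric product of \<open>v\<close> and \<open>w\<close>. The coordinates are the products of the values of the three linear
  forms \<open>y\<close>, \<open>x\<close>, \<open>x - y\<close>, whose kernels are the vertices of the Farey triangle that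
  corresponds to the fundamental chamber.
\<close>
definition rt :: "int \<times> int \<Rightarrow> int \<times> int \<Rightarrow> real^3" where
  "rt v w = vector [of_int (snd v * snd w), of_int (fst v * fst w),
                    of_int ((fst v - snd v) * (fst w - snd w))]"

definition sc :: "int \<Rightarrow> int \<times> int \<Rightarrow> int \<times> int" (infixr "\<odot>" 75) where
  "k \<odot> v = (k * fst v, k * snd v)"

lemma sc_sel [simp]: "fst (k \<odot> v) = k * fst v" "snd (k \<odot> v) = k * snd v"
  by (simp_all add: sc_def)

lemma sc_simps [simp]: "1 \<odot> v = v" "0 \<odot> v = 0" "(-1) \<odot> v = - v"
  by (simp_all add: prod_eq_iff)

lemma dt_simps [simp]:
  "dt v v = 0" "dt (- v) w = - dt v w" "dt v (- w) = - dt v w"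
  "dt (u + v) w = dt u w + dt v w" "dt v (w + w') = dt v w + dt v w'"
  "dt (u - v) w = dt u w - dt v w" "dt v (w - w') = dt v w - dt v w'"
  "dt (k \<odot> v) w = k * dt v w" "dt v (k \<odot> w) = k * dt v w"
  by (simp_all add: dt_def algebra_simps)

lemma dt_swap: "dt w v = - dt v w"
  by (simp add: dt_def algebra_simps)

lemma rt_nth [simp]:
  "rt v w $ 1 = of_int (snd v * snd w)" "rt v w $ 2 = of_int (fst v * fst w)"
  "rt v w $ 3 = of_int ((fst v - snd v) * (fst w - snd w))"
  by (simp_all add: rt_def)

lemma rt_uminus [simp]: "rt (- v) w = - rt v w" "rt v (- w) = - rt v w"
  by (simp_all add: vec_eq_iff forall_3 algebra_simps)

lemma rt_bilinear:
  "rt (u + v) w = rt u w + rt v w" "rt v (w + w') = rt v w + rt v w'"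
  "rt (u - v) w = rt u w - rt v w" "rt v (w - w') = rt v w - rt v w'"
  "rt (k \<odot> v) w = of_int k *\<^sub>R rt v w" "rt v (k \<odot> w) = of_int k *\<^sub>R rt v w"
  by (simp_all add: vec_eq_iff forall_3 algebra_simps)

lemma rt_swap: "rt v w = rt w v"
  by (simp add: vec_eq_iff forall_3)

lemma dt_expand: "dt v w \<odot> u = dt u w \<odot> v + dt v u \<odot> w"
  by (simp add: prod_eq_iff dt_def algebra_simps)

lemma form_rt: "form (rt v w) (rt v w) = of_int ((dt v w)\<^sup>2)"
  by (simp add: form_eq dt_def power2_eq_square algebra_simps)

text \<open>
  Integer matrices of determinant \<open>-1\<close> whose action on symmetric products is that of the simple reflections.
\<close>
definition lift_refl :: "3 \<Rightarrow> int \<times> int \<Rightarrow> int \<times> int" where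
  "lift_refl i v = (if i = 1 then (fst v, 2 * fst v - snd v)
                    else if i = 2 then (2 * snd v - fst v, snd v) else (fst v, - snd v))"

lemma lift_refl_add: "lift_refl i (v + w) = lift_refl i v + lift_refl i w"
  by (simp add: lift_refl_def prod_eq_iff)

lemma dt_lift_refl: "\<bar>dt (lift_refl i v) (lift_refl i w)\<bar> = \<bar>dt v w\<bar>"
  by (simp add: lift_refl_def dt_def algebra_simps)

lemma reflection_rt: "reflection i (rt v w) = rt (lift_refl i v) (lift_refl i w)"
  using exhaust_3[of i]
  by (auto simp: vec_eq_iff forall_3 reflection_nth lift_refl_def algebra_simps)

text \<open>
  The chambers are the Farey triangles with vertices \<open>a\<close>, \<open>b\<close>, \<open>a + b\<close>. The signs make each wall point
  into its triangle.
\<close>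
lemma chamber_superbase:
  "\<exists>a b. \<bar>dt a b\<bar> = 1 \<and> act u (\<alpha> 1) = rt b (a + b) \<and> act u (\<alpha> 2) = rt a (a + b) \<and> act u (\<alpha> 3) = - rt a b"
proof (induction u rule: U3_induct)
  case one
  have "\<bar>dt (1,0) (0,1)\<bar> = 1" by (simp add: dt_def)
  moreover have "\<alpha> 1 = rt (0,1) ((1,0) + (0,1))" "\<alpha> 2 = rt (1,0) ((1,0) + (0,1))" "\<alpha> 3 = - rt (1,0) (0,1)"
    by (simp_all add: vec_eq_iff forall_3 \<alpha>_def axis_def)
  ultimately show ?case unfolding act_one id_apply by blast
next
  case (step i u)
  then obtain a b where ab: "\<bar>dt a b\<bar> = 1" "act u (\<alpha> 1) = rt b (a + b)"
    "act u (\<alpha> 2) = rt a (a + b)" "act u (\<alpha> 3) = - rt a b" by blast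
  let ?L = "lift_refl i"
  have "\<bar>dt (?L a) (?L b)\<bar> = 1" using ab dt_lift_refl by simp
  moreover have "act (u3_mult (gen i) u) (\<alpha> 1) = rt (?L b) (?L a + ?L b)"
    "act (u3_mult (gen i) u) (\<alpha> 2) = rt (?L a) (?L a + ?L b)"
    "act (u3_mult (gen i) u) (\<alpha> 3) = - rt (?L a) (?L b)"
    unfolding act_mult act_gen o_apply ab linear_neg[OF linear_reflection] reflection_rt lift_refl_add
    by simp_all
  ultimately show ?case by blast
qed

lemma root_is_rt:
  assumes "x \<in> \<Phi>" obtains a b where "\<bar>dt a b\<bar> = 1" "x = rt a b"
proof -
  obtain u i where x: "x = act u (\<alpha> i)" using assms by (auto simp: \<Phi>_def)
  obtain a b where ab: "\<bar>dt a b\<bar> = 1" "act u (\<alpha> 1) = rt b (a + b)"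
    "act u (\<alpha> 2) = rt a (a + b)" "act u (\<alpha> 3) = - rt a b" using chamber_superbase by blast
  have *: "\<bar>dt b (a+b)\<bar> = 1" "\<bar>dt a (a+b)\<bar> = 1" "\<bar>dt (-a) b\<bar> = 1" "- rt a b = rt (-a) b"
    using ab(1) dt_swap[of a b] by auto
  consider "i = 1" | "i = 2" | "i = 3" using exhaust_3 by blast
  then show thesis using that x ab * by cases metis+
qed

lemma reflection_root: "x \<in> \<Phi> \<Longrightarrow> reflection i x \<in> \<Phi>"
proof -
  assume "x \<in> \<Phi>"
  then obtain w j where "x = act w (\<alpha> j)" by (auto simp: \<Phi>_def)
  then have "reflection i x = act (u3_mult (gen i) w) (\<alpha> j)" by (simp add: act_mult act_gen)
  then show ?thesis by (auto simp: \<Phi>_def)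
qed

lemma simple_root: "\<alpha> i \<in> \<Phi>"
  unfolding \<Phi>_def using act_one by (metis (mono_tags, lifting) UNIV_I U3_simps(1) id_apply mem_Collect_eq)

lemma uminus_root: "x \<in> \<Phi> \<Longrightarrow> - x \<in> \<Phi>"
proof -
  assume "x \<in> \<Phi>"
  then obtain w i where x: "x = act w (\<alpha> i)" by (auto simp: \<Phi>_def)
  have "reflection i (\<alpha> i) = - \<alpha> i" by (simp add: reflection_def form_\<alpha> scaleR_2)
  then have "act (u3_mult w (gen i)) (\<alpha> i) = - x"
    by (simp add: act_mult act_gen x linear_neg[OF linear_act])
  then show ?thesis by (auto simp: \<Phi>_def) (metis)
qed

lemma uminus_root_iff [simp]: "- x \<in> \<Phi> \<longleftrightarrow> x \<in> \<Phi>"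
  using uminus_root by force

lemma root_form: "x \<in> \<Phi> \<Longrightarrow> form x x = 1"
  by (elim root_is_rt) (metis form_rt of_int_1 power2_abs power_one)

lemma root_nonzero: "x \<in> \<Phi> \<Longrightarrow> x \<noteq> 0"
  using root_form by (fastforce simp: form_eq)

lemma root_int: "x \<in> \<Phi> \<Longrightarrow> x $ i \<in> \<int>"
  by (elim root_is_rt) (use exhaust_3[of i] in auto)

definition height :: "real^3 \<Rightarrow> real" where "height x = x$1 + x$2 + x$3"

lemma linear_height: "linear height"
  by (rule linearI) (simp_all add: height_def algebra_simps)

lemma height_reflection: "height (reflection i x) = height x - 2 * form (\<alpha> i) x"
  using exhaust_3[of i] by (auto simp: height_def reflection_nth form_simple)

text \<open>
  The form equals \<open>(x - y)^2 + z^2 - 2 z (x + y)\<close>, where all three terms are nonnegative and the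
  second one is already at least one.
\<close>
lemma nonneg_three_norm:
  fixes x y z :: int
  assumes "x \<ge> 0" "y \<ge> 0" "z < 0" "x\<^sup>2 + y\<^sup>2 + z\<^sup>2 - 2*x*y - 2*y*z - 2*x*z = 1"
  shows "x = 0 \<and> y = 0"
proof -
  have "(x - y)\<^sup>2 + z\<^sup>2 + 2 * (-z) * (x + y) = 1" using assms(4) by (simp add: power2_eq_square algebra_simps)
  moreover have "z\<^sup>2 \<ge> 1" using assms(3) by (smt (verit) zero_less_power2)
  moreover have "(-z) * (x + y) \<ge> x + y" using assms mult_right_mono[of 1 "-z" "x + y"] by simp
  moreover have "(x-y)\<^sup>2 \<ge> 0" by simp
  ultimately have "x + y \<le> 0" by linarith
  then show ?thesis using assms by linarith
qed

lemma norm_one_same_sign: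
  fixes x y z :: int
  assumes "x\<^sup>2 + y\<^sup>2 + z\<^sup>2 - 2*x*y - 2*y*z - 2*x*z = 1"
  shows "(x \<ge> 0 \<and> y \<ge> 0 \<and> z \<ge> 0) \<or> (x \<le> 0 \<and> y \<le> 0 \<and> z \<le> 0)"
proof -
  define N where "N a b c = a\<^sup>2 + b\<^sup>2 + c\<^sup>2 - 2*a*b - 2*b*c - 2*a*c" for a b c :: int
  have perm: "N a c b = N a b c" "N b c a = N a b c" "N (-a) (-b) (-c) = N a b c" for a b c
    by (simp_all add: N_def power2_eq_square algebra_simps)
  have two: "N a b c = 1 \<Longrightarrow> a \<ge> 0 \<Longrightarrow> b \<ge> 0 \<Longrightarrow> c < 0 \<Longrightarrow> a = 0 \<and> b = 0" for a b c
    using nonneg_three_norm[of a b c] by (simp add: N_def)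
  have N: "N x y z = 1" using assms by (simp add: N_def)
  then have *: "N x z y = 1" "N y z x = 1" "N (-x) (-y) (-z) = 1" "N (-x) (-z) (-y) = 1" "N (-y) (-z) (-x) = 1"
    using perm by metis+
  show ?thesis using two[OF N] *[THEN two] by presburger
qed

lemma integral_norm_one_sign:
  assumes "\<And>j. x $ j \<in> \<int>" "form x x = 1"
  shows "(\<forall>j. 0 \<le> x $ j) \<or> (\<forall>j. x $ j \<le> 0)"
proof -
  obtain p q r where x: "x $ 1 = of_int p" "x $ 2 = of_int q" "x $ 3 = of_int r"
    using assms(1) by (metis Ints_cases)
  have "real_of_int (p\<^sup>2 + q\<^sup>2 + r\<^sup>2 - 2*p*q - 2*q*r - 2*p*r) = of_int 1"
    using assms(2) by (simp add: form_eq x power2_eq_square algebra_simps)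
  then have "p\<^sup>2 + q\<^sup>2 + r\<^sup>2 - 2*p*q - 2*q*r - 2*p*r = 1" by (simp only: of_int_eq_iff)
  from norm_one_same_sign[OF this] show ?thesis by (simp add: forall_3 x)
qed

lemma multiple_of_simple:
  assumes "form x x = 1" "0 \<le> x $ i" "\<And>j. j \<noteq> i \<Longrightarrow> x $ j = 0" shows "x = \<alpha> i"
proof -
  have "form x x = (x $ i)\<^sup>2" using exhaust_3[of i] assms(3) by (auto simp: form_eq power2_eq_square)
  then have "x $ i = 1" using assms(1,2) by (simp add: power2_eq_1_iff)
  then show ?thesis using assms(3) by (auto simp: vec_eq_iff \<alpha>_def axis_def)
qed

text \<open>
  The norm of \<open>x\<close> is the combination of the numbers \<open>form (\<alpha> i) x\<close> with the coordinates of \<open>x\<close> as coefficients.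
\<close>
lemma norm_one_descent:
  assumes "form x x = 1" "\<And>j. 0 \<le> x $ j" shows "\<exists>i. form (\<alpha> i) x > 0"
proof (rule ccontr)
  assume "\<not> ?thesis"
  then have f: "form (\<alpha> i) x \<le> 0" for i by (meson not_less)
  have "form x x = (\<Sum>i\<in>UNIV. x $ i * form (\<alpha> i) x)"
    unfolding sum_3 form_simple unfolding form_eq by (simp add: algebra_simps)
  also have "\<dots> \<le> 0" using f assms(2) by (intro sum_nonpos mult_nonneg_nonpos) auto
  finally show False using assms(1) by simp
qed

text \<open>
  Descent: a simple reflection lowers the height of \<open>x\<close> until the reflected vector is negative, which
  happens only if \<open>x\<close> is a simple root.
\<close>
lemma integral_norm_one_root:
  assumes "\<And>j. x $ j \<in> \<int>" "\<And>j. 0 \<le> x $ j" "form x x = 1" shows "x \<in> \<Phi>"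
proof -
  have nat: "\<exists>n. height y = real n" if "\<And>j. y $ j \<in> \<int>" "\<And>j. 0 \<le> y $ j" for y
  proof -
    have "height y \<in> \<int>" using that(1) by (simp add: height_def)
    moreover have "0 \<le> height y" using that(2) by (simp add: height_def)
    ultimately show ?thesis by (metis Ints_cases of_int_0_le_iff of_int_of_nat_eq nonneg_int_cases)
  qed
  obtain n where "height x = real n" using nat assms by blast
  then show ?thesis using assms
  proof (induction n arbitrary: x rule: less_induct)
    case (less n)
    obtain i where i: "form (\<alpha> i) x > 0" using norm_one_descent less.prems by blast
    define y where "y = reflection i x"
    have x: "x = reflection i y" by (simp add: y_def reflection_involution)
    have yi: "y $ j \<in> \<int>" for j using less.prems(2) by (auto simp: y_def reflection_nth)
    have y1: "form y y = 1" using less.prems(4) by (simp add: y_def form_reflection)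
    from integral_norm_one_sign[OF yi y1] show ?case
    proof
      assume y0: "\<forall>j. 0 \<le> y $ j"
      then obtain m where m: "height y = real m" using nat yi by blast
      then have "m < n" using i less.prems(1) height_reflection[of i x] by (simp add: y_def)
      then have "y \<in> \<Phi>" using less.IH m yi y0 y1 by blast
      then show ?thesis unfolding x by (rule reflection_root)
    next
      assume "\<forall>j. y $ j \<le> 0"
      then have "x $ j \<le> 0" if "j \<noteq> i" for j using that by (metis reflection_nth y_def)
      then have "x = \<alpha> i" using less.prems by (intro multiple_of_simple) (auto intro: order_antisym)
      then show ?thesis by (simp add: simple_root)
    qed
  qed
qed

lemma rt_root: assumes "\<bar>dt a b\<bar> = 1" shows "rt a b \<in> \<Phi>"
proof -
  have int: "rt a b $ j \<in> \<int>" for j using exhaust_3[of j] by auto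
  have "(dt a b)\<^sup>2 = 1" using assms by (metis power2_abs power_one)
  then have one: "form (rt a b) (rt a b) = 1" by (simp add: form_rt)
  from integral_norm_one_sign[OF int one] show ?thesis
  proof
    assume "\<forall>j. 0 \<le> rt a b $ j"
    then show ?thesis using integral_norm_one_root int one by blast
  next
    assume "\<forall>j. rt a b $ j \<le> 0"
    then have "rt (- a) b \<in> \<Phi>"
      using integral_norm_one_root[of "rt (- a) b"] int one by (simp add: form_eq)
    then show ?thesis using uminus_root[of "rt (- a) b"] by simp
  qed
qed

lemma Span_simple: "Span_nonneg \<Delta> = {x. \<forall>i. x $ i \<ge> 0}"
proof (intro equalityI subsetI)
  fix x assume "x \<in> Span_nonneg \<Delta>"
  then obtain F c where x: "x = (\<Sum>y\<in>F. c y *\<^sub>R y)" "finite F" "F \<subseteq> \<Delta>" "\<forall>y\<in>F. 0 \<le> c y"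
    by (auto simp: Span_nonneg_def)
  then show "x \<in> {x. \<forall>i. x $ i \<ge> 0}"
    by (auto simp: \<Delta>_def \<alpha>_def axis_def intro!: sum_nonneg)
next
  fix x :: "real^3" assume x: "x \<in> {x. \<forall>i. x $ i \<ge> 0}"
  define c where "c y = (\<Sum>i\<in>UNIV. if y = \<alpha> i then x $ i else 0)" for y
  have inj: "\<alpha> i = \<alpha> j \<longleftrightarrow> i = j" for i j by (auto simp: \<alpha>_def axis_eq_axis)
  have c: "c (\<alpha> i) = x $ i" for i by (simp add: c_def inj)
  have "(\<Sum>y\<in>\<Delta>. c y *\<^sub>R y) = (\<Sum>i\<in>UNIV. x $ i *\<^sub>R \<alpha> i)"
    unfolding \<Delta>_def by (subst sum.reindex) (auto simp: inj_def inj c)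
  also have "\<dots> = x" using basis_expansion[of x] by (simp add: \<alpha>_def scalar_mult_eq_scaleR)
  finally have "x = (\<Sum>y\<in>\<Delta>. c y *\<^sub>R y)" ..
  moreover have "finite \<Delta>" by (simp add: \<Delta>_def)
  moreover have "\<forall>y\<in>\<Delta>. 0 \<le> c y" using x by (auto simp: \<Delta>_def c)
  ultimately show "x \<in> Span_nonneg \<Delta>" unfolding Span_nonneg_def by blast
qed

lemma positive_root_iff: "x \<in> \<Phi>_pos \<longleftrightarrow> x \<in> \<Phi> \<and> (\<forall>i. x $ i \<ge> 0)"
  by (simp add: \<Phi>_pos_def Span_simple)

lemma root_cases: assumes "x \<in> \<Phi>" shows "x \<in> \<Phi>_pos \<or> - x \<in> \<Phi>_pos"
  using integral_norm_one_sign[OF root_int[OF assms] root_form[OF assms]] assms uminus_root[OF assms]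
  by (auto simp: positive_root_iff)

lemma height_pos: assumes "x \<in> \<Phi>_pos" shows "height x > 0"
proof -
  have "x$1 \<ge> 0" "x$2 \<ge> 0" "x$3 \<ge> 0" "x \<noteq> 0" using assms root_nonzero positive_root_iff by auto
  then show ?thesis by (auto simp: height_def vec_eq_iff forall_3)
qed

lemma not_both_positive: "x \<in> \<Phi>_pos \<Longrightarrow> - x \<notin> \<Phi>_pos"
  using height_pos[of x] height_pos[of "-x"] by (auto simp: linear_neg[OF linear_height])

lemma simple_pos: "\<alpha> i \<in> \<Phi>_pos"
  using simple_root by (auto simp: positive_root_iff \<alpha>_def axis_def)

lemma reflection_pos: assumes "x \<in> \<Phi>_pos" "x \<noteq> \<alpha> i" shows "reflection i x \<in> \<Phi>_pos"
proof (rule ccontr)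
  assume n: "reflection i x \<notin> \<Phi>_pos"
  have x: "x \<in> \<Phi>" "\<And>j. 0 \<le> x $ j" using assms(1) by (auto simp: positive_root_iff)
  have np: "- reflection i x \<in> \<Phi>_pos" using n root_cases reflection_root[OF x(1)] by blast
  have "x $ j = 0" if "j \<noteq> i" for j
  proof -
    have "reflection i x $ j = x $ j" using that by (simp add: reflection_nth)
    then have "x $ j \<le> 0" using np unfolding positive_root_iff by (metis neg_0_le_iff_le vector_uminus_component)
    then show ?thesis using x(2) by (metis order_antisym)
  qed
  then show False using multiple_of_simple[OF root_form[OF x(1)] x(2)] assms(2) by blast
qed

lemma descent_exists: "x \<in> \<Phi>_pos \<Longrightarrow> \<exists>i. form (\<alpha> i) x > 0"
  using norm_one_descent root_form by (auto simp: positive_root_iff)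

lemma height_nat: assumes "x \<in> \<Phi>_pos" obtains n :: nat where "height x = real n"
proof -
  have "height x \<in> \<int>" using assms root_int by (auto simp: height_def positive_root_iff intro!: Ints_add)
  then obtain k where k: "height x = of_int k" by (auto elim: Ints_cases)
  then have "k > 0" using height_pos[OF assms] by simp
  then show thesis using that[of "nat k"] k by simp
qed


definition prim :: "int \<times> int \<Rightarrow> bool" where "prim v \<longleftrightarrow> (\<exists>z. dt v z = 1)"

lemma primI: assumes "\<bar>dt v w\<bar> = 1" shows "prim v"
proof -
  have "dt v w = 1 \<or> dt v (- w) = 1" using assms by auto
  then show ?thesis unfolding prim_def by blast
qed

lemma primI': "\<bar>dt w v\<bar> = 1 \<Longrightarrow> prim v"
  by (rule primI) (simp add: dt_swap[of w v])

lemma prim_uminus [simp]: "prim (- v) \<longleftrightarrow> prim v"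
proof -
  have "prim (- v)" if v: "prim v" for v
  proof -
    obtain z where "dt v z = 1" using v unfolding prim_def by blast
    then show ?thesis by (intro primI[of _ z]) simp
  qed
  from this[of v] this[of "- v"] show ?thesis unfolding minus_minus by blast
qed

lemma prim_comb:
  assumes "\<bar>dt a b\<bar> = 1"
  shows "prim (m \<odot> a + n \<odot> b) \<longleftrightarrow> coprime m n"
proof
  assume "prim (m \<odot> a + n \<odot> b)"
  then obtain z where "m * dt a z + n * dt b z = 1" unfolding prim_def by auto
  then have *: "1 = m * dt a z + n * dt b z" by simp
  show "coprime m n"
  proof (rule coprimeI)
    fix c assume "c dvd m" "c dvd n"
    then show "c dvd 1" unfolding * by simp
  qed
next
  assume "coprime m n"
  obtain x y where xy: "x * m + y * n = gcd m n" using bezout_int[of m n] by metis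
  have "dt (m \<odot> a + n \<odot> b) (x \<odot> b - y \<odot> a) = x * m * dt a b - y * n * dt b a"
    by (simp only: dt_simps) (simp add: algebra_simps)
  also have "\<dots> = dt a b * (x * m + y * n)"
    unfolding dt_swap[of a b] by (simp only: algebra_simps mult_minus_right diff_minus_eq_add)
  also have "\<dots> = dt a b" unfolding xy using \<open>coprime m n\<close> by simp
  finally show "prim (m \<odot> a + n \<odot> b)" using assms primI by metis
qed

lemma prim_parallel:
  assumes "prim u" "prim v" "dt u v = 0" shows "u = v \<or> u = - v"
proof -
  obtain z where z: "dt v z = 1" using assms unfolding prim_def by blast
  have u: "u = dt u z \<odot> v" using dt_expand[of v z u] z assms(3) dt_swap[of u v] by simp
  obtain y where y: "dt u y = 1" using assms unfolding prim_def by blast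
  have "dt (dt u z \<odot> v) y = 1" unfolding u[symmetric] by (rule y)
  then have "dt u z = 1 \<or> dt u z = -1" using zmult_eq_1_iff by auto
  then show ?thesis
  proof
    assume e: "dt u z = 1"
    have "u = v" using u unfolding e by simp
    then show ?thesis ..
  next
    assume e: "dt u z = -1"
    have "u = - v" using u unfolding e by simp
    then show ?thesis ..
  qed
qed

text \<open>
  Up to sign, the Farey neighbours of \<open>v\<close> form a single progression with step \<open>v\<close>.
\<close>
lemma neighbours:
  assumes "\<bar>dt v u\<bar> = 1" "\<bar>dt v w\<bar> = 1"
  obtains k where "w = u + k \<odot> v" | k where "w = - u + k \<odot> v"
proof -
  have e: "dt v u \<odot> w = dt w u \<odot> v + dt v w \<odot> u" by (rule dt_expand)
  have "dt v u \<odot> dt v u \<odot> w = w" using assms(1) by (auto simp: prod_eq_iff abs_eq_iff')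
  then have "w = (dt v u * dt v w) \<odot> u + (dt v u * dt w u) \<odot> v"
    unfolding e by (auto simp: prod_eq_iff algebra_simps)
  moreover have "dt v u * dt v w = 1 \<or> dt v u * dt v w = -1" using assms by (auto simp: abs_eq_iff')
  ultimately show thesis using that sc_simps(1,3)[of u] by metis
qed

text \<open>
  In Conway's topograph the values on the edges around \<open>v\<close> form an arithmetic progression
  whose difference is the value at \<open>v\<close>. The condition excludes a change from positive to negative in the
  direction of the progression, which would mean that the difference is negative.
\<close>
definition nonneg :: "(real^3) set \<Rightarrow> int \<times> int \<Rightarrow> bool" where
  "nonneg \<Psi> v \<longleftrightarrow> (\<forall>w. \<bar>dt v w\<bar> = 1 \<longrightarrow> rt v w \<in> \<Psi> \<longrightarrow> rt v (w + v) \<in> \<Psi>)"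

abbreviation nonpos :: "(real^3) set \<Rightarrow> int \<times> int \<Rightarrow> bool" where
  "nonpos \<Psi> v \<equiv> nonneg (uminus ` \<Psi>) v"

lemma mem_uminus_image [simp]: "x \<in> uminus ` A \<longleftrightarrow> - x \<in> (A :: 'a::group_add set)"
  by (metis image_iff minus_minus)

lemma uminus_uminus_image [simp]: "uminus ` uminus ` A = (A :: 'a::group_add set)"
  by (simp add: image_image)

section \<open>Orientations of the Farey edges and signs of the Farey vertices\<close>

text \<open>
  A biclosed set together with the negatives of its complement. In this form no chamber is distinguished.
\<close>
locale orientation =
  fixes \<Psi> :: "(real^3) set"
  assumes roots: "\<Psi> \<subseteq> \<Phi>"
    and total: "x \<in> \<Phi> \<Longrightarrow> x \<in> \<Psi> \<or> - x \<in> \<Psi>"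
    and proper: "x \<in> \<Psi> \<Longrightarrow> - x \<notin> \<Psi>"
    and closed: "\<lbrakk>x \<in> \<Psi>; y \<in> \<Psi>; 0 \<le> a; 0 \<le> b; a *\<^sub>R x + b *\<^sub>R y \<in> \<Phi>\<rbrakk> \<Longrightarrow> a *\<^sub>R x + b *\<^sub>R y \<in> \<Psi>"
begin

lemma not_mem_iff: "x \<in> \<Phi> \<Longrightarrow> x \<notin> \<Psi> \<longleftrightarrow> - x \<in> \<Psi>"
  using total proper by blast

lemma closed': "\<lbrakk>x \<in> \<Psi>; y \<in> \<Psi>; 0 \<le> a; 0 \<le> b; z = a *\<^sub>R x + b *\<^sub>R y; z \<in> \<Phi>\<rbrakk> \<Longrightarrow> z \<in> \<Psi>"
  using closed by blast

lemma reverse: "orientation (uminus ` \<Psi>)"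
proof
  show "uminus ` \<Psi> \<subseteq> \<Phi>" using roots by auto
  show "x \<in> uminus ` \<Psi> \<or> - x \<in> uminus ` \<Psi>" if "x \<in> \<Phi>" for x using total that by auto
  show "- x \<notin> uminus ` \<Psi>" if "x \<in> uminus ` \<Psi>" for x using proper that by auto
  show "a *\<^sub>R x + b *\<^sub>R y \<in> uminus ` \<Psi>"
    if "x \<in> uminus ` \<Psi>" "y \<in> uminus ` \<Psi>" "0 \<le> a" "0 \<le> b" "a *\<^sub>R x + b *\<^sub>R y \<in> \<Phi>" for x y a b
    using that closed[of "-x" "-y" a b] uminus_root[of "a *\<^sub>R x + b *\<^sub>R y"] by auto
qed

lemma pencil_between:
  assumes "\<bar>dt v u\<bar> = 1" "i < j" "j < k" "rt v (u + i \<odot> v) \<in> \<Psi>" "rt v (u + k \<odot> v) \<in> \<Psi>"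
  shows "rt v (u + j \<odot> v) \<in> \<Psi>"
proof -
  define a b :: real where "a = of_int (k - j) / of_int (k - i)" and "b = of_int (j - i) / of_int (k - i)"
  have ki: "of_int (k - i) \<noteq> (0::real)" using assms by simp
  have s: "a + b = 1" using ki by (simp add: a_def b_def add_divide_distrib[symmetric])
  have "of_int (k - j) * of_int i + of_int (j - i) * of_int k = (of_int (k - i) * of_int j :: real)"
    by (simp add: algebra_simps)
  then have t: "a * of_int i + b * of_int k = of_int j"
    using ki unfolding a_def b_def by (simp add: divide_simps)
  have X: "a *\<^sub>R x + b *\<^sub>R x = x" for x :: "real^3"
    using s by (metis scaleR_add_left scaleR_one)
  have Y: "(a * of_int i) *\<^sub>R x + (b * of_int k) *\<^sub>R x = of_int j *\<^sub>R x" for x :: "real^3"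
    using t by (metis scaleR_add_left)
  have "a *\<^sub>R rt v (u + i \<odot> v) + b *\<^sub>R rt v (u + k \<odot> v) =
    (a *\<^sub>R rt v u + b *\<^sub>R rt v u) + ((a * of_int i) *\<^sub>R rt v v + (b * of_int k) *\<^sub>R rt v v)"
    by (simp only: rt_bilinear scaleR_add_right scaleR_scaleR add_ac)
  then have "rt v (u + j \<odot> v) = a *\<^sub>R rt v (u + i \<odot> v) + b *\<^sub>R rt v (u + k \<odot> v)"
    by (simp only: X Y rt_bilinear)
  moreover have "0 \<le> a" "0 \<le> b" using assms by (simp_all add: a_def b_def)
  moreover have "rt v (u + j \<odot> v) \<in> \<Phi>" using assms(1) by (intro rt_root) simp
  ultimately show ?thesis using closed'[OF assms(4,5)] by blast
qed

text \<open>
  A vertex that violates both conditions would give two changes of sign in opposite directions within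
  one pencil, which is a sequence of collinear roots.
\<close>
lemma nonneg_or_nonpos: "nonneg \<Psi> v \<or> nonpos \<Psi> v"
proof (rule ccontr)
  assume "\<not> ?thesis"
  then obtain u w where u: "\<bar>dt v u\<bar> = 1" "rt v u \<in> \<Psi>" "rt v (u + v) \<notin> \<Psi>"
    and w: "\<bar>dt v w\<bar> = 1" "- rt v w \<in> \<Psi>" "- rt v (w + v) \<notin> \<Psi>"
    unfolding nonneg_def by auto
  have r: "rt v (u + k \<odot> v) \<in> \<Phi>" for k using u by (intro rt_root) simp
  interpret rev: orientation "uminus ` \<Psi>" by (rule reverse)
  \<comment> \<open>Both sign changes live in the pencil \<open>rt v (u + i \<odot> v)\<close>; reversing \<open>w\<close> if necessary,
      the second one is at position \<open>k\<close>.\<close>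
  obtain k where k: "- rt v (u + k \<odot> v) \<in> \<Psi>" "rt v (u + (k + 1) \<odot> v) \<in> \<Psi>"
  proof (rule neighbours[OF u(1) w(1)])
    fix k assume k: "w = u + k \<odot> v"
    have e: "w + v = u + (k + 1) \<odot> v" by (simp add: k prod_eq_iff algebra_simps)
    have "- rt v (u + (k + 1) \<odot> v) \<notin> \<Psi>" using w(3) unfolding e .
    then have "rt v (u + (k + 1) \<odot> v) \<in> \<Psi>" using total[OF r] by blast
    moreover have "- rt v (u + k \<odot> v) \<in> \<Psi>" using w(2) unfolding k .
    ultimately show thesis by (rule that[rotated])
  next
    fix k assume k: "w = - u + k \<odot> v"
    have e: "w = - (u + (- k - 1 + 1) \<odot> v)" "w + v = - (u + (- k - 1) \<odot> v)"
      by (simp_all add: k prod_eq_iff algebra_simps)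
    have "rt v (u + (- k - 1 + 1) \<odot> v) \<in> \<Psi>" using w(2) unfolding e(1) rt_uminus minus_minus .
    moreover have "rt v (u + (- k - 1) \<odot> v) \<notin> \<Psi>" using w(3) unfolding e(2) rt_uminus minus_minus .
    then have "- rt v (u + (- k - 1) \<odot> v) \<in> \<Psi>" using total[OF r] by blast
    ultimately show thesis using that[of "- k - 1"] by blast
  qed
  have 0: "rt v (u + 0 \<odot> v) \<in> \<Psi>" and 1: "- rt v (u + 1 \<odot> v) \<in> \<Psi>"
    using u r[of 1] not_mem_iff by auto
  consider "k = 0" | "k > 0" | "k < 0" by linarith
  then show False
  proof cases
    case 1
    then show False using 0 k proper by metis
  next
    case 2
    then show False using pencil_between[OF u(1), of 0 1 "k + 1"] 0 1 k proper by auto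
  next
    case 3
    show False
    proof (cases "k + 1 = 1")
      case False
      then show False using 3 rev.pencil_between[OF u(1), of k "k + 1" 1] 1 k proper by auto
    qed (use 3 in simp)
  qed
qed

lemma nonneg_iterate:
  assumes "nonneg \<Psi> v" "\<bar>dt v u\<bar> = 1" "rt v u \<in> \<Psi>" "0 \<le> k"
  shows "rt v (u + k \<odot> v) \<in> \<Psi>"
  using assms(4)
proof (induction k rule: int_ge_induct)
  case base
  then show ?case using assms by simp
next
  case (step k)
  have "u + (k + 1) \<odot> v = (u + k \<odot> v) + v" by (simp add: prod_eq_iff algebra_simps)
  then show ?case using step assms(1,2) unfolding nonneg_def by (metis add.right_neutral dt_simps(1,5,9) mult_zero_right)
qed

lemma nonneg_uminus [simp]: "nonneg \<Psi> (- v) \<longleftrightarrow> nonneg \<Psi> v"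
proof -
  have "nonneg \<Psi> (- v)" if "nonneg \<Psi> v" for v
    unfolding nonneg_def
  proof (intro allI impI)
    fix w assume "\<bar>dt (- v) w\<bar> = 1" "rt (- v) w \<in> \<Psi>"
    then have "rt v (- w + v) \<in> \<Psi>" using that unfolding nonneg_def
      by (metis abs_minus_cancel dt_simps(2,3) rt_uminus)
    moreover have "rt v (- w + v) = rt (- v) (w + - v)" by (simp add: rt_bilinear)
    ultimately show "rt (- v) (w + - v) \<in> \<Psi>" by simp
  qed
  then show ?thesis by (metis minus_minus)
qed

lemma positive_eventually:
  assumes "\<not> nonpos \<Psi> v" "\<bar>dt v u\<bar> = 1"
  obtains K where "\<And>k. k \<ge> K \<Longrightarrow> rt v (u + k \<odot> v) \<in> \<Psi>"
proof -
  have g: "nonneg \<Psi> v" using assms nonneg_or_nonpos by blast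
  obtain w where w: "\<bar>dt v w\<bar> = 1" "- rt v w \<in> \<Psi>" "- rt v (w + v) \<notin> \<Psi>"
    using assms(1) unfolding nonneg_def by auto
  have p: "rt v (w + v) \<in> \<Psi>" using w total[of "rt v (w + v)"] rt_root by simp
  show thesis
  proof (rule neighbours[OF w(1) assms(2)])
    fix j assume j: "u = w + j \<odot> v"
    show thesis
    proof (rule that[of "1 - j"])
      fix k assume "k \<ge> 1 - j"
      then have "rt v ((w + v) + (k + j - 1) \<odot> v) \<in> \<Psi>" using nonneg_iterate[OF g _ p] w by simp
      moreover have "(w + v) + (k + j - 1) \<odot> v = u + k \<odot> v" by (simp add: j prod_eq_iff algebra_simps)
      ultimately show "rt v (u + k \<odot> v) \<in> \<Psi>" by simp
    qed
  next
    fix j assume j: "u = - w + j \<odot> v"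
    show thesis
    proof (rule that[of "- j"])
      fix k assume "k \<ge> - j"
      then have "rt v (- w + (k + j) \<odot> v) \<in> \<Psi>" using nonneg_iterate[OF g, of "- w" "k + j"] w by simp
      moreover have "- w + (k + j) \<odot> v = u + k \<odot> v" by (simp add: j prod_eq_iff algebra_simps)
      ultimately show "rt v (u + k \<odot> v) \<in> \<Psi>" by simp
    qed
  qed
qed

text \<open>
  Conway's climbing lemma: the edge \<open>{a, b}\<close> points away from \<open>a - b\<close> towards \<open>a + b\<close>, and the two edges
  behind it again point outwards. This is the basis of the induction in \<open>climb\<close>, which follows the
  subtractive Euclidean algorithm.
\<close>
lemma climb_step:
  assumes "\<bar>dt a b\<bar> = 1" "nonneg \<Psi> a" "nonneg \<Psi> b" "rt a b \<in> \<Psi>"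
  shows "\<not> nonpos \<Psi> (a + b)" "rt a (a + b) \<in> \<Psi>" "rt (a + b) b \<in> \<Psi>"
proof -
  have ba: "\<bar>dt b a\<bar> = 1" using assms(1) dt_swap[of a b] by simp
  show 1: "rt a (a + b) \<in> \<Psi>" using assms unfolding nonneg_def by (metis add.commute)
  have "rt b (a + b) \<in> \<Psi>" using assms ba rt_swap[of a b] unfolding nonneg_def by metis
  then show 2: "rt (a + b) b \<in> \<Psi>" by (simp add: rt_swap)
  have "- rt (a + b) (- b) \<in> \<Psi>" "- rt (a + b) (- b + (a + b)) \<notin> \<Psi>"
    using 1 2 proper[OF 1] rt_swap[of a "a + b"] by simp_all
  moreover have "\<bar>dt (a + b) (- b)\<bar> = 1" using assms(1) by simp
  ultimately show "\<not> nonpos \<Psi> (a + b)" unfolding nonneg_def mem_uminus_image by blast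
qed

lemma climb:
  assumes "\<bar>dt a b\<bar> = 1" "nonneg \<Psi> a" "nonneg \<Psi> b" "rt a b \<in> \<Psi>" "coprime m n" "0 < m" "0 < n"
  shows "\<not> nonpos \<Psi> (int m \<odot> a + int n \<odot> b)"
  using assms
proof (induction "m + n" arbitrary: a b m n rule: less_induct)
  case less
  note c = climb_step[OF less.prems(1-4)]
  have g: "nonneg \<Psi> (a + b)" using c nonneg_or_nonpos by blast
  consider "m = n" | "m > n" | "m < n" by linarith
  then show ?case
  proof cases
    case 1
    then have "m = 1" using less.prems by simp
    then show ?thesis using 1 c by simp
  next
    case 2
    have "coprime (m - n) n"
      using gcd_diff1_nat[of n m] 2 less.prems(5) by (simp add: coprime_iff_gcd_eq_1)
    then have "\<not> nonpos \<Psi> (int (m - n) \<odot> a + int n \<odot> (a + b))"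
      by (rule less.hyps[rotated 5]) (use 2 less.prems(1,2,6,7) g c(2) in simp_all)
    moreover have "int (m - n) \<odot> a + int n \<odot> (a + b) = int m \<odot> a + int n \<odot> b"
      using 2 by (simp add: prod_eq_iff of_nat_diff algebra_simps)
    ultimately show ?thesis by simp
  next
    case 3
    have "coprime m (n - m)"
      using gcd_diff1_nat[of m n] 3 less.prems(5) by (simp add: coprime_iff_gcd_eq_1 gcd.commute)
    then have "\<not> nonpos \<Psi> (int m \<odot> (a + b) + int (n - m) \<odot> b)"
      by (rule less.hyps[rotated 5]) (use 3 less.prems(1,3,6,7) g c(3) in simp_all)
    moreover have "int m \<odot> (a + b) + int (n - m) \<odot> b = int m \<odot> a + int n \<odot> b"
      using 3 by (simp add: prod_eq_iff of_nat_diff algebra_simps)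
    ultimately show ?thesis by simp
  qed
qed

lemma nonpos_uminus [simp]: "nonpos \<Psi> (- v) \<longleftrightarrow> nonpos \<Psi> v"
  using orientation.nonneg_uminus[OF reverse] .

text \<open>
  The vertices \<open>m a + n b\<close> with \<open>m, n > 0\<close> are, up to sign, those in the open arc from \<open>a\<close> to \<open>b\<close>; the sign
  of \<open>dt a u * dt u b\<close> tells this arc from the complementary one.
\<close>
lemma climb_arc:
  assumes "\<bar>dt a b\<bar> = 1" "nonneg \<Psi> a" "nonneg \<Psi> b" "rt a b \<in> \<Psi>" "prim u" "dt a u * dt u b > 0"
  shows "\<not> nonpos \<Psi> u"
proof -
  define m n where "m = nat \<bar>dt u b\<bar>" "n = nat \<bar>dt a u\<bar>"
  have mn: "m > 0" "n > 0" using assms(6) by (auto simp: m_n_def)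
  have e: "dt a b \<odot> u = dt u b \<odot> a + dt a u \<odot> b" by (rule dt_expand)
  consider "dt u b > 0" "dt a u > 0" | "dt u b < 0" "dt a u < 0"
    using assms(6) by (auto simp: zero_less_mult_iff)
  then have "int m \<odot> a + int n \<odot> b = dt a b \<odot> u \<or> int m \<odot> a + int n \<odot> b = - (dt a b \<odot> u)"
    unfolding e by cases (simp_all add: m_n_def prod_eq_iff)
  then have u: "int m \<odot> a + int n \<odot> b = u \<or> int m \<odot> a + int n \<odot> b = - u"
    using assms(1) by (auto simp: abs_eq_iff')
  then have "prim (int m \<odot> a + int n \<odot> b)" using assms(5) by auto
  then have "coprime m n" using prim_comb[OF assms(1)] by simp
  then show ?thesis using climb[OF assms(1-4) _ mn] u by auto
qed

text \<open>
  Let \<open>s\<close> be the reflection in \<open>rt a b\<close>. Far out in the pencil of \<open>v = m a + n b\<close> the roots \<open>x\<close> have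
  nonnegative product with \<open>rt a b\<close>, hence \<open>s x\<close> is a nonnegative combination of \<open>x\<close> and \<open>- rt a b\<close>. Both lie in
  \<open>\<Psi>\<close>, so \<open>s x\<close> does, and the \<open>s x\<close> run through the pencil of \<open>m a - n b\<close>.
\<close>
lemma no_reversal:
  assumes "\<bar>dt a b\<bar> = 1" "- rt a b \<in> \<Psi>" "0 < m" "0 < n" "\<not> nonpos \<Psi> (m \<odot> a + n \<odot> b)"
  shows "nonneg \<Psi> (m \<odot> a - n \<odot> b)"
proof (rule ccontr)
  let ?v = "m \<odot> a + n \<odot> b" and ?v' = "m \<odot> a - n \<odot> b"
  assume ng: "\<not> nonneg \<Psi> ?v'"
  interpret rev: orientation "uminus ` \<Psi>" by (rule reverse)
  obtain w where w: "\<bar>dt ?v w\<bar> = 1" using assms(5) unfolding nonneg_def by auto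
  \<comment> \<open>The reflection in the root \<open>rt a b\<close> lifts to \<open>a \<mapsto> a\<close>, \<open>b \<mapsto> - b\<close>.\<close>
  define p q where "p = dt a b * dt w b" "q = dt a b * dt a w"
  have d1: "dt a b * dt a b = 1" using assms(1) by (auto simp: abs_eq_iff')
  have wpq: "w = p \<odot> a + q \<odot> b"
  proof -
    have "dt a b \<odot> dt a b \<odot> w = p \<odot> a + q \<odot> b"
      unfolding dt_expand[of a b w] by (simp add: p_q_def prod_eq_iff algebra_simps)
    moreover have "dt a b \<odot> dt a b \<odot> w = w" using d1 by (simp add: prod_eq_iff mult.assoc[symmetric])
    ultimately show ?thesis by simp
  qed
  let ?w' = "p \<odot> a - q \<odot> b"
  have w': "\<bar>dt ?v' ?w'\<bar> = 1"
    using w dt_swap[of a b] unfolding wpq by (simp add: algebra_simps)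
  obtain K where K: "\<And>k. k \<ge> K \<Longrightarrow> rt ?v (w + k \<odot> ?v) \<in> \<Psi>" using positive_eventually[OF assms(5) w] by metis
  obtain K' where K': "\<And>k. k \<ge> K' \<Longrightarrow> rt ?v' (?w' + k \<odot> ?v') \<in> uminus ` \<Psi>"
    using rev.positive_eventually[of ?v' ?w'] ng w' by auto
  \<comment> \<open>Beyond \<open>K\<close> and \<open>K'\<close> the two pencils have their final signs; the last bound makes the coefficient of \<open>- rt a b\<close> nonnegative.\<close>
  define k where "k = max (max K K') \<bar>m * q + n * p\<bar>"
  have k: "k \<ge> K" "k \<ge> K'" "k \<ge> \<bar>m * q + n * p\<bar>" by (auto simp: k_def)
  have "m * n \<ge> 1" using assms(3,4) by (simp add: int_one_le_iff_zero_less)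
  then have "k * 1 \<le> k * (m * n)" using k by (intro mult_left_mono) auto
  then have c: "m * q + n * p + 2 * (k * (m * n)) \<ge> 0" using k by linarith
  have e: "rt ?v' (?w' + k \<odot> ?v') = 1 *\<^sub>R rt ?v (w + k \<odot> ?v) + of_int (2 * (m * q + n * p + 2 * (k * (m * n)))) *\<^sub>R (- rt a b)"
    by (simp add: vec_eq_iff forall_3 wpq algebra_simps)
  have "(0::real) \<le> of_int (2 * (m * q + n * p + 2 * (k * (m * n))))"
    unfolding of_int_0_le_iff using c by simp
  then have "rt ?v' (?w' + k \<odot> ?v') \<in> \<Psi>"
    by (rule closed'[OF K[OF k(1)] assms(2) zero_le_one _ e]) (use w' in \<open>simp add: rt_root\<close>)
  then show False using K'[OF k(2)] proper by (simp)
qed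

end


section \<open>The positive vertices form an arc\<close>

context orientation
begin

text \<open>
  The two inequalities describe the two open arcs of the projective line that are bounded by \<open>v\<close> and \<open>w\<close>:
  the first one the arc through \<open>v + w\<close>, the second one the arc through \<open>v - w\<close>.
\<close>
definition splits :: "int \<times> int \<Rightarrow> int \<times> int \<Rightarrow> bool" where
  "splits v w \<longleftrightarrow> (\<forall>u. prim u \<longrightarrow> dt v u * dt u w > 0 \<longrightarrow> nonneg \<Psi> u) \<or>
                (\<forall>u. prim u \<longrightarrow> dt v u * dt u w < 0 \<longrightarrow> nonneg \<Psi> u)"

lemma splits_uminus [simp]: "splits v (- w) \<longleftrightarrow> splits v w"
  unfolding splits_def by (simp add: disj_commute)

lemma splits_adjacent:
  assumes "\<bar>dt a b\<bar> = 1" "nonneg \<Psi> a" "nonneg \<Psi> b" shows "splits a b"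
proof -
  have g: "nonneg \<Psi> u" if "\<not> nonpos \<Psi> u" for u using that nonneg_or_nonpos by blast
  from total[OF rt_root[OF assms(1)]] show ?thesis
  proof
    assume "rt a b \<in> \<Psi>"
    then show ?thesis unfolding splits_def using climb_arc[OF assms] g by blast
  next
    assume "- rt a b \<in> \<Psi>"
    then have "rt a (- b) \<in> \<Psi>" by simp
    moreover have "\<bar>dt a (- b)\<bar> = 1" "nonneg \<Psi> (- b)" using assms by simp_all
    ultimately have "nonneg \<Psi> u" if "prim u" "dt a u * dt u (- b) > 0" for u
      using climb_arc[of a "- b" u] assms(2) g that by blast
    then have "splits a (- b)" unfolding splits_def by blast
    then show ?thesis by simp
  qed
qed

text \<open>
  The vertex \<open>t\<close> divides the arc of \<open>v, w\<close> on which it lies into an arc of \<open>v, t\<close> and an arc of \<open>t, w\<close>. If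
  these are the two nonnegative arcs, then so is the arc of \<open>v, w\<close> through \<open>t\<close>. Otherwise one of the nonnegative
  arcs contains the arc of \<open>v, w\<close> that avoids \<open>t\<close>. The sign conditions choose the representative of \<open>t\<close> among
  \<open>t\<close> and \<open>- t\<close>.
\<close>
lemma splits_trans:
  assumes t: "prim t" "nonneg \<Psi> t" "dt v w * dt v t > 0" "dt v w * dt t w > 0"
    and s: "splits v t" "splits t w"
  shows "splits v w"
proof -
  \<comment> \<open>The Pluecker relation expresses \<open>dt t u\<close> by the determinants of \<open>u\<close> with \<open>v\<close> and \<open>w\<close>.\<close>
  have key: "dt v w * dt t u = dt t w * dt v u - dt v t * dt u w" for u
    by (simp add: dt_def algebra_simps)
  have key2: "(dt v w)\<^sup>2 * (dt t u * e) = (dt v w * dt t w) * (dt v u * e) - (dt v w * dt v t) * (dt u w * e)" for u e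
  proof -
    have "(dt v w)\<^sup>2 * (dt t u * e) = dt v w * e * (dt v w * dt t u)" by (simp add: power2_eq_square)
    then show ?thesis unfolding key by (simp add: algebra_simps)
  qed
  have D: "(dt v w)\<^sup>2 > 0" using t(3) by (metis mult_eq_0_iff less_irrefl zero_less_power2)
  consider (both) "\<forall>u. prim u \<longrightarrow> dt v u * dt u t > 0 \<longrightarrow> nonneg \<Psi> u" "\<forall>u. prim u \<longrightarrow> dt t u * dt u w > 0 \<longrightarrow> nonneg \<Psi> u"
    | (left) "\<forall>u. prim u \<longrightarrow> dt v u * dt u t < 0 \<longrightarrow> nonneg \<Psi> u"
    | (right) "\<forall>u. prim u \<longrightarrow> dt t u * dt u w < 0 \<longrightarrow> nonneg \<Psi> u"
    using s unfolding splits_def by blast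
  then show ?thesis
  proof cases
    case both
    have "nonneg \<Psi> u" if u: "prim u" "dt v u * dt u w > 0" for u
    proof (cases "dt t u = 0")
      case True
      then have "t = u \<or> t = - u" by (rule prim_parallel[OF t(1) u(1)])
      then show ?thesis using t(2) nonneg_uminus by metis
    next
      case False
      then have "dt t u * dt u w > 0 \<or> dt v u * - dt t u > 0"
        using u(2) by (auto simp: zero_less_mult_iff mult_less_0_iff)
      then have "dt t u * dt u w > 0 \<or> dt v u * dt u t > 0" by (simp add: dt_swap[of t u])
      then show ?thesis using both u(1) by blast
    qed
    then show ?thesis unfolding splits_def by blast
  next
    case left
    have "nonneg \<Psi> u" if u: "prim u" "dt v u * dt u w < 0" for u
    proof -
      have "(dt v w * dt t w) * (dt v u * dt v u) \<ge> 0" using t(4) by simp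
      moreover have "(dt v w * dt v t) * (dt u w * dt v u) < 0"
        using t(3) u(2) by (metis mult.commute mult_pos_neg)
      ultimately have "(dt v w)\<^sup>2 * (dt t u * dt v u) > 0" unfolding key2 by linarith
      then have "dt t u * dt v u > 0" using D by (simp add: zero_less_mult_iff)
      then have "dt v u * dt u t < 0" unfolding dt_swap[of t u] by (simp add: mult.commute)
      then show ?thesis using left u(1) by blast
    qed
    then show ?thesis unfolding splits_def by blast
  next
    case right
    have "nonneg \<Psi> u" if u: "prim u" "dt v u * dt u w < 0" for u
    proof -
      have "(dt v w * dt t w) * (dt v u * dt u w) < 0" using t(4) u(2) by (rule mult_pos_neg)
      moreover have "(dt v w * dt v t) * (dt u w * dt u w) \<ge> 0" using t(3) by simp
      ultimately have "(dt v w)\<^sup>2 * (dt t u * dt u w) < 0" unfolding key2 by linarith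
      then have "dt t u * dt u w < 0" using D by (simp add: mult_less_0_iff)
      then show ?thesis using right u(1) by blast
    qed
    then show ?thesis unfolding splits_def by blast
  qed
qed

text \<open>
  Induction on the determinant. The first triangle that the chord from \<open>v\<close> to \<open>w\<close> crosses has vertices \<open>v\<close>,
  \<open>t\<close> and \<open>b = v - t\<close>. If \<open>t\<close> or \<open>b\<close> is nonnegative, the chord can be replaced by chords of smaller
  determinant. If both are negative, then one side of the edge \<open>{t, b}\<close> is negative by climbing, but \<open>v\<close> and
  \<open>w\<close> lie on different sides of it.
\<close>
lemma splits_pos:
  assumes "prim v" "prim w" "nonneg \<Psi> v" "nonneg \<Psi> w" "dt v w = int D" "D > 0"
  shows "splits v w"
  using assms
proof (induction D arbitrary: v w rule: less_induct)
  case (less D)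
  interpret rev: orientation "uminus ` \<Psi>" by (rule reverse)
  show ?case
  proof (cases "D = 1")
    case True
    then show ?thesis using less.prems splits_adjacent by simp
  next
    case False
    obtain z where z: "dt v z = 1" using less.prems(1) unfolding prim_def by blast
    \<comment> \<open>Reduce \<open>z\<close> modulo \<open>v\<close> so that \<open>0 \<le> dt t w < D\<close>.\<close>
    define t where "t = z - (dt z w div int D) \<odot> v"
    define e where "e = dt t w"
    have vt: "dt v t = 1" using z by (simp add: t_def)
    have "e = dt z w mod int D"
      using less.prems(5) by (simp add: e_def t_def minus_div_mult_eq_mod)
    then have e: "0 \<le> e" "e < int D" using less.prems(6) by simp_all
    have pt: "prim t" using vt by (intro primI'[of v]) simp
    have "e \<noteq> 0"
    proof
      assume "e = 0"
      then have "t = w \<or> t = - w" using prim_parallel[OF pt less.prems(2)] unfolding e_def by simp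
      then have "\<bar>dt v w\<bar> = 1" using vt by auto
      then show False using less.prems(5) False by simp
    qed
    then have e0: "e > 0" using e by simp
    define b where "b = v - t"
    have vb: "dt v b = -1" using vt by (simp add: b_def)
    have pb: "prim b" using vb by (intro primI'[of v]) simp
    have bw: "dt b w = int D - e" using less.prems(5) by (simp add: b_def e_def)
    have tb: "dt t b = -1" using vt dt_swap[of v t] by (simp add: b_def)
    consider "nonneg \<Psi> t" | "nonneg \<Psi> b" | "\<not> nonneg \<Psi> t" "\<not> nonneg \<Psi> b" by blast
    then show ?thesis
    proof cases
      case 1
      have "splits t w" by (rule less.IH[of "nat e"]) (use e0 e pt 1 less.prems e_def in auto)
      moreover have "splits v t" using splits_adjacent vt 1 less.prems by simp
      ultimately show ?thesis
        using splits_trans[OF pt 1] vt e0 less.prems(5,6) by (simp add: e_def)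
    next
      case 2
      have "splits b w" by (rule less.IH[of "nat (int D - e)"]) (use e0 e pb 2 less.prems bw in auto)
      then have "splits b (- w)" by simp
      moreover have "splits v b" using splits_adjacent vb 2 less.prems by simp
      ultimately have "splits v (- w)"
        using splits_trans[OF pb 2, of v "- w"] vb bw e less.prems(5,6) by (simp add: mult_pos_neg)
      then show ?thesis by simp
    next
      case 3
      then have l: "nonpos \<Psi> t" "nonpos \<Psi> b" using nonneg_or_nonpos by blast+
      have "rt t b \<in> \<Psi> \<or> - rt t b \<in> \<Psi>" using total[OF rt_root[of t b]] tb by simp
      then show ?thesis
      proof (elim disjE)
        assume "- rt t b \<in> \<Psi>"
        then have "\<not> nonneg \<Psi> v"
          using rev.climb_arc[of t b v] l less.prems(1) tb vb vt dt_swap[of v t] by simp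
        then show ?thesis using less.prems by blast
      next
        assume "rt t b \<in> \<Psi>"
        moreover have "dt t w * dt w (- b) > 0" using e0 e bw dt_swap[of b w] by (simp add: e_def)
        ultimately have "\<not> nonneg \<Psi> w"
          using rev.climb_arc[of t "- b" w] l less.prems(2) tb by simp
        then show ?thesis using less.prems by blast
      qed
    qed
  qed
qed

lemma splits_all:
  assumes "prim v" "prim w" "nonneg \<Psi> v" "nonneg \<Psi> w" "dt v w \<noteq> 0"
  shows "splits v w"
proof (cases "dt v w > 0")
  case True
  then show ?thesis using splits_pos[of v w "nat (dt v w)"] assms by simp
next
  case False
  then have "splits v (- w)" using splits_pos[of v "- w" "nat (- dt v w)"] assms by simp
  then show ?thesis by simp
qed

lemma positive_prim: "\<not> nonpos \<Psi> v \<Longrightarrow> prim v" "\<not> nonneg \<Psi> v \<Longrightarrow> prim v"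
  unfolding nonneg_def using primI by blast+

text \<open>
  Going from the positive vertex \<open>v0\<close> to the negative vertex \<open>r0\<close> along one arc, one meets all positive
  vertices before all negative ones: the nonnegative arc of \<open>v0\<close> and \<open>u\<close> cannot be the one through \<open>r0\<close>.
\<close>
lemma positive_before_negative:
  assumes "\<not> nonpos \<Psi> v0" "\<not> nonneg \<Psi> r0" "\<not> nonpos \<Psi> u" "\<not> nonneg \<Psi> w"
    and "dt v0 r0 * dt v0 u > 0" "dt v0 r0 * dt u r0 > 0" "dt v0 r0 * dt v0 w > 0"
  shows "dt v0 r0 * dt u w > 0"
proof (rule ccontr)
  assume n: "\<not> ?thesis"
  have g: "nonneg \<Psi> v0" "nonneg \<Psi> u" using assms nonneg_or_nonpos by blast+
  have p: "prim v0" "prim r0" "prim u" "prim w" using positive_prim assms by blast+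
  have "dt v0 u \<noteq> 0" using assms(5) by auto
  from splits_all[OF p(1,3) g this] show False
    unfolding splits_def
  proof
    assume a: "\<forall>x. prim x \<longrightarrow> 0 < dt v0 x * dt x u \<longrightarrow> nonneg \<Psi> x"
    have "dt u w \<noteq> 0" using prim_parallel[OF p(3,4)] g(2) assms(4) by auto
    then have "dt v0 r0 * dt w u > 0" using n assms(5) dt_swap[of u w] by (auto simp: zero_less_mult_iff mult_less_0_iff)
    then have "dt v0 w * dt w u > 0" using assms(7) by (auto simp: zero_less_mult_iff)
    then show False using a p(4) assms(4) by blast
  next
    assume a: "\<forall>x. prim x \<longrightarrow> dt v0 x * dt x u < 0 \<longrightarrow> nonneg \<Psi> x"
    have "dt v0 r0 * dt r0 u < 0" using assms(6) dt_swap[of u r0] by simp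
    then show False using a p(2) assms(2) by blast
  qed
qed

text \<open>
  If \<open>v\<close> were nonpositive, then being nonnegative as well it would have a pencil without change of sign. Its
  neighbours \<open>b\<close> far out are positive for \<open>F\<close> because they are close to \<open>v\<close>, so climbing from the edge
  \<open>{v, b}\<close> reaches everything outside a small arc next to \<open>v\<close>, in particular \<open>r0\<close>.
\<close>
lemma positive_value:
  assumes F: "\<And>u. F \<bullet> rt u u > 0 \<Longrightarrow> nonneg \<Psi> u" and r0: "\<not> nonneg \<Psi> r0"
    and v: "prim v" "F \<bullet> rt v v > 0"
  shows "\<not> nonpos \<Psi> v"
proof
  assume l: "nonpos \<Psi> v"
  have g: "nonneg \<Psi> v" using F v by blast
  obtain u where u: "\<bar>dt v u\<bar> = 1" "rt v u \<in> \<Psi>"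
  proof -
    obtain z where z: "dt v z = 1" using v(1) unfolding prim_def by blast
    then show thesis using that[of z] that[of "- z"] total[OF rt_root[of v z]] by auto
  qed
  have descend: "rt v (u - int k \<odot> v) \<in> \<Psi>" for k
  proof (induction k)
    case (Suc k)
    show ?case
    proof (rule ccontr)
      let ?w = "u - int (Suc k) \<odot> v"
      assume "rt v ?w \<notin> \<Psi>"
      moreover have w: "\<bar>dt v ?w\<bar> = 1" using u by simp
      ultimately have "- rt v ?w \<in> \<Psi>" using total rt_root by blast
      then have "- rt v (?w + v) \<in> \<Psi>" by (rule l[unfolded nonneg_def mem_uminus_image, rule_format, OF w])
      moreover have "?w + v = u - int k \<odot> v" by (simp add: prod_eq_iff algebra_simps)
      ultimately show False using Suc proper by metis
    qed
  qed (use u in \<open>simp\<close>)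
  have nz: "dt v r0 \<noteq> 0"
  proof
    assume "dt v r0 = 0"
    then have "v = r0 \<or> v = - r0" by (rule prim_parallel[OF v(1) positive_prim(2)[OF r0]])
    then show False using g r0 by auto
  qed
  let ?q = "F \<bullet> rt v v"
  \<comment> \<open>The first summand makes \<open>F\<close> positive at \<open>u - k v\<close>, the last one puts \<open>r0\<close> into the arc from \<open>v\<close> to \<open>u - k v\<close>.\<close>
  obtain k :: nat where k: "real k > (2 * \<bar>F \<bullet> rt u v\<bar> + \<bar>F \<bullet> rt u u\<bar>) / ?q + 1 + \<bar>of_int (dt v r0 * dt r0 u)\<bar>"
    using reals_Archimedean2 by blast
  define a where "a = (2 * \<bar>F \<bullet> rt u v\<bar> + \<bar>F \<bullet> rt u u\<bar>) / ?q"
  have "a \<ge> 0" using v(2) by (simp add: a_def)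
  then have k1: "real k \<ge> 1" "real k > a" "real k > \<bar>of_int (dt v r0 * dt r0 u)\<bar>" using k unfolding a_def[symmetric] by linarith+
  let ?b = "u - int k \<odot> v"
  have "F \<bullet> rt ?b ?b = F \<bullet> rt u u - 2 * k * (F \<bullet> rt u v) + k * (k * ?q)"
  proof -
    have "rt ?b ?b = rt u u - (2 * real k) *\<^sub>R rt u v + (real k * real k) *\<^sub>R rt v v"
      by (simp add: vec_eq_iff forall_3 algebra_simps)
    then show ?thesis by (simp add: inner_diff_right inner_add_right)
  qed
  moreover have "k * ?q > 2 * \<bar>F \<bullet> rt u v\<bar> + \<bar>F \<bullet> rt u u\<bar>"
    using k1(2) v(2) unfolding a_def by (simp add: divide_less_eq)
  then have "k * (k * ?q) \<ge> k * (2 * \<bar>F \<bullet> rt u v\<bar> + \<bar>F \<bullet> rt u u\<bar>)" "k * (k * ?q) \<noteq> k * (2 * \<bar>F \<bullet> rt u v\<bar> + \<bar>F \<bullet> rt u u\<bar>)"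
    using k1(1) by auto
  moreover have "k * \<bar>F \<bullet> rt u u\<bar> \<ge> \<bar>F \<bullet> rt u u\<bar>" using k1(1) by (simp add: mult_le_cancel_right1)
  moreover have "k * \<bar>F \<bullet> rt u v\<bar> \<ge> k * (F \<bullet> rt u v)" by (intro mult_left_mono) auto
  ultimately have "F \<bullet> rt ?b ?b > 0" by (simp add: distrib_left)
  then have gb: "nonneg \<Psi> ?b" by (rule F)
  have "int k > \<bar>dt v r0 * dt r0 u\<bar>" using k1(3) by linarith
  moreover have "(dt v r0)\<^sup>2 \<ge> 1" using nz by (smt (verit) zero_less_power2)
  then have "int k * (dt v r0)\<^sup>2 \<ge> int k" by (simp add: mult_le_cancel_left1)
  ultimately have "dt v r0 * dt r0 u + int k * (dt v r0)\<^sup>2 > 0" by linarith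
  also have "\<dots> = dt v r0 * dt r0 ?b" using dt_swap[of v r0] by (simp add: power2_eq_square algebra_simps)
  finally have "\<not> nonpos \<Psi> r0"
    using climb_arc[of v ?b r0] u g gb descend positive_prim(2)[OF r0] by simp
  then show False using r0 nonneg_or_nonpos by blast
qed

end

section \<open>A quadratic form that induces the orientation\<close>

text \<open>
  With \<open>t = n / m\<close> the two conditions read \<open>\<bar>A + C t^2\<bar> < 2 B t\<close>. They define an open set, which contains
  \<open>sqrt (\<bar>A\<bar> / \<bar>C\<bar>)\<close> unless \<open>A\<close> or \<open>C\<close> is zero.
\<close>
lemma rational_between_roots:
  fixes A B C :: real
  assumes "B > 0" "A * C < B\<^sup>2"
  obtains m n :: nat where "m > 0" "n > 0" "coprime m n"
    "A * m\<^sup>2 + 2 * B * m * n + C * n\<^sup>2 > 0" "A * m\<^sup>2 - 2 * B * m * n + C * n\<^sup>2 < 0"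
proof -
  obtain t where t: "t > 0" "\<bar>A + C * t\<^sup>2\<bar> < 2 * B * t"
  proof -
    consider "C = 0" | "A = 0" "C \<noteq> 0" | "A \<noteq> 0" "C \<noteq> 0" by blast
    then show thesis
    proof cases
      case 1
      show thesis by (rule that[of "\<bar>A\<bar> / (2 * B) + 1"]) (use 1 assms in \<open>auto simp: field_simps add_pos_nonneg\<close>)
    next
      case 2
      show thesis by (rule that[of "B / \<bar>C\<bar>"]) (use 2 assms in \<open>auto simp: abs_mult power2_eq_square field_simps\<close>)
    next
      case 3
      define t where "t = sqrt (\<bar>A\<bar> / \<bar>C\<bar>)"
      have t0: "t > 0" using 3 by (simp add: t_def)
      have t2: "t\<^sup>2 * \<bar>C\<bar> = \<bar>A\<bar>" using 3 by (simp add: t_def)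
      show thesis
      proof (rule that[OF t0])
        show "\<bar>A + C * t\<^sup>2\<bar> < 2 * B * t"
        proof (cases "A * C > 0")
          case True
          then have "\<bar>A\<bar> * \<bar>C\<bar> < B\<^sup>2" using assms(2) by (simp add: abs_mult[symmetric])
          then have "\<bar>A\<bar> * (t\<^sup>2 * \<bar>C\<bar>) < B\<^sup>2 * t\<^sup>2" using t0 by (simp add: mult.assoc[symmetric] mult.commute)
          then have "\<bar>A\<bar>\<^sup>2 < (B * t)\<^sup>2" unfolding t2 by (simp add: power2_eq_square algebra_simps)
          then have "\<bar>A\<bar> < B * t" using assms(1) t0 by (meson less_le mult_pos_pos power2_less_imp_less)
          moreover have "\<bar>A + C * t\<^sup>2\<bar> \<le> \<bar>A\<bar> + \<bar>C\<bar> * t\<^sup>2" by (metis abs_mult abs_power2 abs_triangle_ineq)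
          moreover have "\<bar>C\<bar> * t\<^sup>2 = \<bar>A\<bar>" using t2 by (simp add: mult.commute)
          ultimately show ?thesis by linarith
        next
          case False
          then have "A + C * t\<^sup>2 = 0"
            using t2 3 by (auto simp: zero_less_mult_iff not_less abs_if mult.commute split: if_splits)
          then show ?thesis using assms(1) t0 by simp
        qed
      qed
    qed
  qed
  let ?g = "\<lambda>t. 2 * B * t - \<bar>A + C * t\<^sup>2\<bar>"
  have "isCont ?g t" by (intro continuous_intros)
  then have "(?g \<longlongrightarrow> ?g t) (at t)" by (simp add: isCont_def)
  then have "\<forall>\<^sub>F x in at t. ?g x > 0" using order_tendstoD(1) t(2) by (smt (verit) eventually_mono)
  then obtain \<delta> where \<delta>: "\<delta> > 0" "\<And>x. x \<noteq> t \<Longrightarrow> dist x t < \<delta> \<Longrightarrow> ?g x > 0"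
    unfolding eventually_at by auto
  obtain r where r: "r \<in> \<rat>" "t < r" "r < t + \<delta>" using Rats_dense_in_real[of t "t + \<delta>"] \<delta> by auto
  have gr: "?g r > 0" by (rule \<delta>(2)) (use r in \<open>auto simp: dist_real_def\<close>)
  obtain n m :: nat where nm: "m \<noteq> 0" "\<bar>r\<bar> = real n / real m" "coprime n m"
    using Rats_abs_nat_div_natE r(1) by metis
  have r0: "r > 0" using r t by simp
  then have rr: "real n = r * real m" using nm by simp
  have n0: "n > 0" using rr r0 nm by (metis gr0I mult_pos_pos of_nat_0 of_nat_0_less_iff less_irrefl)
  have m2: "(real m)\<^sup>2 > 0" using nm by simp
  have "A * (real m)\<^sup>2 + 2 * B * m * n + C * (real n)\<^sup>2 = (real m)\<^sup>2 * (A + 2 * B * r + C * r\<^sup>2)"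
    unfolding rr by (simp add: power2_eq_square algebra_simps)
  moreover have "A + 2 * B * r + C * r\<^sup>2 > 0" using gr by linarith
  moreover have "A * (real m)\<^sup>2 - 2 * B * m * n + C * (real n)\<^sup>2 = (real m)\<^sup>2 * (A - 2 * B * r + C * r\<^sup>2)"
    unfolding rr by (simp add: power2_eq_square algebra_simps)
  moreover have "A - 2 * B * r + C * r\<^sup>2 < 0" using gr by linarith
  ultimately show thesis using that[of m n] m2 nm n0 by (simp add: coprime_commute mult_pos_neg)
qed


text \<open>
  Functionals on \<open>V\<close> are quadratic forms, and \<open>rt u w\<close> evaluates the polarization at \<open>u, w\<close>.
\<close>
lemma product_of_linear_forms:
  fixes p q p' q' :: real
  defines "l u \<equiv> p * of_int (fst u) + q * of_int (snd u)"
    and "l' u \<equiv> p' * of_int (fst u) + q' * of_int (snd u)"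
  obtains F :: "real^3" where "\<And>u w. F \<bullet> rt u w = (l u * l' w + l w * l' u) / 2"
proof -
  define A B C where "A = p * p'" "B = (p * q' + q * p') / 2" "C = q * q'"
  have "(vector [C + B, A + B, - B] :: real^3) \<bullet> rt u w = (l u * l' w + l w * l' u) / 2" for u w
    by (simp add: inner_vec_def sum_3 l_def l'_def A_B_C_def field_simps)
  then show thesis by (rule that)
qed

text \<open>
  Homogeneous coordinates \<open>(c, s)\<close> of a slope between the slopes \<open>y / x\<close> of \<open>P\<close> and those of \<open>N\<close>; the slopes
  zero and infinity are needed if \<open>P\<close> or \<open>N\<close> is empty.
\<close>
lemma separate_slopes:
  fixes P N :: "(real \<times> real) set"
  assumes pos: "\<And>x y. (x, y) \<in> P \<union> N \<Longrightarrow> x > 0 \<and> y > 0"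
    and sep: "\<And>x y x' y'. (x, y) \<in> P \<Longrightarrow> (x', y') \<in> N \<Longrightarrow> x * y' - y * x' > 0"
  obtains c s where "c \<ge> 0" "s \<ge> 0" "c + s > 0"
    "\<And>x y. (x, y) \<in> P \<Longrightarrow> c * y \<le> s * x" "\<And>x y. (x, y) \<in> N \<Longrightarrow> s * x \<le> c * y"
proof -
  consider "P = {}" | "N = {}" | "P \<noteq> {}" "N \<noteq> {}" by blast
  then show thesis
  proof cases
    case 1
    show thesis by (rule that[of 1 0]) (use 1 pos in \<open>auto intro: less_imp_le\<close>)
  next
    case 2
    show thesis by (rule that[of 0 1]) (use 2 pos in \<open>auto intro: less_imp_le\<close>)
  next
    case 3
    define S where "S = (\<lambda>(x, y). y / x) ` P"
    have S: "S \<noteq> {}" using 3 by (simp add: S_def)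
    have le: "a \<le> y' / x'" if aS: "a \<in> S" and N': "(x', y') \<in> N" for a x' y'
    proof -
      obtain x y where xy: "(x, y) \<in> P" "a = y / x" using aS by (auto simp: S_def)
      then have "x > 0" "x' > 0" "y * x' \<le> y' * x"
        using pos[of x y] pos[of x' y'] sep[of x y x' y'] N' by (auto simp: mult.commute)
      then show ?thesis unfolding xy(2) by (simp add: pos_le_divide_eq pos_divide_le_eq)
    qed
    obtain x' y' where "(x', y') \<in> N" using 3(2) by auto
    then have bdd: "bdd_above S" using le by (auto simp: bdd_above_def)
    have up: "y / x \<le> Sup S" if "(x, y) \<in> P" for x y
      by (rule cSup_upper[OF _ bdd]) (use that in \<open>force simp: S_def\<close>)
    have down: "Sup S \<le> y / x" if "(x, y) \<in> N" for x y
      by (rule cSup_least[OF S]) (use le that in blast)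
    obtain a b where ab: "(a, b) \<in> P" using 3(1) by auto
    then have "0 \<le> b / a" using pos[of a b] by simp
    then have "0 \<le> Sup S" using up[OF ab] by linarith
    then show thesis
    proof (rule that[of 1, rotated])
      show "1 * y \<le> Sup S * x" if "(x, y) \<in> P" for x y
        using up[OF that] pos[of x y] that by (simp add: divide_simps)
      show "Sup S * x \<le> 1 * y" if "(x, y) \<in> N" for x y
        using down[OF that] pos[of x y] that by (simp add: divide_simps)
    qed (use \<open>0 \<le> Sup S\<close> in auto)
  qed
qed

context orientation
begin

text \<open>
  In the coordinates \<open>x, y\<close> with respect to \<open>v0\<close> and \<open>r0\<close>, the positive and the negative vertices of each
  quadrant are separated by a slope. The product \<open>l1 l2\<close> of the two corresponding linear forms is the
  desired functional \<open>F\<close>. That \<open>F\<close> has the right sign on all edges is the claim \<open>known\<close> in the proof.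
\<close>
lemma exists_functional_aux:
  assumes v0: "\<not> nonpos \<Psi> v0" and r0: "\<not> nonneg \<Psi> r0" and d: "dt v0 r0 > 0"
  obtains F where "F \<noteq> 0" "\<And>x. x \<in> \<Psi> \<Longrightarrow> F \<bullet> x \<ge> 0"
proof -
  interpret rev: orientation "uminus ` \<Psi>" by (rule reverse)
  have gv0: "nonneg \<Psi> v0" and lr0: "nonpos \<Psi> r0" using v0 r0 nonneg_or_nonpos by blast+
  have pv0: "prim v0" and pr0: "prim r0" using positive_prim v0 r0 by blast+
  have plucker: "dt v0 r0 * dt u w = dt u r0 * dt v0 w - dt v0 u * dt w r0" for u w
    by (simp add: dt_def algebra_simps)
  define x y where "x u = real_of_int (dt u r0)" and "y u = real_of_int (dt v0 u)" for u
  have xy_uminus: "x (- u) = - x u" "y (- u) = - y u" for u by (simp_all add: x_def y_def)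
  have xy_zero: "x u = 0 \<longleftrightarrow> dt u r0 = 0" "y u = 0 \<longleftrightarrow> dt v0 u = 0" for u by (simp_all add: x_def y_def)
  have vr: "x v0 = dt v0 r0" "y v0 = 0" "x r0 = 0" "y r0 = dt v0 r0" by (simp_all add: x_def y_def)
  have sep: "x u * y w - y u * x w > 0"
    if "\<not> nonpos \<Psi> u" "\<not> nonneg \<Psi> w" "x u > 0" "y u > 0" "y w > 0" for u w
  proof -
    have "dt v0 r0 * dt u w > 0"
      by (rule positive_before_negative) (use v0 r0 d that in \<open>auto simp: x_def y_def\<close>)
    then have "real_of_int (dt u r0 * dt v0 w - dt v0 u * dt w r0) > 0" unfolding plucker by linarith
    then show ?thesis by (simp add: x_def y_def)
  qed
  have sep': "x u * - y w - - y u * x w > 0"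
    if "\<not> nonpos \<Psi> u" "\<not> nonneg \<Psi> w" "x u > 0" "y u < 0" "y w < 0" for u w
  proof -
    have "dt v0 (- r0) * dt u w > 0"
      by (rule positive_before_negative)
        (use v0 r0 d that in \<open>auto simp: x_def y_def mult_less_0_iff zero_less_mult_iff\<close>)
    then have "dt v0 r0 * dt u w < 0" by simp
    then have "real_of_int (dt u r0 * dt v0 w - dt v0 u * dt w r0) < 0" unfolding plucker by linarith
    then show ?thesis by (simp add: x_def y_def)
  qed
  \<comment> \<open>The slope \<open>s1 / c1\<close> separates the vertices with \<open>x, y > 0\<close>, and \<open>- s2 / c2\<close> those with \<open>x > 0 > y\<close>.\<close>
  obtain c1 s1 where cs1: "c1 \<ge> 0" "s1 \<ge> 0" "c1 + s1 > 0"
    and P1: "\<And>u. \<not> nonpos \<Psi> u \<Longrightarrow> x u > 0 \<Longrightarrow> y u > 0 \<Longrightarrow> c1 * y u \<le> s1 * x u"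
    and N1: "\<And>u. \<not> nonneg \<Psi> u \<Longrightarrow> x u > 0 \<Longrightarrow> y u > 0 \<Longrightarrow> s1 * x u \<le> c1 * y u"
  proof (rule separate_slopes[of "{(x u, y u) | u. \<not> nonpos \<Psi> u \<and> x u > 0 \<and> y u > 0}"
                                 "{(x u, y u) | u. \<not> nonneg \<Psi> u \<and> x u > 0 \<and> y u > 0}"])
    fix c s assume "c \<ge> 0" "s \<ge> 0" "c + s > 0"
      "\<And>a b. (a, b) \<in> {(x u, y u) | u. \<not> nonpos \<Psi> u \<and> x u > 0 \<and> y u > 0} \<Longrightarrow> c * b \<le> s * a"
      "\<And>a b. (a, b) \<in> {(x u, y u) | u. \<not> nonneg \<Psi> u \<and> x u > 0 \<and> y u > 0} \<Longrightarrow> s * a \<le> c * b"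
    then show thesis by (intro that[of c s]) blast+
  qed (use sep in blast)+
  obtain c2 s2 where cs2: "c2 \<ge> 0" "s2 \<ge> 0" "c2 + s2 > 0"
    and P2: "\<And>u. \<not> nonpos \<Psi> u \<Longrightarrow> x u > 0 \<Longrightarrow> y u < 0 \<Longrightarrow> c2 * - y u \<le> s2 * x u"
    and N2: "\<And>u. \<not> nonneg \<Psi> u \<Longrightarrow> x u > 0 \<Longrightarrow> y u < 0 \<Longrightarrow> s2 * x u \<le> c2 * - y u"
  proof (rule separate_slopes[of "{(x u, - y u) | u. \<not> nonpos \<Psi> u \<and> x u > 0 \<and> y u < 0}"
                                 "{(x u, - y u) | u. \<not> nonneg \<Psi> u \<and> x u > 0 \<and> y u < 0}"])
    fix c s assume "c \<ge> 0" "s \<ge> 0" "c + s > 0"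
      "\<And>a b. (a, b) \<in> {(x u, - y u) | u. \<not> nonpos \<Psi> u \<and> x u > 0 \<and> y u < 0} \<Longrightarrow> c * b \<le> s * a"
      "\<And>a b. (a, b) \<in> {(x u, - y u) | u. \<not> nonneg \<Psi> u \<and> x u > 0 \<and> y u < 0} \<Longrightarrow> s * a \<le> c * b"
    then show thesis by (intro that[of c s]) blast+
  qed (use sep' in \<open>auto\<close>)
  define l1 l2 where "l1 u = s1 * x u - c1 * y u" and "l2 u = s2 * x u + c2 * y u" for u
  have l_uminus: "l1 (- u) = - l1 u" "l2 (- u) = - l2 u" for u
    by (simp_all add: l1_def l2_def xy_uminus)
  have Pos: "l1 u * l2 u \<ge> 0" if u: "\<not> nonpos \<Psi> u" for u
  proof -
    have main: "l1 u * l2 u \<ge> 0" if "\<not> nonpos \<Psi> u" "x u > 0" for u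
    proof -
      consider "y u = 0" | "y u > 0" | "y u < 0" by linarith
      then show ?thesis
      proof cases
        case 1
        have "l1 u * l2 u = s1 * s2 * (x u)\<^sup>2" by (simp add: l1_def l2_def 1 power2_eq_square)
        then show ?thesis using cs1 cs2 by simp
      next
        case 2
        then have "l1 u \<ge> 0" "l2 u \<ge> 0" using P1 that cs2 by (simp_all add: l1_def l2_def)
        then show ?thesis by simp
      next
        case 3
        then have "c1 * y u \<le> 0" using cs1 by (simp add: mult_nonneg_nonpos)
        moreover have "s1 * x u \<ge> 0" using cs1 that by simp
        moreover have "l2 u \<ge> 0" using P2[of u] 3 that by (simp add: l1_def l2_def)
        ultimately show ?thesis by (simp add: l1_def l2_def)
      qed
    qed
    have "x u \<noteq> 0"
    proof
      assume "x u = 0"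
      then have "u = r0 \<or> u = - r0" using prim_parallel[OF positive_prim(1)[OF u] pr0] xy_zero by simp
      then show False using u lr0 by auto
    qed
    then consider "x u > 0" | "x (- u) > 0" using xy_uminus by (metis neg_0_less_iff_less linorder_neqE)
    then show ?thesis
      by cases (use main[of u] main[of "- u"] u l_uminus in auto)
  qed
  have Neg: "l1 u * l2 u \<le> 0" if u: "\<not> nonneg \<Psi> u" for u
  proof -
    have main: "l1 u * l2 u \<le> 0" if u: "\<not> nonneg \<Psi> u" "x u > 0" for u
    proof -
      have "y u \<noteq> 0"
      proof
        assume "y u = 0"
        then have "v0 = u \<or> v0 = - u" using prim_parallel[OF pv0 positive_prim(2)[OF u(1)]] xy_zero by simp
        then show False using u gv0 by auto
      qed
      then consider "y u > 0" | "y u < 0" by linarith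
      then show ?thesis
      proof cases
        case 1
        then have "l1 u \<le> 0" "l2 u \<ge> 0" using N1 that cs2 by (simp_all add: l1_def l2_def)
        then show ?thesis by (simp add: mult_nonpos_nonneg)
      next
        case 2
        then have "c1 * y u \<le> 0" using cs1 by (simp add: mult_nonneg_nonpos)
        moreover have "s1 * x u \<ge> 0" using cs1 that by simp
        ultimately have "l1 u \<ge> 0" by (simp add: l1_def l2_def)
        moreover have "l2 u \<le> 0" using N2[of u] 2 that by (simp add: l1_def l2_def)
        ultimately show ?thesis by (simp add: mult_nonneg_nonpos)
      qed
    qed
    consider "x u = 0" | "x u > 0" | "x (- u) > 0" using xy_uminus by (metis neg_0_less_iff_less linorder_neqE)
    then show ?thesis
    proof cases
      case 1
      have "l1 u * l2 u = - (c1 * c2 * (y u)\<^sup>2)" by (simp add: l1_def l2_def 1 power2_eq_square)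
      then show ?thesis using cs1 cs2 by simp
    qed (use main[of u] main[of "- u"] u l_uminus in auto)
  qed
  have l1_eq: "l1 u = (s1 * snd r0 + c1 * snd v0) * of_int (fst u) + (- s1 * fst r0 - c1 * fst v0) * of_int (snd u)" for u
    by (simp add: l1_def l2_def x_def y_def dt_def algebra_simps)
  have l2_eq: "l2 u = (s2 * snd r0 - c2 * snd v0) * of_int (fst u) + (- s2 * fst r0 + c2 * fst v0) * of_int (snd u)" for u
    by (simp add: l1_def l2_def x_def y_def dt_def algebra_simps)
  obtain F where F: "\<And>u w. F \<bullet> rt u w = (l1 u * l2 w + l1 w * l2 u) / 2"
    using product_of_linear_forms[of "s1 * snd r0 + c1 * snd v0" "- s1 * fst r0 - c1 * fst v0"
      "s2 * snd r0 - c2 * snd v0" "- s2 * fst r0 + c2 * fst v0"] unfolding l1_eq[symmetric] l2_eq[symmetric] by metis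
  have q: "F \<bullet> rt u u = l1 u * l2 u" for u by (simp add: F)
  have d': "real_of_int (dt v0 r0) > 0" using d by simp
  have positive: "\<not> nonpos \<Psi> u" if "prim u" "F \<bullet> rt u u > 0" for u
    by (rule positive_value[OF _ r0 that]) (use Neg q in force)
  have negative: "\<not> nonneg \<Psi> u" if "prim u" "F \<bullet> rt u u < 0" for u
    using rev.positive_value[of "- F" v0 u] v0 that Pos q by force
  have known: "rt a b \<in> \<Psi>" if ab: "\<bar>dt a b\<bar> = 1" and B: "F \<bullet> rt a b > 0" for a b
  proof (rule ccontr)
    assume "rt a b \<notin> \<Psi>"
    then have nab: "- rt a b \<in> \<Psi>" using total rt_root ab by blast
    have contra: False if "0 < m" "0 < n" "\<not> nonpos \<Psi> (m \<odot> a + n \<odot> b)" "\<not> nonneg \<Psi> (m \<odot> a - n \<odot> b)" for m n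
      using no_reversal[OF ab nab that(1-3)] that(4) by blast
    have minus: "m \<odot> a - n \<odot> b = m \<odot> a + (- n) \<odot> b" for m n by (simp add: prod_eq_iff)
    have prim2: "prim (m \<odot> a - n \<odot> b) \<longleftrightarrow> prim (m \<odot> a + n \<odot> b)" for m n
      unfolding minus prim_comb[OF ab] by simp
    define A C B' where "A = F \<bullet> rt a a" and "C = F \<bullet> rt b b" and "B' = F \<bullet> rt a b"
    have disc: "B'\<^sup>2 - A * C = ((l1 a * l2 b - l1 b * l2 a) / 2)\<^sup>2"
      unfolding A_def C_def B'_def F by (simp add: power2_eq_square field_simps)
    have val: "F \<bullet> rt (m \<odot> a + n \<odot> b) (m \<odot> a + n \<odot> b) = A * m\<^sup>2 + 2 * B' * m * n + C * n\<^sup>2"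
      "F \<bullet> rt (m \<odot> a - n \<odot> b) (m \<odot> a - n \<odot> b) = A * m\<^sup>2 - 2 * B' * m * n + C * n\<^sup>2" for m n
      unfolding A_def C_def B'_def rt_bilinear inner_add_right inner_diff_right inner_scaleR_right rt_swap[of b a]
      by (simp_all add: power2_eq_square algebra_simps)
    \<comment> \<open>If the form is not a square up to sign, it changes sign under the reflection at some rational point; otherwise it is \<open>x^2\<close> or \<open>- y^2\<close> up to a positive factor, and \<open>r0\<close> or \<open>v0\<close> itself gives the contradiction.\<close>
    show False
    proof (cases "A * C < B'\<^sup>2")
      case True
      obtain m n :: nat where mn: "m > 0" "n > 0" "coprime m n"
        "A * m\<^sup>2 + 2 * B' * m * n + C * n\<^sup>2 > 0" "A * m\<^sup>2 - 2 * B' * m * n + C * n\<^sup>2 < 0"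
        using rational_between_roots[of B' A C] B True unfolding B'_def by metis
      have pr: "prim (int m \<odot> a + int n \<odot> b)" using prim_comb[OF ab] mn by simp
      have "\<not> nonpos \<Psi> (int m \<odot> a + int n \<odot> b)" by (rule positive[OF pr]) (use mn in \<open>simp add: val\<close>)
      moreover have "\<not> nonneg \<Psi> (int m \<odot> a - int n \<odot> b)"
        by (rule negative) (use pr prim2 mn in \<open>simp_all add: val\<close>)
      ultimately show False using contra[of "int m" "int n"] mn by simp
    next
      case False
      then have "((l1 a * l2 b - l1 b * l2 a) / 2)\<^sup>2 \<le> 0" using disc by linarith
      then have ab0: "l1 a * l2 b - l1 b * l2 a = 0" by simp
      have "of_int (dt a b) * (l1 v0 * l2 r0 - l1 r0 * l2 v0) = of_int (dt v0 r0) * (l1 a * l2 b - l1 b * l2 a)"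
        unfolding l1_eq l2_eq by (simp add: dt_def algebra_simps)
      then have "l1 v0 * l2 r0 - l1 r0 * l2 v0 = 0" using ab0 ab by auto
      then have "(s1 * c2 + c1 * s2) * (dt v0 r0)\<^sup>2 = 0"
        by (simp add: l1_def l2_def vr power2_eq_square algebra_simps)
      then have "s1 * c2 + c1 * s2 = 0" using d' by simp
      moreover have "s1 * c2 \<ge> 0" "c1 * s2 \<ge> 0" using cs1 cs2 by simp_all
      ultimately have sc: "s1 * c2 = 0" "c1 * s2 = 0" by linarith+
      then consider "c1 = 0" "c2 = 0" "s1 > 0" "s2 > 0" | "s1 = 0" "s2 = 0" "c1 > 0" "c2 > 0"
        using cs1 cs2 by fastforce
      then show False
      proof cases
        case 1
        have Fx: "F \<bullet> rt u w = s1 * s2 * (x u * x w)" for u w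
          unfolding F by (simp add: l1_def l2_def 1)
        have xx: "x a * x b > 0" using B unfolding Fx by (rule zero_less_mult_pos) (use 1 in simp)
        define m n where "m = \<bar>dt b r0\<bar>" and "n = \<bar>dt a r0\<bar>"
        have sg: "dt a r0 > 0 \<and> dt b r0 > 0 \<or> dt a r0 < 0 \<and> dt b r0 < 0"
          using xx by (auto simp: x_def y_def zero_less_mult_iff)
        have e: "dt a b \<odot> r0 = dt a r0 \<odot> b - dt b r0 \<odot> a"
          unfolding dt_expand[of a b r0] by (simp add: prod_eq_iff dt_def algebra_simps)
        have "m \<odot> a - n \<odot> b = dt a b \<odot> r0 \<or> m \<odot> a - n \<odot> b = - (dt a b \<odot> r0)"
          unfolding e using sg by (auto simp: m_def n_def prod_eq_iff)
        then have mr: "m \<odot> a - n \<odot> b = r0 \<or> m \<odot> a - n \<odot> b = - r0" using ab by (auto simp: abs_eq_iff')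
        then have "prim (m \<odot> a - n \<odot> b)" using pr0 by auto
        then have pr: "prim (m \<odot> a + n \<odot> b)" using prim2 by simp
        have "dt (m \<odot> a + n \<odot> b) r0 \<noteq> 0" using sg by (auto simp: m_def n_def mult_pos_neg mult_pos_pos)
        then have "(x (m \<odot> a + n \<odot> b))\<^sup>2 > 0" unfolding x_def zero_less_power2 of_int_eq_0_iff .
        then have "\<not> nonpos \<Psi> (m \<odot> a + n \<odot> b)"
          by (intro positive[OF pr]) (use 1 in \<open>simp add: Fx power2_eq_square\<close>)
        moreover have "\<not> nonneg \<Psi> (m \<odot> a - n \<odot> b)" using mr r0 by auto
        moreover have "m > 0" "n > 0" using sg by (auto simp: m_def n_def)
        ultimately show False using contra by blast
      next
        case 2
        have Fy: "F \<bullet> rt u w = - (c1 * c2 * (y u * y w))" for u w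
          unfolding F by (simp add: l1_def l2_def 2)
        have "0 < c1 * c2 * - (y a * y b)" using B unfolding Fy by simp
        then have "0 < - (y a * y b)" by (rule zero_less_mult_pos) (use 2 in simp)
        then have yy: "y a * y b < 0" by simp
        define m n where "m = \<bar>dt v0 b\<bar>" and "n = \<bar>dt v0 a\<bar>"
        have sg: "dt v0 a > 0 \<and> dt v0 b < 0 \<or> dt v0 a < 0 \<and> dt v0 b > 0"
          using yy by (auto simp: x_def y_def mult_less_0_iff)
        have e: "dt a b \<odot> v0 = dt v0 b \<odot> a - dt v0 a \<odot> b"
          unfolding dt_expand[of a b v0] by (simp add: prod_eq_iff dt_def algebra_simps)
        have "m \<odot> a + n \<odot> b = dt a b \<odot> v0 \<or> m \<odot> a + n \<odot> b = - (dt a b \<odot> v0)"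
          unfolding e using sg by (auto simp: m_def n_def prod_eq_iff)
        then have mv: "m \<odot> a + n \<odot> b = v0 \<or> m \<odot> a + n \<odot> b = - v0" using ab by (auto simp: abs_eq_iff')
        then have "prim (m \<odot> a + n \<odot> b)" using pv0 by auto
        then have pr: "prim (m \<odot> a - n \<odot> b)" using prim2 by simp
        have "dt v0 (m \<odot> a - n \<odot> b) \<noteq> 0" using sg by (auto simp: m_def n_def mult_pos_neg mult_pos_pos)
        then have "(y (m \<odot> a - n \<odot> b))\<^sup>2 > 0" unfolding y_def zero_less_power2 of_int_eq_0_iff .
        then have "\<not> nonneg \<Psi> (m \<odot> a - n \<odot> b)"
          by (intro negative[OF pr]) (use 2 in \<open>simp add: Fy power2_eq_square\<close>)
        moreover have "\<not> nonpos \<Psi> (m \<odot> a + n \<odot> b)" using mv v0 by auto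
        moreover have "m > 0" "n > 0" using sg by (auto simp: m_def n_def)
        ultimately show False using contra by blast
      qed
    qed
  qed
  have "F \<noteq> 0"
  proof
    assume F0: "F = 0"
    have qz: "l1 u * l2 u = 0" for u using q[of u] by (simp add: F0)
    have "s1 * s2 = 0" "c1 * c2 = 0"
      using qz[of v0] qz[of r0] d by (auto simp: l1_def l2_def vr)
    moreover have "(s1 - c1) * (s2 + c2) = 0"
    proof -
      have "x (v0 + r0) = dt v0 r0" "y (v0 + r0) = dt v0 r0" by (simp_all add: x_def y_def)
      then have "(s1 - c1) * (s2 + c2) * (dt v0 r0)\<^sup>2 = 0"
        using qz[of "v0 + r0"] by (simp add: l1_def l2_def power2_eq_square algebra_simps)
      then show ?thesis using d' by simp
    qed
    ultimately show False using cs1 cs2 by auto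
  qed
  moreover have "F \<bullet> z \<ge> 0" if z: "z \<in> \<Psi>" for z
  proof (rule ccontr)
    assume n: "\<not> F \<bullet> z \<ge> 0"
    obtain a b where ab: "\<bar>dt a b\<bar> = 1" "z = rt a b" using root_is_rt roots z by blast
    have "rt (- a) b \<in> \<Psi>" by (rule known) (use ab n in auto)
    then show False using proper z ab by simp
  qed
  ultimately show thesis by (rule that)
qed

lemma exists_functional:
  assumes v0: "\<not> nonpos \<Psi> v0" and r0: "\<not> nonneg \<Psi> r0"
  obtains F where "F \<noteq> 0" "\<And>x. x \<in> \<Psi> \<Longrightarrow> F \<bullet> x \<ge> 0"
proof -
  have "dt v0 r0 \<noteq> 0"
  proof
    assume "dt v0 r0 = 0"
    then have "v0 = r0 \<or> v0 = - r0" by (rule prim_parallel[OF positive_prim(1)[OF v0] positive_prim(2)[OF r0]])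
    then show False using v0 r0 nonneg_or_nonpos[of r0] by auto
  qed
  then consider "dt v0 r0 > 0" | "dt v0 (- r0) > 0" by force
  then show thesis
    by cases (use exists_functional_aux[OF v0 r0] exists_functional_aux[OF v0, of "- r0"] r0 that in auto)
qed

end


section \<open>Orientations admit no nonnegative relation\<close>

definition positively_independent :: "(real^3) set \<Rightarrow> bool" where
  "positively_independent A \<longleftrightarrow>
     (\<forall>Y c. finite Y \<and> Y \<subseteq> A \<and> (\<forall>y\<in>Y. 0 \<le> c y) \<and> (\<Sum>y\<in>Y. c y *\<^sub>R y) = 0 \<longrightarrow> (\<forall>y\<in>Y. c y = 0))"

lemma positively_independentI:
  assumes "\<And>Y. finite Y \<Longrightarrow> Y \<subseteq> A \<Longrightarrow> \<exists>g :: real^3 \<Rightarrow> real. linear g \<and> (\<forall>y\<in>Y. g y > 0)"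
  shows "positively_independent A"
  unfolding positively_independent_def
proof (intro allI impI)
  fix Y c assume a: "finite Y \<and> Y \<subseteq> A \<and> (\<forall>y\<in>Y. 0 \<le> c y) \<and> (\<Sum>y\<in>Y. c y *\<^sub>R y) = 0"
  then obtain g :: "real^3 \<Rightarrow> real" where g: "linear g" "\<And>y. y \<in> Y \<Longrightarrow> g y > 0" using assms[of Y] by auto
  have "(\<Sum>y\<in>Y. c y * g y) = g (\<Sum>y\<in>Y. c y *\<^sub>R y)"
    by (simp add: linear_sum[OF g(1)] linear_scale[OF g(1)])
  also have "\<dots> = 0" using a linear_0[OF g(1)] by simp
  finally have "\<forall>y\<in>Y. c y * g y = 0"
    using a g by (subst (asm) sum_nonneg_eq_0_iff) (auto intro: mult_nonneg_nonneg less_imp_le)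
  then show "\<forall>y\<in>Y. c y = 0" using g by fastforce
qed

text \<open>
  Gordan's theorem: the convex hull of \<open>Y\<close> is compact and misses the origin.
\<close>
lemma strict_functional:
  assumes "positively_independent A" "finite Y" "Y \<subseteq> A"
  obtains G where "\<And>y. y \<in> Y \<Longrightarrow> G \<bullet> y > 0"
proof -
  have "0 \<notin> convex hull Y"
  proof
    assume "0 \<in> convex hull Y"
    then obtain u where u: "\<forall>x\<in>Y. 0 \<le> u x" "sum u Y = 1" "(\<Sum>x\<in>Y. u x *\<^sub>R x) = 0"
      unfolding convex_hull_finite[OF assms(2)] by auto
    then have "\<forall>x\<in>Y. u x = 0" using assms unfolding positively_independent_def by blast
    then show False using u(2) by simp
  qed
  moreover have "closed (convex hull Y)"
    using assms(2) by (simp add: compact_imp_closed finite_imp_compact_convex_hull)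
  ultimately obtain G b where "0 < b" "\<forall>x\<in>convex hull Y. G \<bullet> x > b"
    using separating_hyperplane_closed_0[of "convex hull Y"] by auto
  then show thesis using that[of G] hull_inc[of _ Y convex] by (meson less_trans)
qed

lemma positively_independent_uminus:
  assumes "positively_independent (uminus ` A)" shows "positively_independent A"
proof (rule positively_independentI)
  fix Y assume Y: "finite Y" "Y \<subseteq> A"
  then have "finite (uminus ` Y)" "uminus ` Y \<subseteq> uminus ` A" by auto
  then obtain G where G: "\<And>y. y \<in> uminus ` Y \<Longrightarrow> G \<bullet> y > 0" using strict_functional[OF assms] by metis
  have "(- G) \<bullet> y > 0" if "y \<in> Y" for y using G[of "- y"] that by simp
  moreover have "linear ((\<bullet>) (- G))" by (rule bounded_linear.linear[OF bounded_linear_inner_right])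
  ultimately show "\<exists>g :: real^3 \<Rightarrow> real. linear g \<and> (\<forall>y\<in>Y. g y > 0)" by blast
qed

lemma weighted_sum_zero:
  fixes c g :: "'a \<Rightarrow> real"
  assumes "finite P" "P \<noteq> {}" "\<And>y. y \<in> P \<Longrightarrow> c y > 0" "(\<Sum>y\<in>P. c y * g y) = 0"
  shows "\<exists>y\<in>P. g y \<le> 0" "\<exists>y\<in>P. g y \<ge> 0"
proof -
  show "\<exists>y\<in>P. g y \<le> 0"
  proof (rule ccontr)
    assume "\<not> ?thesis"
    then have "(\<Sum>y\<in>P. c y * g y) > 0" using assms by (intro sum_pos mult_pos_pos) (auto simp: not_le)
    then show False using assms by simp
  qed
  show "\<exists>y\<in>P. g y \<ge> 0"
  proof (rule ccontr)
    assume "\<not> ?thesis"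
    then have "(\<Sum>y\<in>P. c y * (- g y)) > 0" using assms by (intro sum_pos mult_pos_pos) (auto simp: not_le)
    then show False using assms by (simp add: sum_negf)
  qed
qed

text \<open>
  A nonnegative relation involves only roots with \<open>F \<bullet> y = 0\<close>. In this plane the positive roots are ordered
  by slope, and the relation makes the slopes of those in \<open>\<Psi>\<close> and of those with negative in \<open>\<Psi>\<close>
  overlap. Then some root lies between two roots of the other kind, against closedness.
\<close>
lemma (in orientation) independent_of_functional:
  assumes F: "F \<noteq> 0" "\<And>x. x \<in> \<Psi> \<Longrightarrow> F \<bullet> x \<ge> 0"
  shows "positively_independent \<Psi>"
  unfolding positively_independent_def
proof (intro allI impI)
  fix Y c assume a: "finite Y \<and> Y \<subseteq> \<Psi> \<and> (\<forall>y\<in>Y. 0 \<le> c y) \<and> (\<Sum>y\<in>Y. c y *\<^sub>R y) = 0"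
  define Z where "Z = {y \<in> Y. c y > 0}"
  have Z: "finite Z" "Z \<subseteq> \<Psi>" "\<And>y. y \<in> Z \<Longrightarrow> c y > 0" using a by (auto simp: Z_def)
  have "(\<Sum>y\<in>Z. c y *\<^sub>R y) = (\<Sum>y\<in>Y. c y *\<^sub>R y)"
    by (rule sum.mono_neutral_left) (use a in \<open>auto simp: Z_def order_less_le\<close>)
  then have Zsum: "(\<Sum>y\<in>Z. c y *\<^sub>R y) = 0" using a by simp
  have rel: "(\<Sum>y\<in>Z. c y * g y) = 0" if g: "linear g" for g :: "real^3 \<Rightarrow> real"
  proof -
    have "(\<Sum>y\<in>Z. c y * g y) = g (\<Sum>y\<in>Z. c y *\<^sub>R y)"
      by (simp add: linear_sum[OF g] linear_scale[OF g])
    then show ?thesis using Zsum linear_0[OF g] by simp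
  qed
  have "Z = {}"
  proof (rule ccontr)
    assume ne: "Z \<noteq> {}"
    have "(\<Sum>y\<in>Z. c y * (F \<bullet> y)) = 0"
      by (rule rel) (rule bounded_linear.linear[OF bounded_linear_inner_right])
    moreover have "c y * (F \<bullet> y) \<ge> 0" if "y \<in> Z" for y
      by (rule mult_nonneg_nonneg) (use Z(2) Z(3)[OF that] F(2)[of y] that in auto)
    ultimately have "\<forall>y\<in>Z. c y * (F \<bullet> y) = 0"
      by (subst (asm) sum_nonneg_eq_0_iff[OF Z(1)]) auto
    then have F0: "F \<bullet> y = 0" if "y \<in> Z" for y using Z(3) that by fastforce
    define e :: "real^3" where "e = 1"
    have he: "height x = e \<bullet> x" for x by (simp add: height_def e_def inner_vec_def sum_3)
    have hnz: "height x \<noteq> 0" if "x \<in> \<Phi>" for x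
      using root_cases[OF that] height_pos[of x] height_pos[of "- x"] by (auto simp: linear_neg[OF linear_height])
    define G where "G = cross3 F e"
    have "G \<noteq> 0"
    proof
      assume "G = 0"
      obtain y where y: "y \<in> Z" using ne by blast
      have "cross3 y (cross3 F e) = (y \<bullet> e) *\<^sub>R F - (y \<bullet> F) *\<^sub>R e" by (rule Lagrange)
      then have "height y *\<^sub>R F = 0" using F0[OF y] \<open>G = 0\<close> by (simp add: G_def he inner_commute cross_zero_right)
      then show False using F(1) hnz[of y] y Z(2) roots by auto
    qed
    \<comment> \<open>On the plane orthogonal to \<open>F\<close>, \<open>height\<close> and \<open>G\<close> are coordinates.\<close>
    have inj: "x = x'" if "F \<bullet> x = 0" "F \<bullet> x' = 0" "height x = height x'" "G \<bullet> x = G \<bullet> x'" for x x'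
    proof -
      let ?d = "x - x'"
      have "F \<bullet> ?d = 0" "e \<bullet> ?d = 0" "G \<bullet> ?d = 0" using that he by (simp_all add: inner_diff_right)
      then have "cross3 ?d G = 0" "?d \<bullet> G = 0" unfolding G_def Lagrange by (simp_all add: inner_commute)
      then have "?d = 0 \<or> G = 0" using norm_and_cross_eq_0 by blast
      then show ?thesis using \<open>G \<noteq> 0\<close> by simp
    qed
    define P M where "P = Z \<inter> \<Phi>_pos" and "M = Z - \<Phi>_pos"
    have PM: "finite P" "finite M" "Z = P \<union> M" "P \<inter> M = {}" using Z(1) by (auto simp: P_def M_def)
    have Mneg: "- y \<in> \<Phi>_pos" if "y \<in> M" for y using that Z(2) roots root_cases by (auto simp: M_def)
    have hP: "height y > 0" if "y \<in> P" for y using that height_pos by (auto simp: P_def)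
    have hM: "height y < 0" if "y \<in> M" for y
      using height_pos[OF Mneg[OF that]] by (simp add: linear_neg[OF linear_height])
    have split: "(\<Sum>y\<in>P. c y * g y) + (\<Sum>y\<in>M. c y * g y) = 0" if "linear g" for g :: "real^3 \<Rightarrow> real"
      using rel[OF that] PM by (simp add: sum.union_disjoint)
    have cP: "\<And>y. y \<in> P \<Longrightarrow> c y > 0" and cM: "\<And>y. y \<in> M \<Longrightarrow> c y > 0" using Z(3) by (auto simp: P_def M_def)
    have sP: "(\<Sum>y\<in>P. c y * height y) > 0" if "P \<noteq> {}" using that PM cP hP by (intro sum_pos mult_pos_pos) auto
    have sM: "(\<Sum>y\<in>M. c y * (- height y)) > 0" if "M \<noteq> {}" using that PM cM hM by (intro sum_pos mult_pos_pos) auto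
    have Pne: "P \<noteq> {}"
    proof
      assume "P = {}"
      then have "M \<noteq> {}" "(\<Sum>y\<in>M. c y * height y) = 0" using split[OF linear_height] ne PM(3) by auto
      then show False using sM by (simp add: sum_negf)
    qed
    have Mne: "M \<noteq> {}"
    proof
      assume "M = {}"
      then show False using split[OF linear_height] sP[OF Pne] by simp
    qed
    \<comment> \<open>The common mean slope of the two parts of the relation; \<open>g\<close> compares slopes with it.\<close>
    define \<tau> where "\<tau> = (\<Sum>y\<in>P. c y * (G \<bullet> y)) / (\<Sum>y\<in>P. c y * height y)"
    define g where "g y = G \<bullet> y - \<tau> * height y" for y
    have lg: "linear g" unfolding g_def he
      by (rule linearI) (simp_all add: algebra_simps inner_add_right)
    have gP: "(\<Sum>y\<in>P. c y * g y) = 0"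
    proof -
      have "(\<Sum>y\<in>P. c y * g y) = (\<Sum>y\<in>P. c y * (G \<bullet> y)) - \<tau> * (\<Sum>y\<in>P. c y * height y)"
        by (simp add: g_def sum_subtractf sum_distrib_left algebra_simps)
      then show ?thesis using sP[OF Pne] by (simp add: \<tau>_def)
    qed
    then have gM: "(\<Sum>y\<in>M. c y * g y) = 0" using split[OF lg] by simp
    obtain a1 a2 where a12: "a1 \<in> P" "g a1 \<le> 0" "a2 \<in> P" "g a2 \<ge> 0"
      using weighted_sum_zero[OF PM(1) Pne cP gP] by blast
    obtain m1 m2 where m12: "m1 \<in> M" "g m1 \<ge> 0" "m2 \<in> M" "g m2 \<le> 0"
      using weighted_sum_zero[OF PM(2) Mne cM gM] by blast
    have cone: "\<exists>p q. 0 \<le> p \<and> 0 \<le> q \<and> x = p *\<^sub>R a + q *\<^sub>R b"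
      if "F \<bullet> a = 0" "F \<bullet> b = 0" "F \<bullet> x = 0" "height a > 0" "height b > 0" "height x > 0"
        "g a / height a \<le> g x / height x" "g x / height x \<le> g b / height b" for a b x
    proof (cases "g a / height a = g b / height b")
      case True
      then have e: "g x / height x = g a / height a" using that by simp
      have "G \<bullet> x = (height x / height a) * (G \<bullet> a)"
        using e that by (simp add: g_def field_simps)
      then have "x = (height x / height a) *\<^sub>R a"
        by (intro inj) (use that in \<open>simp_all add: linear_scale[OF linear_height]\<close>)
      then show ?thesis using that by (intro exI[of _ "height x / height a"] exI[of _ 0]) simp
    next
      case False
      define sa sb sx where "sa = g a / height a" "sb = g b / height b" "sx = g x / height x"
      have s: "sa < sb" "sa \<le> sx" "sx \<le> sb" using False that by (auto simp: sa_sb_sx_def)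
      have gs: "g a = sa * height a" "g b = sb * height b" "g x = sx * height x"
        using that by (simp_all add: sa_sb_sx_def)
      define k where "k = (sx - sa) / (sb - sa)"
      have l: "0 \<le> k" "k \<le> 1" "sx = (1 - k) * sa + k * sb"
        using s by (auto simp: k_def divide_simps) (simp add: algebra_simps)
      define p q where "p = (1 - k) * height x / height a" "q = k * height x / height b"
      have pq: "0 \<le> p" "0 \<le> q" using l that by (auto simp: p_q_def)
      let ?z = "p *\<^sub>R a + q *\<^sub>R b"
      have ph: "p * height a = (1 - k) * height x" "q * height b = k * height x"
        using that by (auto simp: p_q_def)
      have hz: "height ?z = height x"
        using ph by (simp add: linear_add[OF linear_height] linear_scale[OF linear_height] algebra_simps)
      have "g ?z = sa * (p * height a) + sb * (q * height b)"
        unfolding linear_add[OF lg] linear_scale[OF lg] gs(1,2) by (simp add: mult.left_commute)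
      also have "\<dots> = sx * height x" unfolding ph l(3) by (simp add: algebra_simps)
      finally have "g ?z = g x" unfolding gs(3) .
      then have Gz: "G \<bullet> ?z = G \<bullet> x" using hz unfolding g_def by simp
      have Fz: "F \<bullet> ?z = 0" using that by (simp add: inner_add_right)
      have "x = ?z" by (rule inj[OF that(3) Fz hz[symmetric] Gz[symmetric]])
      then show ?thesis using pq by blast
    qed
    let ?n1 = "- m1" and ?n2 = "- m2"
    have pos: "height a1 > 0" "height a2 > 0" "height ?n1 > 0" "height ?n2 > 0"
      using a12 m12 hP hM by (auto simp: linear_neg[OF linear_height])
    have in\<Psi>: "a1 \<in> \<Psi>" "a2 \<in> \<Psi>" "m1 \<in> \<Psi>" "m2 \<in> \<Psi>" using a12 m12 Z(2) by (auto simp: P_def M_def)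
    have F4: "F \<bullet> a1 = 0" "F \<bullet> a2 = 0" "F \<bullet> ?n1 = 0" "F \<bullet> ?n2 = 0"
      using F0 a12 m12 by (auto simp: P_def M_def)
    have sg: "g a1 / height a1 \<le> 0" "0 \<le> g a2 / height a2" "g ?n1 / height ?n1 \<le> 0" "0 \<le> g ?n2 / height ?n2"
      using a12 m12 pos by (auto simp: linear_neg[OF lg] divide_nonpos_pos)
    show False
    proof (cases "g a1 / height a1 \<le> g ?n1 / height ?n1")
      case True
      moreover have "g ?n1 / height ?n1 \<le> g a2 / height a2" using sg by linarith
      ultimately obtain p q where pq: "0 \<le> p" "0 \<le> q" "?n1 = p *\<^sub>R a1 + q *\<^sub>R a2"
        using cone[OF F4(1,2,3) pos(1,2,3)] by blast
      have "?n1 \<in> \<Psi>" by (rule closed'[OF in\<Psi>(1,2) pq]) (use in\<Psi> roots in auto)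
      then show False using proper in\<Psi> by blast
    next
      case False
      then have "g ?n1 / height ?n1 \<le> g a1 / height a1" "g a1 / height a1 \<le> g ?n2 / height ?n2" using sg by linarith+
      then obtain p q where pq: "0 \<le> p" "0 \<le> q" "a1 = p *\<^sub>R ?n1 + q *\<^sub>R ?n2"
        using cone[OF F4(3,4,1) pos(3,4,1)] by blast
      have e: "- a1 = p *\<^sub>R m1 + q *\<^sub>R m2" by (subst pq(3)) simp
      have "- a1 \<in> \<Psi>" by (rule closed'[OF in\<Psi>(3,4) pq(1,2) e]) (use in\<Psi> roots in auto)
      then show False using proper in\<Psi> by blast
    qed
  qed
  then show "\<forall>y\<in>Y. c y = 0" using a by (force simp: Z_def)
qed

text \<open>
  The last condition says that \<open>\<Psi>\<close> orients at most one wall of each chamber outwards. Quantifying over all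
  chambers makes the property invariant under the group.
\<close>
definition one_descent :: "(real^3) set \<Rightarrow> bool" where
  "one_descent \<Psi> \<longleftrightarrow> \<Psi> \<subseteq> \<Phi> \<and> (\<forall>x\<in>\<Phi>. x \<in> \<Psi> \<or> - x \<in> \<Psi>) \<and> (\<forall>x\<in>\<Psi>. - x \<notin> \<Psi>) \<and>
     (\<forall>u i j. - act u (\<alpha> i) \<in> \<Psi> \<longrightarrow> - act u (\<alpha> j) \<in> \<Psi> \<longrightarrow> i = j)"

lemma one_descent_total: assumes "one_descent \<Psi>" "x \<in> \<Phi>" "x \<notin> \<Psi>" shows "- x \<in> \<Psi>"
proof -
  have "\<forall>x\<in>\<Phi>. x \<in> \<Psi> \<or> - x \<in> \<Psi>" using assms(1) unfolding one_descent_def by (elim conjE)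
  from bspec[OF this assms(2)] show ?thesis using assms(3) by simp
qed

lemma one_descent_proper: assumes "one_descent \<Psi>" "x \<in> \<Psi>" shows "- x \<notin> \<Psi>"
proof -
  have "\<forall>x\<in>\<Psi>. - x \<notin> \<Psi>" using assms(1) unfolding one_descent_def by (elim conjE)
  from bspec[OF this assms(2)] show ?thesis .
qed

lemma one_descent_unique:
  assumes "one_descent \<Psi>" "- act u (\<alpha> i) \<in> \<Psi>" "- act u (\<alpha> j) \<in> \<Psi>" shows "i = j"
proof -
  have "\<forall>u i j. - act u (\<alpha> i) \<in> \<Psi> \<longrightarrow> - act u (\<alpha> j) \<in> \<Psi> \<longrightarrow> i = j"
    using assms(1) unfolding one_descent_def by (elim conjE)
  then show ?thesis using assms(2,3) by simp
qed

lemma mem_reflection_image [simp]: "x \<in> reflection i ` A \<longleftrightarrow> reflection i x \<in> A"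
proof
  assume "reflection i x \<in> A"
  then have "reflection i (reflection i x) \<in> reflection i ` A" by (rule imageI)
  then show "x \<in> reflection i ` A" by (simp only: reflection_involution)
qed (auto simp: reflection_involution)

lemma reflection_uminus: "reflection i (- x) = - reflection i x"
  by (rule linear_neg[OF linear_reflection])

lemma reflection_self: "reflection i (\<alpha> i) = - \<alpha> i"
  by (simp add: reflection_def form_\<alpha> scaleR_2)

lemma one_descent_reflection:
  assumes "one_descent \<Psi>" shows "one_descent (reflection i ` \<Psi>)"
  unfolding one_descent_def
proof (intro conjI allI impI ballI)
  show "reflection i ` \<Psi> \<subseteq> \<Phi>" using assms reflection_root by (auto simp: one_descent_def)
  show "x \<in> reflection i ` \<Psi> \<or> - x \<in> reflection i ` \<Psi>" if "x \<in> \<Phi>" for x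
    using one_descent_total[OF assms reflection_root[OF that]] by (auto simp: reflection_uminus)
  show "- x \<notin> reflection i ` \<Psi>" if "x \<in> reflection i ` \<Psi>" for x
    using one_descent_proper[OF assms] that by (simp add: reflection_uminus)
  show "j = k" if "- act u (\<alpha> j) \<in> reflection i ` \<Psi>" "- act u (\<alpha> k) \<in> reflection i ` \<Psi>" for u j k
  proof -
    have "- act (u3_mult (gen i) u) (\<alpha> j) \<in> \<Psi>" "- act (u3_mult (gen i) u) (\<alpha> k) \<in> \<Psi>"
      using that unfolding mem_reflection_image by (simp_all add: act_mult act_gen reflection_uminus)
    then show ?thesis by (rule one_descent_unique[OF assms])
  qed
qed

lemma one_descent_simple:
  assumes "one_descent \<Psi>" "- \<alpha> i \<in> \<Psi>" "j \<noteq> i" shows "\<alpha> j \<in> \<Psi>"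
proof -
  have "- act u3_one (\<alpha> i) \<in> \<Psi>" using assms by (simp add: act_one)
  then have "- act u3_one (\<alpha> j) \<notin> \<Psi>" using one_descent_unique[OF assms(1)] assms(3) by metis
  then have "- \<alpha> j \<notin> \<Psi>" by (simp add: act_one)
  then show ?thesis using one_descent_total[OF assms(1) simple_root] by blast
qed

text \<open>
  The roots with \<open>form (\<alpha> i) x > 0\<close> are those behind the wall \<open>\<alpha> i\<close>. If \<open>\<Psi>\<close> orients this wall inwards, then
  seen from the chamber behind it, the wall is the one that is oriented outwards; hence the other two walls
  there are oriented inwards, and so on.
\<close>
lemma one_descent_cone:
  assumes "one_descent \<Psi>" "x \<in> \<Phi>_pos" "\<alpha> i \<in> \<Psi>" "form (\<alpha> i) x > 0"
  shows "x \<in> \<Psi>"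
proof -
  obtain n where "height x = real n" using height_nat assms(2) by blast
  then show ?thesis using assms
  proof (induction n arbitrary: x i \<Psi> rule: less_induct)
    case (less n)
    show ?case
    proof (cases "x = \<alpha> i")
      case False
      note f = less.prems(5)
      let ?x = "reflection i x" and ?\<Psi> = "reflection i ` \<Psi>"
      have p: "?x \<in> \<Phi>_pos" using reflection_pos less.prems(3) False by blast
      obtain m where m: "height ?x = real m" using height_nat p by blast
      then have mn: "m < n" using f less.prems(1) height_reflection[of i x] by simp
      have d: "one_descent ?\<Psi>" using one_descent_reflection less.prems(2) .
      have "- \<alpha> i \<in> ?\<Psi>" using less.prems(4) unfolding mem_reflection_image by (simp add: reflection_uminus reflection_self)
      then have s: "\<alpha> j \<in> ?\<Psi>" if "j \<noteq> i" for j using one_descent_simple[OF d] that by blast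
      have fi: "form (\<alpha> i) ?x < 0"
        using f form_reflection[of i "\<alpha> i" x] by (simp add: reflection_self form_eq algebra_simps)
      obtain j where j: "form (\<alpha> j) ?x > 0" using descent_exists[OF p] by blast
      have "j \<noteq> i" using j fi by auto
      then have "?x \<in> ?\<Psi>" using less.IH[OF mn m d p s j] by blast
      then show ?thesis by (simp add: reflection_involution)
    qed (use less.prems in simp)
  qed
qed

text \<open>
  By \<open>one_descent_cone\<close> all negative roots of \<open>\<Psi>\<close> lie behind the unique wall \<open>\<alpha> j\<close> with \<open>- \<alpha> j \<in> \<Psi>\<close>.
  The reflection in this wall keeps the positive roots of \<open>\<Psi>\<close> positive and lowers the total height of the
  negative ones, so the induction ends with positive roots, on which \<open>height\<close> is positive.
\<close>
lemma one_descent_functional: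
  assumes "one_descent \<Psi>" "finite Y" "Y \<subseteq> \<Psi>"
  shows "\<exists>g :: real^3 \<Rightarrow> real. linear g \<and> (\<forall>y\<in>Y. g y > 0)"
proof -
  \<comment> \<open>The height of \<open>- y\<close> if \<open>y\<close> is a negative root, and zero if it is a positive one.\<close>
  define w where "w y = nat \<lfloor>- height y\<rfloor>" for y
  show ?thesis using assms
  proof (induction "\<Sum>y\<in>Y. w y" arbitrary: Y \<Psi> rule: less_induct)
    case less
    have roots: "y \<in> \<Phi>" if "y \<in> Y" for y using that less.prems unfolding one_descent_def by blast
    show ?case
    proof (cases "Y \<subseteq> \<Phi>_pos")
      case True
      then show ?thesis using linear_height height_pos by blast
    next
      case False
      have ex: "\<exists>j. - \<alpha> j \<in> \<Psi> \<and> form (\<alpha> j) (- y) > 0" if y: "y \<in> Y" "- y \<in> \<Phi>_pos" for y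
      proof -
        obtain j where j: "form (\<alpha> j) (- y) > 0" using descent_exists[OF y(2)] by blast
        have "\<alpha> j \<notin> \<Psi>"
        proof
          assume "\<alpha> j \<in> \<Psi>"
          then have "- y \<in> \<Psi>" using one_descent_cone less.prems(1) y(2) j by blast
          then show False using one_descent_proper[OF less.prems(1)] less.prems(3) y(1) by blast
        qed
        then show ?thesis using j one_descent_total[OF less.prems(1) simple_root] by blast
      qed
      obtain y0 where y0: "y0 \<in> Y" "- y0 \<in> \<Phi>_pos" using False roots root_cases by blast
      obtain j where j: "- \<alpha> j \<in> \<Psi>" using ex[OF y0] by blast
      have dj: "form (\<alpha> j) (- y) > 0" if y: "y \<in> Y" "- y \<in> \<Phi>_pos" for y
      proof -
        obtain k where k: "- \<alpha> k \<in> \<Psi>" "form (\<alpha> k) (- y) > 0" using ex[OF y] by blast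
        have "k = j" using one_descent_simple[OF less.prems(1) j, of k] one_descent_proper[OF less.prems(1), of "\<alpha> k"] k(1) by blast
        then show ?thesis using k by simp
      qed
      let ?r = "reflection j"
      have small: "w (?r y) < w y" if y: "y \<in> Y" "- y \<in> \<Phi>_pos" for y
      proof -
        obtain n where n: "height (- y) = real n" using height_nat y(2) by blast
        have wn: "w y = n" using n by (simp add: w_def linear_neg[OF linear_height])
        have n0: "n > 0" using n height_pos[OF y(2)] by simp
        show ?thesis
        proof (cases "- y = \<alpha> j")
          case True
          then have "?r y = \<alpha> j" using reflection_self reflection_uminus by (metis minus_minus)
          then have "w (?r y) = 0" using height_pos[OF simple_pos[of j]] by (simp add: w_def)
          then show ?thesis using wn n0 by simp
        next
          case False
          then have "height (?r (- y)) < height (- y)" using dj[OF y] height_reflection by simp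
          moreover obtain m where m: "height (?r (- y)) = real m" using height_nat reflection_pos[OF y(2) False] by blast
          moreover have "w (?r y) = m" using m by (simp add: w_def reflection_uminus linear_neg[OF linear_height])
          ultimately show ?thesis using wn n by simp
        qed
      qed
      have le: "w (?r y) \<le> w y" if y: "y \<in> Y" for y
      proof (cases "y \<in> \<Phi>_pos")
        case True
        have "y \<noteq> \<alpha> j" using y j less.prems(3) one_descent_proper[OF less.prems(1), of y] by blast
        then have "height (?r y) > 0" using height_pos reflection_pos True by blast
        then show ?thesis by (simp add: w_def)
      next
        case False
        then show ?thesis using small y roots root_cases less_imp_le by blast
      qed
      have inj: "inj_on ?r Y" by (rule inj_on_inverseI[of _ ?r]) (rule reflection_involution)
      have "(\<Sum>y\<in>?r ` Y. w y) = (\<Sum>y\<in>Y. w (?r y))" using inj by (simp add: sum.reindex)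
      also have "\<dots> < (\<Sum>y\<in>Y. w y)"
        by (rule sum_strict_mono_ex1) (use less.prems le small y0 in auto)
      finally obtain g :: "real^3 \<Rightarrow> real" where g: "linear g" "\<forall>y\<in>?r ` Y. g y > 0"
        using less.hyps[OF _ one_descent_reflection[OF less.prems(1)], of "?r ` Y"] less.prems by blast
      have "linear (g \<circ> ?r)" using linear_compose[OF linear_reflection g(1)] .
      then show ?thesis using g(2) by (intro exI[of _ "g \<circ> ?r"]) auto
    qed
  qed
qed

text \<open>
  Two walls that are oriented outwards meet in a vertex of the chamber, and this vertex is negative.
\<close>
lemma (in orientation) all_nonneg_one_descent:
  assumes "\<And>v. nonneg \<Psi> v" shows "one_descent \<Psi>"
  unfolding one_descent_def
proof (intro conjI allI impI ballI)
  show "x \<in> \<Psi> \<or> - x \<in> \<Psi>" if "x \<in> \<Phi>" for x using total that .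
  show "- x \<notin> \<Psi>" if "x \<in> \<Psi>" for x using proper that .
  fix u i j assume ij: "- act u (\<alpha> i) \<in> \<Psi>" "- act u (\<alpha> j) \<in> \<Psi>"
  obtain a b where ab: "\<bar>dt a b\<bar> = 1" "act u (\<alpha> 1) = rt b (a + b)"
    "act u (\<alpha> 2) = rt a (a + b)" "act u (\<alpha> 3) = - rt a b" using chamber_superbase by blast
  have ba: "\<bar>dt b a\<bar> = 1" using ab(1) dt_swap[of a b] by simp
  have g: "rt v (w + v) \<in> \<Psi>" if "\<bar>dt v w\<bar> = 1" "rt v w \<in> \<Psi>" for v w
    using assms that unfolding nonneg_def by blast
  have 1: "\<not> (- act u (\<alpha> 1) \<in> \<Psi> \<and> - act u (\<alpha> 2) \<in> \<Psi>)"
    using g[of "a + b" "- b"] ab proper[of "rt a (a + b)"] rt_swap[of "a + b"] by auto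
  have 2: "\<not> (- act u (\<alpha> 1) \<in> \<Psi> \<and> - act u (\<alpha> 3) \<in> \<Psi>)"
    using g[of b a] ab ba proper[of "rt b (a + b)"] rt_swap[of a b] by auto
  have 3: "\<not> (- act u (\<alpha> 2) \<in> \<Psi> \<and> - act u (\<alpha> 3) \<in> \<Psi>)"
    using g[of a b] ab proper[of "rt a (a + b)"] by (auto simp: add.commute)
  show "i = j" using 1 2 3 ij exhaust_3[of i] exhaust_3[of j] by auto
qed (rule roots)

theorem (in orientation) independent: "positively_independent \<Psi>"
proof -
  consider "\<And>v. nonneg \<Psi> v" | "\<And>v. nonpos \<Psi> v" | v r where "\<not> nonpos \<Psi> v" "\<not> nonneg \<Psi> r" by blast
  then show ?thesis
  proof cases
    case 1
    then show ?thesis by (intro positively_independentI one_descent_functional[OF all_nonneg_one_descent])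
  next
    case 2
    then have "one_descent (uminus ` \<Psi>)" using orientation.all_nonneg_one_descent[OF reverse] by blast
    then have "positively_independent (uminus ` \<Psi>)" by (intro positively_independentI one_descent_functional)
    then show ?thesis by (rule positively_independent_uminus)
  next
    case 3
    obtain F where "F \<noteq> 0" "\<And>x. x \<in> \<Psi> \<Longrightarrow> F \<bullet> x \<ge> 0" using exists_functional[OF 3] by metis
    then show ?thesis by (rule independent_of_functional)
  qed
qed


section \<open>Biclosed sets are weakly separable\<close>

lemma Span_pair: "Span_nonneg {x, y :: 'a::real_vector} = {a *\<^sub>R x + b *\<^sub>R y | a b. 0 \<le> a \<and> 0 \<le> b}"
proof (intro equalityI subsetI)
  fix z assume "z \<in> Span_nonneg {x, y}"
  then obtain F c where z: "z = (\<Sum>v\<in>F. c v *\<^sub>R v)" "F \<subseteq> {x, y}" "\<forall>v\<in>F. 0 \<le> c v"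
    unfolding Span_nonneg_def by blast
  consider "F = {}" | "F = {x}" | "F = {y}" | "F = {x, y}" "x \<noteq> y" using z(2) by blast
  then have "\<exists>a b. 0 \<le> a \<and> 0 \<le> b \<and> z = a *\<^sub>R x + b *\<^sub>R y"
  proof cases
    case 1
    then show ?thesis using z by (intro exI[of _ 0]) simp
  next
    case 2
    then show ?thesis using z by (intro exI[of _ "c x"] exI[of _ 0]) simp
  next
    case 3
    then show ?thesis using z by (intro exI[of _ 0] exI[of _ "c y"]) simp
  next
    case 4
    then show ?thesis using z by (intro exI[of _ "c x"] exI[of _ "c y"]) simp
  qed
  then show "z \<in> {a *\<^sub>R x + b *\<^sub>R y | a b. 0 \<le> a \<and> 0 \<le> b}" by blast
next
  fix z assume "z \<in> {a *\<^sub>R x + b *\<^sub>R y | a b. 0 \<le> a \<and> 0 \<le> b}"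
  then obtain a b where ab: "z = a *\<^sub>R x + b *\<^sub>R y" "0 \<le> a" "0 \<le> b" by blast
  show "z \<in> Span_nonneg {x, y}"
  proof (cases "x = y")
    case True
    have "z = (\<Sum>v\<in>{x}. (a + b) *\<^sub>R v)" using ab True by (simp add: scaleR_add_left)
    then show ?thesis unfolding Span_nonneg_def using ab True
      by (intro CollectI exI[of _ "{x}"] exI[of _ "\<lambda>_. a + b"]) simp
  next
    case False
    then have "z = (\<Sum>v\<in>{x, y}. (if v = x then a else b) *\<^sub>R v)" using ab by simp
    then show ?thesis unfolding Span_nonneg_def using ab
      by (intro CollectI exI[of _ "{x, y}"] exI[of _ "\<lambda>v. if v = x then a else b"]) simp
  qed
qed

lemma closed_roots_iff:
  "closed_roots R \<longleftrightarrow> R \<subseteq> \<Phi>_pos \<and>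
     (\<forall>x\<in>R. \<forall>y\<in>R. \<forall>a b. 0 \<le> a \<longrightarrow> 0 \<le> b \<longrightarrow> a *\<^sub>R x + b *\<^sub>R y \<in> \<Phi>_pos \<longrightarrow> a *\<^sub>R x + b *\<^sub>R y \<in> R)"
  unfolding closed_roots_def Span_pair by blast

lemma closed_rootsD:
  assumes "closed_roots R" "x \<in> R" "y \<in> R" "0 \<le> a" "0 \<le> b" "z = a *\<^sub>R x + b *\<^sub>R y" "z \<in> \<Phi>_pos"
  shows "z \<in> R"
  using assms unfolding closed_roots_iff by metis

lemma biclosed_complement: "biclosed R \<Longrightarrow> biclosed (\<Phi>_pos - R)"
  unfolding biclosed_def by (simp add: double_diff)

lemma biclosedD:
  assumes "biclosed R" shows "R \<subseteq> \<Phi>_pos" "closed_roots R" "closed_roots (\<Phi>_pos - R)"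
  using assms by (simp_all add: biclosed_def)

definition orient :: "(real^3) set \<Rightarrow> (real^3) set" where
  "orient R = R \<union> uminus ` (\<Phi>_pos - R)"

text \<open>
  If \<open>z = a x - b n\<close> had the wrong sign, then solving for \<open>x\<close> or for \<open>n\<close> would show that \<open>x \<notin> R\<close> or \<open>n \<in> R\<close>.
\<close>
lemma biclosed_mixed:
  assumes R: "biclosed R" and x: "x \<in> R" and n: "n \<in> \<Phi>_pos - R"
    and ab: "0 \<le> a" "0 \<le> b" and z: "z = a *\<^sub>R x - b *\<^sub>R n" "z \<in> \<Phi>"
  shows "z \<in> orient R"
proof (rule ccontr)
  note bc = biclosedD[OF R]
  assume no: "z \<notin> orient R"
  have xp: "x \<in> \<Phi>_pos" and np: "n \<in> \<Phi>_pos" using x n bc by auto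
  from root_cases[OF z(2)] show False
  proof
    assume zp: "z \<in> \<Phi>_pos"
    then have zn: "z \<in> \<Phi>_pos - R" using no by (auto simp: orient_def)
    have "a \<noteq> 0"
    proof
      assume "a = 0"
      then have "height z = - (b * height n)"
        by (simp add: z linear_neg[OF linear_height] linear_scale[OF linear_height])
      then show False using height_pos[OF zp] height_pos[OF np] ab by (simp add: mult_less_0_iff)
    qed
    then have "x = (1 / a) *\<^sub>R z + (b / a) *\<^sub>R n" by (simp add: z scaleR_diff_right)
    then have "x \<in> \<Phi>_pos - R"
      by (rule closed_rootsD[OF bc(3) zn n, rotated 2]) (use ab xp in auto)
    then show False using x by simp
  next
    assume zp: "- z \<in> \<Phi>_pos"
    then have zr: "- z \<in> R" using no by (auto simp: orient_def)
    have "b \<noteq> 0"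
    proof
      assume "b = 0"
      then have "height (- z) = - (a * height x)"
        by (simp add: z linear_neg[OF linear_height] linear_scale[OF linear_height])
      then show False using height_pos[OF zp] height_pos[OF xp] ab by (simp add: mult_less_0_iff)
    qed
    then have "n = (a / b) *\<^sub>R x + (1 / b) *\<^sub>R (- z)" by (simp add: z scaleR_diff_right)
    then have "n \<in> R"
      by (rule closed_rootsD[OF bc(2) x zr, rotated 2]) (use ab np in auto)
    then show False using n by simp
  qed
qed

lemma biclosed_orientation: assumes R: "biclosed R" shows "orientation (orient R)"
proof
  note bc = biclosedD[OF R]
  have pos: "x \<in> \<Phi>" if "x \<in> \<Phi>_pos" for x using that by (simp add: positive_root_iff)
  show "orient R \<subseteq> \<Phi>" using bc(1) pos by (auto simp: orient_def)
  show "x \<in> orient R \<or> - x \<in> orient R" if "x \<in> \<Phi>" for x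
    using root_cases[OF that] by (auto simp: orient_def)
  show "- x \<notin> orient R" if "x \<in> orient R" for x
    using that bc(1) not_both_positive by (auto simp: orient_def)
  fix x y a b assume xy: "x \<in> orient R" "y \<in> orient R" and ab: "0 \<le> a" "0 \<le> (b :: real)"
    and z: "a *\<^sub>R x + b *\<^sub>R y \<in> \<Phi>"
  let ?z = "a *\<^sub>R x + b *\<^sub>R y"
  consider "x \<in> R" "y \<in> R" | "x \<in> R" "- y \<in> \<Phi>_pos - R" | "- x \<in> \<Phi>_pos - R" "y \<in> R"
    | "- x \<in> \<Phi>_pos - R" "- y \<in> \<Phi>_pos - R" using xy by (auto simp: orient_def)
  then show "?z \<in> orient R"
  proof cases
    case 1
    have "height ?z = a * height x + b * height y"
      by (simp add: linear_add[OF linear_height] linear_scale[OF linear_height])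
    moreover have "height x > 0" "height y > 0" using 1 bc(1) height_pos by auto
    ultimately have "height ?z \<ge> 0" using ab by simp
    then have "\<not> height (- ?z) > 0" unfolding linear_neg[OF linear_height] by simp
    then have "- ?z \<notin> \<Phi>_pos" using height_pos by blast
    then have "?z \<in> \<Phi>_pos" using root_cases[OF z] by blast
    then have "?z \<in> R" using closed_rootsD[OF bc(2) 1 ab HOL.refl] by blast
    then show ?thesis by (simp add: orient_def)
  next
    case 2
    show ?thesis by (rule biclosed_mixed[OF R 2 ab _ z]) simp
  next
    case 3
    show ?thesis by (rule biclosed_mixed[OF R 3(2,1) ab(2,1) _ z]) simp
  next
    case 4
    have e: "- ?z = a *\<^sub>R (- x) + b *\<^sub>R (- y)" by simp
    have "height (- ?z) = a * height (- x) + b * height (- y)" unfolding e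
      by (simp only: linear_add[OF linear_height] linear_scale[OF linear_height] real_scaleR_def)
    moreover have "height (- x) > 0" "height (- y) > 0" using 4 height_pos by auto
    ultimately have "height (- ?z) \<ge> 0" using ab by simp
    then have "\<not> height ?z > 0" unfolding linear_neg[OF linear_height] by simp
    then have "?z \<notin> \<Phi>_pos" using height_pos by blast
    then have "- ?z \<in> \<Phi>_pos" using root_cases[OF z] by blast
    then have "- ?z \<in> \<Phi>_pos - R" using closed_rootsD[OF bc(3) 4 ab e] by blast
    then show ?thesis by (simp add: orient_def)
  qed
qed

lemma orientation_biclosed: assumes "orientation \<Psi>" shows "biclosed (\<Psi> \<inter> \<Phi>_pos)"
proof -
  interpret orientation \<Psi> by (rule assms)
  interpret rev: orientation "uminus ` \<Psi>" by (rule reverse)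
  have e: "\<Phi>_pos - \<Psi> \<inter> \<Phi>_pos = uminus ` \<Psi> \<inter> \<Phi>_pos"
  proof (rule Set.set_eqI)
    fix x show "x \<in> \<Phi>_pos - \<Psi> \<inter> \<Phi>_pos \<longleftrightarrow> x \<in> uminus ` \<Psi> \<inter> \<Phi>_pos"
      using total[of x] proper[of x] by (auto simp: positive_root_iff)
  qed
  have "closed_roots (\<Psi> \<inter> \<Phi>_pos)" "closed_roots (uminus ` \<Psi> \<inter> \<Phi>_pos)"
    unfolding closed_roots_iff using closed rev.closed by (auto simp: positive_root_iff)
  then show ?thesis unfolding biclosed_def e by simp
qed

lemma Span_mono: "A \<subseteq> B \<Longrightarrow> Span_nonneg A \<subseteq> Span_nonneg B"
  unfolding Span_nonneg_def by blast

lemma Span_uminus: assumes "x \<in> Span_nonneg A" shows "- x \<in> Span_nonneg (uminus ` A)"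
proof -
  obtain F c where x: "x = (\<Sum>v\<in>F. c v *\<^sub>R v)" "finite F" "F \<subseteq> A" "\<forall>v\<in>F. 0 \<le> c v"
    using assms unfolding Span_nonneg_def by blast
  have "- x = (\<Sum>v\<in>uminus ` F. c (- v) *\<^sub>R v)"
    by (subst sum.reindex) (simp_all add: x(1) sum_negf)
  then show ?thesis unfolding Span_nonneg_def using x
    by (intro CollectI exI[of _ "uminus ` F"] exI[of _ "\<lambda>v. c (- v)"]) auto
qed

lemma independent_pointed:
  assumes "positively_independent A" "z \<in> Span_nonneg A" "- z \<in> Span_nonneg A" shows "z = 0"
proof -
  obtain F c where F: "z = (\<Sum>v\<in>F. c v *\<^sub>R v)" "finite F" "F \<subseteq> A" "\<forall>v\<in>F. 0 \<le> c v"
    using assms(2) unfolding Span_nonneg_def by blast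
  obtain G d where G: "- z = (\<Sum>v\<in>G. d v *\<^sub>R v)" "finite G" "G \<subseteq> A" "\<forall>v\<in>G. 0 \<le> d v"
    using assms(3) unfolding Span_nonneg_def by blast
  define u where "u v = (if v \<in> F then c v else 0) + (if v \<in> G then d v else 0)" for v
  have "(\<Sum>v\<in>F \<union> G. u v *\<^sub>R v) =
    (\<Sum>v\<in>F \<union> G. (if v \<in> F then c v else 0) *\<^sub>R v) + (\<Sum>v\<in>F \<union> G. (if v \<in> G then d v else 0) *\<^sub>R v)"
    by (simp add: u_def scaleR_add_left sum.distrib)
  also have "(\<Sum>v\<in>F \<union> G. (if v \<in> F then c v else 0) *\<^sub>R v) = (\<Sum>v\<in>F. c v *\<^sub>R v)"
    by (rule sum.mono_neutral_cong_right) (use F G in auto)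
  also have "(\<Sum>v\<in>F \<union> G. (if v \<in> G then d v else 0) *\<^sub>R v) = (\<Sum>v\<in>G. d v *\<^sub>R v)"
    by (rule sum.mono_neutral_cong_right) (use F G in auto)
  finally have "(\<Sum>v\<in>F \<union> G. u v *\<^sub>R v) = z + - z" using F(1) G(1) by simp
  then have "(\<Sum>v\<in>F \<union> G. u v *\<^sub>R v) = 0" by simp
  moreover have "\<forall>v\<in>F \<union> G. 0 \<le> u v" using F(4) G(4) by (auto simp: u_def)
  ultimately have "\<forall>v\<in>F \<union> G. u v = 0"
    using assms(1) F(2,3) G(2,3) unfolding positively_independent_def by blast
  then have u0: "u v = 0" if "v \<in> F" for v using that by blast
  have "c v = 0" if "v \<in> F" for v
  proof -
    have "0 \<le> c v" "v \<in> G \<Longrightarrow> 0 \<le> d v" using that F(4) G(4) by blast+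
    then show ?thesis using u0[OF that] that unfolding u_def by (cases "v \<in> G") auto
  qed
  then show ?thesis using F(1) by simp
qed

theorem biclosed_weakly_separable: assumes "biclosed R" shows "weakly_separable R"
proof -
  interpret orientation "orient R" by (rule biclosed_orientation[OF assms])
  have "x = 0" if "x \<in> Span_nonneg R" "x \<in> Span_nonneg (\<Phi>_pos - R)" for x
  proof (rule independent_pointed[OF independent])
    show "x \<in> Span_nonneg (orient R)" using that Span_mono[of R "orient R"] by (auto simp: orient_def)
    show "- x \<in> Span_nonneg (orient R)"
      using Span_uminus[OF that(2)] Span_mono[of "uminus ` (\<Phi>_pos - R)" "orient R"] by (auto simp: orient_def)
  qed
  moreover have "0 \<in> Span_nonneg A" for A :: "(real^3) set"
    unfolding Span_nonneg_def by (intro CollectI exI[of _ "{}"]) simp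
  ultimately show ?thesis using biclosedD[OF assms] by (auto simp: weakly_separable_def)
qed

section \<open>Positively independent sets extend to biclosed sets\<close>

text \<open>
  A nontrivial relation must involve \<open>x\<close>; solve it for \<open>- x\<close>.
\<close>
lemma dependent_pointed:
  assumes "positively_independent M" "\<not> positively_independent (insert x M)"
  shows "- x \<in> Span_nonneg M"
proof -
  obtain Y c where Y: "finite Y" "Y \<subseteq> insert x M" "\<forall>y\<in>Y. 0 \<le> c y" "(\<Sum>y\<in>Y. c y *\<^sub>R y) = 0"
    and nz: "\<not> (\<forall>y\<in>Y. c y = 0)" using assms(2) unfolding positively_independent_def by blast
  have x: "x \<in> Y" "c x \<noteq> 0"
  proof -
    have "x \<in> Y \<and> c x \<noteq> 0"
    proof (rule ccontr)
      assume n: "\<not> (x \<in> Y \<and> c x \<noteq> 0)"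
      have "(\<Sum>y\<in>Y - {x}. c y *\<^sub>R y) = (\<Sum>y\<in>Y. c y *\<^sub>R y)"
        by (rule sum.mono_neutral_left) (use Y n in auto)
      then have "(\<Sum>y\<in>Y - {x}. c y *\<^sub>R y) = 0" using Y by simp
      moreover have "finite (Y - {x})" "Y - {x} \<subseteq> M" "\<forall>y\<in>Y - {x}. 0 \<le> c y" using Y by auto
      ultimately have "\<forall>y\<in>Y - {x}. c y = 0" using assms(1) unfolding positively_independent_def by blast
      then show False using n nz by auto
    qed
    then show "x \<in> Y" "c x \<noteq> 0" by auto
  qed
  then have cx: "c x > 0" using Y(3) by fastforce
  have "c x *\<^sub>R x + (\<Sum>y\<in>Y - {x}. c y *\<^sub>R y) = 0" using Y(1,4) x(1) by (simp add: sum.remove)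
  then have s: "(\<Sum>y\<in>Y - {x}. c y *\<^sub>R y) = - (c x *\<^sub>R x)" by (simp add: eq_neg_iff_add_eq_0 add.commute)
  have "(\<Sum>y\<in>Y - {x}. (c y / c x) *\<^sub>R y) = (1 / c x) *\<^sub>R (\<Sum>y\<in>Y - {x}. c y *\<^sub>R y)"
    by (simp add: scaleR_sum_right)
  also have "\<dots> = - x" unfolding s using cx by simp
  finally have "- x = (\<Sum>y\<in>Y - {x}. (c y / c x) *\<^sub>R y)" by simp
  then show ?thesis unfolding Span_nonneg_def using Y cx
    by (intro CollectI exI[of _ "Y - {x}"] exI[of _ "\<lambda>y. c y / c x"]) auto
qed

text \<open>
  Take a maximal positively independent set \<open>M\<close>. If it contained neither \<open>x\<close> nor \<open>- x\<close>, then both would lie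
  in the cone of \<open>M\<close>, which contains no line. For the same reason \<open>M\<close> contains all roots in its cone.
\<close>
lemma extend_to_orientation:
  assumes "positively_independent \<Theta>" "\<Theta> \<subseteq> \<Phi>"
  obtains \<Psi> where "\<Theta> \<subseteq> \<Psi>" "orientation \<Psi>"
proof -
  define \<A> where "\<A> = {A. \<Theta> \<subseteq> A \<and> A \<subseteq> \<Phi> \<and> positively_independent A}"
  have "\<exists>M\<in>\<A>. \<forall>X\<in>\<A>. M \<subseteq> X \<longrightarrow> X = M"
  proof (rule subset_Zorn_nonempty)
    show "\<A> \<noteq> {}" using assms by (auto simp: \<A>_def)
    fix \<C> assume C: "\<C> \<noteq> {}" "subset.chain \<A> \<C>"
    then have CA: "\<C> \<subseteq> \<A>" by (simp add: subset.chain_def)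
    have "positively_independent (\<Union>\<C>)"
      unfolding positively_independent_def
    proof (intro allI impI)
      fix Y c assume Y: "finite Y \<and> Y \<subseteq> \<Union>\<C> \<and> (\<forall>y\<in>Y. 0 \<le> c y) \<and> (\<Sum>y\<in>Y. c y *\<^sub>R y) = 0"
      then obtain B where B: "B \<in> \<C>" "Y \<subseteq> B" using finite_subset_Union_chain[OF _ _ C] by metis
      then have "positively_independent B" using CA by (auto simp: \<A>_def)
      then show "\<forall>y\<in>Y. c y = 0" using Y B unfolding positively_independent_def by blast
    qed
    moreover have "\<Theta> \<subseteq> \<Union>\<C>" "\<Union>\<C> \<subseteq> \<Phi>" using CA C(1) by (auto simp: \<A>_def)
    ultimately show "\<Union>\<C> \<in> \<A>" by (simp add: \<A>_def)
  qed
  then obtain M where MA: "M \<in> \<A>" and mx: "\<forall>X\<in>\<A>. M \<subseteq> X \<longrightarrow> X = M" by (elim bexE)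
  have M: "\<Theta> \<subseteq> M" "M \<subseteq> \<Phi>" "positively_independent M" using MA by (simp_all add: \<A>_def)
  have max: "X = M" if "\<Theta> \<subseteq> X" "X \<subseteq> \<Phi>" "positively_independent X" "M \<subseteq> X" for X
    using mx[rule_format, of X] that by (simp add: \<A>_def)
  have pointed: "z \<notin> Span_nonneg M \<or> - z \<notin> Span_nonneg M" if "z \<in> \<Phi>" for z
    using independent_pointed[OF M(3), of z] root_nonzero[OF that] by blast
  have blocked: "- x \<in> Span_nonneg M" if "x \<in> \<Phi>" "x \<notin> M" for x
  proof (rule dependent_pointed[OF M(3)])
    show "\<not> positively_independent (insert x M)"
      using max[of "insert x M"] M that by blast
  qed
  have mem: "x \<in> Span_nonneg M" if "x \<in> M" for x
    unfolding Span_nonneg_def using that by (intro CollectI exI[of _ "{x}"] exI[of _ "\<lambda>_. 1"]) simp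
  have "orientation M"
  proof
    show "M \<subseteq> \<Phi>" by (rule M)
    show "x \<in> M \<or> - x \<in> M" if "x \<in> \<Phi>" for x
      using pointed[OF that] blocked[OF that] blocked[of "- x"] that by auto
    show "- x \<notin> M" if "x \<in> M" for x using pointed[of x] mem[of x] mem[of "- x"] that M(2) by blast
    fix x y a b assume h: "x \<in> M" "y \<in> M" "0 \<le> a" "0 \<le> (b::real)" "a *\<^sub>R x + b *\<^sub>R y \<in> \<Phi>"
    have "a *\<^sub>R x + b *\<^sub>R y \<in> Span_nonneg {x, y}" unfolding Span_pair using h by blast
    then have "a *\<^sub>R x + b *\<^sub>R y \<in> Span_nonneg M" using Span_mono[of "{x, y}" M] h by blast
    then show "a *\<^sub>R x + b *\<^sub>R y \<in> M" using pointed[OF h(5)] blocked[OF h(5)] by blast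
  qed
  then show thesis using that M(1) by blast
qed

lemma biclosed_functional:
  assumes "biclosed R" "finite Y" "Y \<subseteq> \<Phi>_pos"
  obtains f where "\<And>y. y \<in> Y \<Longrightarrow> y \<in> R \<Longrightarrow> f \<bullet> y > 0" "\<And>y. y \<in> Y \<Longrightarrow> y \<notin> R \<Longrightarrow> f \<bullet> y < 0"
proof -
  interpret orientation "orient R" by (rule biclosed_orientation[OF assms(1)])
  have "finite (Y \<inter> R \<union> uminus ` (Y - R))" "Y \<inter> R \<union> uminus ` (Y - R) \<subseteq> orient R"
    using assms by (auto simp: orient_def)
  then obtain f where f: "\<And>y. y \<in> Y \<inter> R \<union> uminus ` (Y - R) \<Longrightarrow> f \<bullet> y > 0"
    using strict_functional[OF independent] by metis
  show thesis
  proof (rule that[of f])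
    show "f \<bullet> y > 0" if "y \<in> Y" "y \<in> R" for y using f that by blast
    show "f \<bullet> y < 0" if "y \<in> Y" "y \<notin> R" for y using f[of "- y"] that by simp
  qed
qed

text \<open>
  A root \<open>x\<close> with \<open>form (\<alpha> i) x > 0\<close> lies between \<open>\<alpha> i\<close> and the lower root \<open>reflection i x\<close>.
\<close>
lemma closed_roots_simple:
  assumes "closed_roots R" "\<Delta> \<subseteq> R" "x \<in> \<Phi>_pos" shows "x \<in> R"
proof -
  obtain n where "height x = real n" using height_nat assms(3) by blast
  then show ?thesis using assms(3)
  proof (induction n arbitrary: x rule: less_induct)
    case (less n)
    obtain i where i: "form (\<alpha> i) x > 0" using descent_exists less.prems by blast
    have si: "\<alpha> i \<in> R" using assms(2) by (auto simp: \<Delta>_def)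
    show ?case
    proof (cases "x = \<alpha> i")
      case False
      have p: "reflection i x \<in> \<Phi>_pos" using reflection_pos less.prems False by blast
      obtain m where m: "height (reflection i x) = real m" using height_nat p by blast
      have "m < n" using m i less.prems(1) height_reflection[of i x] by simp
      then have r: "reflection i x \<in> R" using less.IH m p by blast
      have "x = 1 *\<^sub>R reflection i x + (2 * form (\<alpha> i) x) *\<^sub>R \<alpha> i" by (simp add: reflection_def)
      then show ?thesis
        using closed_rootsD[OF assms(1) r si, of 1 "2 * form (\<alpha> i) x" x] i less.prems(2) by simp
    qed (use si in simp)
  qed
qed

lemma biclosed_has_simple: assumes "biclosed R" "R \<noteq> {}" shows "\<exists>i. \<alpha> i \<in> R"
proof (rule ccontr)
  assume "\<not> ?thesis"
  then have "\<Delta> \<subseteq> \<Phi>_pos - R" using simple_pos by (auto simp: \<Delta>_def)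
  then have "\<Phi>_pos \<subseteq> \<Phi>_pos - R" using closed_roots_simple[OF biclosedD(3)[OF assms(1)]] by blast
  then show False using assms biclosedD(1) by blast
qed

section \<open>Interpolation between biclosed sets\<close>

lemma four_dependent:
  fixes v1 v2 v3 v4 :: "real^3"
  obtains a b c d where "a *\<^sub>R v1 + b *\<^sub>R v2 + c *\<^sub>R v3 + d *\<^sub>R v4 = 0" "a \<noteq> 0 \<or> b \<noteq> 0 \<or> c \<noteq> 0 \<or> d \<noteq> 0"
proof -
  define L :: "real^4 \<Rightarrow> real^3" where "L x = x$1 *\<^sub>R v1 + x$2 *\<^sub>R v2 + x$3 *\<^sub>R v3 + x$4 *\<^sub>R v4" for x
  have L: "linear L" by (rule linearI) (simp_all add: L_def algebra_simps)
  have "\<not> inj L"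
  proof
    assume "inj L"
    then have "dim (range L) = dim (UNIV :: (real^4) set)"
      by (intro dim_image_eq[OF L]) (auto intro: inj_on_subset)
    then show False using dim_subset_UNIV[of "range L"] by simp
  qed
  then obtain x where "L x = 0" "x \<noteq> 0" using linear_injective_0[OF L] by blast
  then show thesis using that[of "x$1" "x$2" "x$3" "x$4"] by (auto simp: L_def vec_eq_iff forall_4)
qed

lemma same_sign_zero:
  fixes v1 v2 v3 v4 :: real
  assumes "v1 \<noteq> 0" "v2 \<noteq> 0" "v3 \<noteq> 0" "v4 \<noteq> 0" "a * v1 + b * v2 + c * v3 + d * v4 = 0"
    and "(0 \<le> a * v1 \<and> 0 \<le> b * v2 \<and> 0 \<le> c * v3 \<and> 0 \<le> d * v4) \<or>
         (a * v1 \<le> 0 \<and> b * v2 \<le> 0 \<and> c * v3 \<le> 0 \<and> d * v4 \<le> 0)"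
  shows "a = 0 \<and> b = 0 \<and> c = 0 \<and> d = 0"
proof -
  have "a * v1 = 0" "b * v2 = 0" "c * v3 = 0" "d * v4 = 0" using assms(5,6) by linarith+
  then show ?thesis using assms(1-4) by simp
qed


lemma weighted_pos:
  fixes x y u v :: real
  assumes "0 \<le> x" "0 \<le> y" "x \<noteq> 0 \<or> y \<noteq> 0" "0 < u" "0 < v"
  shows "0 < x * u + y * v"
proof (cases "x = 0")
  case True
  then show ?thesis using assms by simp
next
  case False
  then show ?thesis using assms by (intro add_pos_nonneg mult_pos_pos mult_nonneg_nonneg) auto
qed

text \<open>
  The four roots \<open>a1, a2, b1, b2\<close> are linearly dependent. For most sign patterns of the relation, one of the
  vectors \<open>fR, fS, f1, f2, h\<close> or the common value \<open>q\<close> of the two combinations has all four terms of the same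
  sign. In the remaining two patterns, \<open>a1\<close> and one of the \<open>b\<close> on one side have a common
  positive combination \<open>d\<close> with \<open>a2\<close> and the other \<open>b\<close>; then \<open>fR\<close> and \<open>fS\<close> are negative and \<open>f1\<close> and \<open>f2\<close>
  positive on \<open>d\<close>, so \<open>q \<bullet> d\<close> would be both negative and positive.
\<close>
lemma opposite_pairs_disjoint:
  fixes a1 a2 b1 b2 fR fS f1 f2 h :: "real^3"
  assumes q: "lR *\<^sub>R fR + lS *\<^sub>R fS = m1 *\<^sub>R f1 + m2 *\<^sub>R f2"
    and nn: "0 \<le> lR" "0 \<le> lS" "lR \<noteq> 0 \<or> lS \<noteq> 0" "0 \<le> m1" "0 \<le> m2" "m1 \<noteq> 0 \<or> m2 \<noteq> 0"
    and h: "h \<bullet> a1 > 0" "h \<bullet> a2 > 0" "h \<bullet> b1 > 0" "h \<bullet> b2 > 0"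
    and R: "fR \<bullet> a1 > 0" "fR \<bullet> a2 < 0" "fR \<bullet> b1 < 0" "fR \<bullet> b2 < 0"
    and S: "fS \<bullet> a1 < 0" "fS \<bullet> a2 > 0" "fS \<bullet> b1 < 0" "fS \<bullet> b2 < 0"
    and T1: "f1 \<bullet> a1 > 0" "f1 \<bullet> a2 > 0" "f1 \<bullet> b1 > 0" "f1 \<bullet> b2 < 0"
    and T2: "f2 \<bullet> a1 > 0" "f2 \<bullet> a2 > 0" "f2 \<bullet> b1 < 0" "f2 \<bullet> b2 > 0"
  shows False
proof -
  define q where "q = lR *\<^sub>R fR + lS *\<^sub>R fS"
  have q1: "q \<bullet> v = lR * (fR \<bullet> v) + lS * (fS \<bullet> v)" for v by (simp add: q_def inner_add_left)
  have q2: "q \<bullet> v = m1 * (f1 \<bullet> v) + m2 * (f2 \<bullet> v)" for v unfolding q_def q by (simp add: inner_add_left)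
  have qa: "q \<bullet> a1 > 0" "q \<bullet> a2 > 0" unfolding q2 using weighted_pos nn T1 T2 by blast+
  have qn: "q \<bullet> v < 0" if "fR \<bullet> v < 0" "fS \<bullet> v < 0" for v
    using weighted_pos[of lR lS "- (fR \<bullet> v)" "- (fS \<bullet> v)"] nn that unfolding q1 by simp
  have qb: "q \<bullet> b1 < 0" "q \<bullet> b2 < 0" using qn R S by blast+
  \<comment> \<open>Both combinations have the value \<open>q\<close>, so no \<open>d\<close> is negative for \<open>fR, fS\<close> and positive for \<open>f1, f2\<close>.\<close>
  have no: False if "fR \<bullet> d < 0" "fS \<bullet> d < 0" "f1 \<bullet> d > 0" "f2 \<bullet> d > 0" for d
    using qn[of d] weighted_pos[of m1 m2 "f1 \<bullet> d" "f2 \<bullet> d"] nn that unfolding q2 by linarith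
  have main: False if dep: "p1 *\<^sub>R a1 + p2 *\<^sub>R a2 + r1 *\<^sub>R b1 + r2 *\<^sub>R b2 = 0"
    and nz: "p1 \<noteq> 0 \<or> p2 \<noteq> 0 \<or> r1 \<noteq> 0 \<or> r2 \<noteq> 0" and p1: "0 \<le> p1" for p1 p2 r1 r2
  proof -
    have row: "p1 * (f \<bullet> a1) + p2 * (f \<bullet> a2) + r1 * (f \<bullet> b1) + r2 * (f \<bullet> b2) = 0" for f
    proof -
      have "f \<bullet> (p1 *\<^sub>R a1 + p2 *\<^sub>R a2 + r1 *\<^sub>R b1 + r2 *\<^sub>R b2) = 0" unfolding dep by simp
      then show ?thesis by (simp add: inner_add_right)
    qed
    have kill: False if "f \<bullet> a1 \<noteq> 0" "f \<bullet> a2 \<noteq> 0" "f \<bullet> b1 \<noteq> 0" "f \<bullet> b2 \<noteq> 0"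
      "(0 \<le> p1 * (f \<bullet> a1) \<and> 0 \<le> p2 * (f \<bullet> a2) \<and> 0 \<le> r1 * (f \<bullet> b1) \<and> 0 \<le> r2 * (f \<bullet> b2)) \<or>
       (p1 * (f \<bullet> a1) \<le> 0 \<and> p2 * (f \<bullet> a2) \<le> 0 \<and> r1 * (f \<bullet> b1) \<le> 0 \<and> r2 * (f \<bullet> b2) \<le> 0)" for f
      using same_sign_zero[OF that(1-4) row that(5)] nz by blast
    consider "0 \<le> p2" "0 \<le> r1" "0 \<le> r2" | "0 \<le> p2" "0 \<le> r1" "r2 \<le> 0" | "0 \<le> p2" "r1 \<le> 0" "0 \<le> r2"
      | "0 \<le> p2" "r1 \<le> 0" "r2 \<le> 0" | "p2 \<le> 0" "r1 \<le> 0" "r2 \<le> 0" | "p2 \<le> 0" "0 \<le> r1" "0 \<le> r2"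
      | (A) "p2 \<le> 0" "0 \<le> r1" "r2 \<le> 0" | (B) "p2 \<le> 0" "r1 \<le> 0" "0 \<le> r2"
      by linarith
    then show False
    proof cases
      case 1 then show False using h p1 kill[of h] by (auto simp: mult_nonneg_nonneg less_imp_le)
    next
      case 2 then show False using T1 p1 kill[of f1] by (auto simp: mult_nonneg_nonneg mult_nonpos_nonpos less_imp_le)
    next
      case 3 then show False using T2 p1 kill[of f2] by (auto simp: mult_nonneg_nonneg mult_nonpos_nonpos less_imp_le)
    next
      case 4 then show False using qa qb p1 kill[of q] by (auto simp: mult_nonneg_nonneg mult_nonpos_nonpos less_imp_le)
    next
      case 5 then show False using R p1 kill[of fR] by (auto simp: mult_nonneg_nonneg mult_nonpos_nonpos less_imp_le)
    next
      case 6 then show False using S p1 kill[of fS] by (auto simp: mult_nonneg_nonpos mult_nonpos_nonneg less_imp_le)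
    next
      case A
      define d where "d = p1 *\<^sub>R a1 + r1 *\<^sub>R b1"
      have "d - ((- p2) *\<^sub>R a2 + (- r2) *\<^sub>R b2) = 0" using dep by (simp add: d_def algebra_simps)
      then have d': "d = (- p2) *\<^sub>R a2 + (- r2) *\<^sub>R b2" by simp
      have v: "f \<bullet> d = p1 * (f \<bullet> a1) + r1 * (f \<bullet> b1)" "f \<bullet> d = (- p2) * (f \<bullet> a2) + (- r2) * (f \<bullet> b2)" for f
        by (simp add: d_def inner_add_right, subst d', simp only: inner_add_right inner_scaleR_right)
      have n1: "p1 \<noteq> 0 \<or> r1 \<noteq> 0"
        using v[of h] weighted_pos[of "- p2" "- r2" "h \<bullet> a2" "h \<bullet> b2"] A nz h by force
      have n2: "- p2 \<noteq> 0 \<or> - r2 \<noteq> 0"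
        using v[of h] weighted_pos[of p1 r1 "h \<bullet> a1" "h \<bullet> b1"] A p1 nz h by force
      have A': "0 \<le> - p2" "0 \<le> - r2" using A by auto
      show False
      proof (rule no[of d])
        show "fR \<bullet> d < 0" unfolding v(2)
          using weighted_pos[OF A' n2, of "- (fR \<bullet> a2)" "- (fR \<bullet> b2)"] R by simp
        show "fS \<bullet> d < 0" unfolding v(1)
          using weighted_pos[OF p1 A(2) n1, of "- (fS \<bullet> a1)" "- (fS \<bullet> b1)"] S by simp
        show "f1 \<bullet> d > 0" unfolding v(1) using weighted_pos[OF p1 A(2) n1] T1 by blast
        show "f2 \<bullet> d > 0" unfolding v(2) using weighted_pos[OF A' n2] T2 by blast
      qed
    next
      case B
      define d where "d = p1 *\<^sub>R a1 + r2 *\<^sub>R b2"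
      have "d - ((- p2) *\<^sub>R a2 + (- r1) *\<^sub>R b1) = 0" using dep by (simp add: d_def algebra_simps)
      then have d': "d = (- p2) *\<^sub>R a2 + (- r1) *\<^sub>R b1" by simp
      have v: "f \<bullet> d = p1 * (f \<bullet> a1) + r2 * (f \<bullet> b2)" "f \<bullet> d = (- p2) * (f \<bullet> a2) + (- r1) * (f \<bullet> b1)" for f
        by (simp add: d_def inner_add_right, subst d', simp only: inner_add_right inner_scaleR_right)
      have n1: "p1 \<noteq> 0 \<or> r2 \<noteq> 0"
        using v[of h] weighted_pos[of "- p2" "- r1" "h \<bullet> a2" "h \<bullet> b1"] B nz h by force
      have n2: "- p2 \<noteq> 0 \<or> - r1 \<noteq> 0"
        using v[of h] weighted_pos[of p1 r2 "h \<bullet> a1" "h \<bullet> b2"] B p1 nz h by force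
      have B': "0 \<le> - p2" "0 \<le> - r1" using B by auto
      show False
      proof (rule no[of d])
        show "fR \<bullet> d < 0" unfolding v(2)
          using weighted_pos[OF B' n2, of "- (fR \<bullet> a2)" "- (fR \<bullet> b1)"] R by simp
        show "fS \<bullet> d < 0" unfolding v(1)
          using weighted_pos[OF p1 B(3) n1, of "- (fS \<bullet> a1)" "- (fS \<bullet> b2)"] S by simp
        show "f1 \<bullet> d > 0" unfolding v(2) using weighted_pos[OF B' n2] T1 by blast
        show "f2 \<bullet> d > 0" unfolding v(1) using weighted_pos[OF p1 B(3) n1] T2 by blast
      qed
    qed
  qed
  obtain p1 p2 r1 r2 where dep: "p1 *\<^sub>R a1 + p2 *\<^sub>R a2 + r1 *\<^sub>R b1 + r2 *\<^sub>R b2 = 0"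
    "p1 \<noteq> 0 \<or> p2 \<noteq> 0 \<or> r1 \<noteq> 0 \<or> r2 \<noteq> 0" using four_dependent by metis
  have "(- p1) *\<^sub>R a1 + (- p2) *\<^sub>R a2 + (- r1) *\<^sub>R b1 + (- r2) *\<^sub>R b2 = - (p1 *\<^sub>R a1 + p2 *\<^sub>R a2 + r1 *\<^sub>R b1 + r2 *\<^sub>R b2)"
    by simp
  then have dep': "(- p1) *\<^sub>R a1 + (- p2) *\<^sub>R a2 + (- r1) *\<^sub>R b1 + (- r2) *\<^sub>R b2 = 0" unfolding dep by simp
  show False
  proof (cases "0 \<le> p1")
    case True
    then show False using main[OF dep] by blast
  next
    case False
    then show False using main[OF dep'] dep(2) by simp
  qed
qed

text \<open>
  Among the sign patterns of a linear relation of the four vectors, the roots \<open>a1, a2, b1, b2\<close> exclude those in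
  which one vector stands against three, the root \<open>g\<close> excludes equal signs, and
  \<open>opposite_pairs_disjoint\<close> excludes \<open>fR, fS\<close> against \<open>f1, f2\<close>. The patterns that remain pair \<open>fR\<close> with one of
  \<open>f1, f2\<close> and \<open>fS\<close> with the other. The vector \<open>h\<close> witnesses that the four roots are positive.
\<close>
lemma crossing_functional:
  fixes a1 a2 b1 b2 g fR fS f1 f2 h :: "real^3"
  assumes h: "h \<bullet> a1 > 0" "h \<bullet> a2 > 0" "h \<bullet> b1 > 0" "h \<bullet> b2 > 0"
    and R: "fR \<bullet> a1 > 0" "fR \<bullet> a2 < 0" "fR \<bullet> b1 < 0" "fR \<bullet> b2 < 0"
    and S: "fS \<bullet> a1 < 0" "fS \<bullet> a2 > 0" "fS \<bullet> b1 < 0" "fS \<bullet> b2 < 0"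
    and T1: "f1 \<bullet> a1 > 0" "f1 \<bullet> a2 > 0" "f1 \<bullet> b1 > 0" "f1 \<bullet> b2 < 0"
    and T2: "f2 \<bullet> a1 > 0" "f2 \<bullet> a2 > 0" "f2 \<bullet> b1 < 0" "f2 \<bullet> b2 > 0"
    and g: "fR \<bullet> g > 0 \<and> fS \<bullet> g > 0 \<and> f1 \<bullet> g > 0 \<and> f2 \<bullet> g > 0 \<or>
            fR \<bullet> g < 0 \<and> fS \<bullet> g < 0 \<and> f1 \<bullet> g < 0 \<and> f2 \<bullet> g < 0"
  obtains (crossing) i j k l where "0 \<le> i" "0 \<le> j" "0 \<le> k" "0 \<le> l"
      "i \<noteq> 0 \<or> j \<noteq> 0" "k \<noteq> 0 \<or> l \<noteq> 0"
      "i *\<^sub>R fR + j *\<^sub>R f2 = k *\<^sub>R fS + l *\<^sub>R f1 \<or> i *\<^sub>R fR + j *\<^sub>R f1 = k *\<^sub>R fS + l *\<^sub>R f2"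
proof -
  have both: "(x \<noteq> 0 \<or> y \<noteq> 0) \<and> (x' \<noteq> 0 \<or> y' \<noteq> 0)"
    if e: "x *\<^sub>R u + y *\<^sub>R v = x' *\<^sub>R u' + y' *\<^sub>R v'" and nn: "0 \<le> x" "0 \<le> y" "0 \<le> x'" "0 \<le> y'"
      and nz: "x \<noteq> 0 \<or> y \<noteq> 0 \<or> x' \<noteq> 0 \<or> y' \<noteq> 0"
      and gs: "u \<bullet> g > 0 \<and> v \<bullet> g > 0 \<and> u' \<bullet> g > 0 \<and> v' \<bullet> g > 0 \<or> u \<bullet> g < 0 \<and> v \<bullet> g < 0 \<and> u' \<bullet> g < 0 \<and> v' \<bullet> g < 0"
    for x y x' y' and u v u' v' :: "real^3"
  proof -
    have "(x *\<^sub>R u + y *\<^sub>R v) \<bullet> g = (x' *\<^sub>R u' + y' *\<^sub>R v') \<bullet> g" using e by simp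
    then have e': "x * (u \<bullet> g) + y * (v \<bullet> g) = x' * (u' \<bullet> g) + y' * (v' \<bullet> g)" by (simp add: inner_add_left)
    have e'': "x * - (u \<bullet> g) + y * - (v \<bullet> g) = x' * - (u' \<bullet> g) + y' * - (v' \<bullet> g)" using e' by simp
    from gs show ?thesis
    proof
      assume "u \<bullet> g > 0 \<and> v \<bullet> g > 0 \<and> u' \<bullet> g > 0 \<and> v' \<bullet> g > 0"
      then show ?thesis using e' nn nz weighted_pos[of x y "u \<bullet> g" "v \<bullet> g"] weighted_pos[of x' y' "u' \<bullet> g" "v' \<bullet> g"]
        by fastforce
    next
      assume "u \<bullet> g < 0 \<and> v \<bullet> g < 0 \<and> u' \<bullet> g < 0 \<and> v' \<bullet> g < 0"
      then show ?thesis using e'' nn nz weighted_pos[of x y "- (u \<bullet> g)" "- (v \<bullet> g)"] weighted_pos[of x' y' "- (u' \<bullet> g)" "- (v' \<bullet> g)"]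
        by fastforce
    qed
  qed
  have main: thesis if dep: "lR *\<^sub>R fR + lS *\<^sub>R fS + l1 *\<^sub>R f1 + l2 *\<^sub>R f2 = 0"
    and nz: "lR \<noteq> 0 \<or> lS \<noteq> 0 \<or> l1 \<noteq> 0 \<or> l2 \<noteq> 0" and lR: "0 \<le> lR" for lR lS l1 l2
  proof -
    have row: "lR * (fR \<bullet> v) + lS * (fS \<bullet> v) + l1 * (f1 \<bullet> v) + l2 * (f2 \<bullet> v) = 0" for v
    proof -
      have "(lR *\<^sub>R fR + lS *\<^sub>R fS + l1 *\<^sub>R f1 + l2 *\<^sub>R f2) \<bullet> v = 0" unfolding dep by simp
      then show ?thesis by (simp add: inner_add_left)
    qed
    have kill: False if "fR \<bullet> v \<noteq> 0" "fS \<bullet> v \<noteq> 0" "f1 \<bullet> v \<noteq> 0" "f2 \<bullet> v \<noteq> 0"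
      "(0 \<le> lR * (fR \<bullet> v) \<and> 0 \<le> lS * (fS \<bullet> v) \<and> 0 \<le> l1 * (f1 \<bullet> v) \<and> 0 \<le> l2 * (f2 \<bullet> v)) \<or>
       (lR * (fR \<bullet> v) \<le> 0 \<and> lS * (fS \<bullet> v) \<le> 0 \<and> l1 * (f1 \<bullet> v) \<le> 0 \<and> l2 * (f2 \<bullet> v) \<le> 0)" for v
      using same_sign_zero[OF that(1-4) row that(5)] nz by blast
    note signs = mult_nonneg_nonneg mult_nonpos_nonpos mult_nonneg_nonpos mult_nonpos_nonneg less_imp_le
    consider (s) "0 \<le> lS" "0 \<le> l1" "0 \<le> l2" | (p) "0 \<le> lS" "l1 \<le> 0" "l2 \<le> 0"
      | (b2) "0 \<le> lS" "0 \<le> l1" "l2 \<le> 0" | (b1) "0 \<le> lS" "l1 \<le> 0" "0 \<le> l2"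
      | (a1) "lS \<le> 0" "0 \<le> l1" "0 \<le> l2" | (a2) "lS \<le> 0" "l1 \<le> 0" "l2 \<le> 0"
      | (x2) "lS \<le> 0" "0 \<le> l1" "l2 \<le> 0" | (x1) "lS \<le> 0" "l1 \<le> 0" "0 \<le> l2"
      by linarith
    then show thesis
    proof cases
      case s
      then have False using g lR kill[of g] by (auto simp: signs)
      then show ?thesis ..
    next
      case p
      have "lR *\<^sub>R fR + lS *\<^sub>R fS - ((- l1) *\<^sub>R f1 + (- l2) *\<^sub>R f2) = 0" using dep by (simp add: algebra_simps)
      then have e: "lR *\<^sub>R fR + lS *\<^sub>R fS = (- l1) *\<^sub>R f1 + (- l2) *\<^sub>R f2" by simp
      have nn: "0 \<le> - l1" "0 \<le> - l2" using p by auto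
      have n: "(lR \<noteq> 0 \<or> lS \<noteq> 0) \<and> (- l1 \<noteq> 0 \<or> - l2 \<noteq> 0)"
        by (rule both[OF e lR p(1) nn]) (use nz g in auto)
      have False by (rule opposite_pairs_disjoint[OF e lR p(1) _ nn _ h R S T1 T2]) (use n in auto)
      then show ?thesis ..
    next
      case b2
      then have False using R S T1 T2 lR kill[of b2] by (auto simp: signs)
      then show ?thesis ..
    next
      case b1
      then have False using R S T1 T2 lR kill[of b1] by (auto simp: signs)
      then show ?thesis ..
    next
      case a1
      then have False using R S T1 T2 lR kill[of a1] by (auto simp: signs)
      then show ?thesis ..
    next
      case a2
      then have False using R S T1 T2 lR kill[of a2] by (auto simp: signs)
      then show ?thesis ..
    next
      case x2
      have "lR *\<^sub>R fR + l1 *\<^sub>R f1 - ((- lS) *\<^sub>R fS + (- l2) *\<^sub>R f2) = 0" using dep by (simp add: algebra_simps)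
      then have e: "lR *\<^sub>R fR + l1 *\<^sub>R f1 = (- lS) *\<^sub>R fS + (- l2) *\<^sub>R f2" by simp
      have nn: "0 \<le> - lS" "0 \<le> - l2" using x2 by auto
      have n: "(lR \<noteq> 0 \<or> l1 \<noteq> 0) \<and> (- lS \<noteq> 0 \<or> - l2 \<noteq> 0)"
        by (rule both[OF e lR x2(2) nn]) (use nz g in auto)
      show ?thesis by (rule crossing[OF lR x2(2) nn]) (use n e in auto)
    next
      case x1
      have "lR *\<^sub>R fR + l2 *\<^sub>R f2 - ((- lS) *\<^sub>R fS + (- l1) *\<^sub>R f1) = 0" using dep by (simp add: algebra_simps)
      then have e: "lR *\<^sub>R fR + l2 *\<^sub>R f2 = (- lS) *\<^sub>R fS + (- l1) *\<^sub>R f1" by simp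
      have nn: "0 \<le> - lS" "0 \<le> - l1" using x1 by auto
      have n: "(lR \<noteq> 0 \<or> l2 \<noteq> 0) \<and> (- lS \<noteq> 0 \<or> - l1 \<noteq> 0)"
        by (rule both[OF e lR x1(3) nn]) (use nz g in auto)
      show ?thesis by (rule crossing[OF lR x1(3) nn]) (use n e in auto)
    qed
  qed
  obtain lR lS l1 l2 where dep: "lR *\<^sub>R fR + lS *\<^sub>R fS + l1 *\<^sub>R f1 + l2 *\<^sub>R f2 = 0"
    "lR \<noteq> 0 \<or> lS \<noteq> 0 \<or> l1 \<noteq> 0 \<or> l2 \<noteq> 0" using four_dependent by metis
  have "(- lR) *\<^sub>R fR + (- lS) *\<^sub>R fS + (- l1) *\<^sub>R f1 + (- l2) *\<^sub>R f2 = - (lR *\<^sub>R fR + lS *\<^sub>R fS + l1 *\<^sub>R f1 + l2 *\<^sub>R f2)"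
    by simp
  then have dep': "(- lR) *\<^sub>R fR + (- lS) *\<^sub>R fS + (- l1) *\<^sub>R f1 + (- l2) *\<^sub>R f2 = 0" unfolding dep by simp
  show thesis
  proof (cases "0 \<le> lR")
    case True
    then show thesis using main[OF dep] by blast
  next
    case False
    then show thesis using main[OF dep'] dep(2) by simp
  qed
qed

text \<open>
  The vector \<open>q\<close> given by the crossing is a positive combination of \<open>fR\<close> and the vector \<open>f\<close> of one of the \<open>Ti\<close>,
  hence positive on \<open>R\<close> and negative outside that \<open>Ti\<close>; it is also one of \<open>fS\<close> and the vector \<open>f'\<close> of the
  other \<open>Ti\<close>.
\<close>
lemma interpolation_finite:
  assumes bc: "biclosed R" "biclosed S" "biclosed T1" "biclosed T2"
    and sub: "R \<subseteq> T1" "R \<subseteq> T2" "S \<subseteq> T1" "S \<subseteq> T2"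
    and ab: "a1 \<in> R - S" "a2 \<in> S - R" "b1 \<in> T1 - T2" "b2 \<in> T2 - T1"
    and g: "g \<in> \<Phi>_pos" "g \<in> R \<inter> S \<or> g \<notin> T1 \<union> T2"
    and Y: "finite Y" "Y \<subseteq> \<Phi>_pos"
  obtains (found) q where "\<And>y. y \<in> Y \<Longrightarrow> y \<in> R \<union> S \<Longrightarrow> q \<bullet> y > 0" "\<And>y. y \<in> Y \<Longrightarrow> y \<notin> T1 \<inter> T2 \<Longrightarrow> q \<bullet> y < 0"
proof -
  define Z where "Z = Y \<union> {a1, a2, b1, b2, g}"
  have p: "a1 \<in> \<Phi>_pos" "a2 \<in> \<Phi>_pos" "b1 \<in> \<Phi>_pos" "b2 \<in> \<Phi>_pos"
    using ab biclosedD(1)[OF bc(1)] biclosedD(1)[OF bc(2)] biclosedD(1)[OF bc(3)] biclosedD(1)[OF bc(4)] by auto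
  have Z: "finite Z" "Z \<subseteq> \<Phi>_pos" using Y p g by (auto simp: Z_def)
  have inZ: "a1 \<in> Z" "a2 \<in> Z" "b1 \<in> Z" "b2 \<in> Z" "g \<in> Z" by (auto simp: Z_def)
  obtain fR where R: "\<And>y. y \<in> Z \<Longrightarrow> y \<in> R \<Longrightarrow> fR \<bullet> y > 0" "\<And>y. y \<in> Z \<Longrightarrow> y \<notin> R \<Longrightarrow> fR \<bullet> y < 0"
    using biclosed_functional[OF bc(1) Z] by metis
  obtain fS where S: "\<And>y. y \<in> Z \<Longrightarrow> y \<in> S \<Longrightarrow> fS \<bullet> y > 0" "\<And>y. y \<in> Z \<Longrightarrow> y \<notin> S \<Longrightarrow> fS \<bullet> y < 0"
    using biclosed_functional[OF bc(2) Z] by metis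
  obtain f1 where T1: "\<And>y. y \<in> Z \<Longrightarrow> y \<in> T1 \<Longrightarrow> f1 \<bullet> y > 0" "\<And>y. y \<in> Z \<Longrightarrow> y \<notin> T1 \<Longrightarrow> f1 \<bullet> y < 0"
    using biclosed_functional[OF bc(3) Z] by metis
  obtain f2 where T2: "\<And>y. y \<in> Z \<Longrightarrow> y \<in> T2 \<Longrightarrow> f2 \<bullet> y > 0" "\<And>y. y \<in> Z \<Longrightarrow> y \<notin> T2 \<Longrightarrow> f2 \<bullet> y < 0"
    using biclosed_functional[OF bc(4) Z] by metis
  have h: "(1 :: real^3) \<bullet> x > 0" if "x \<in> \<Phi>_pos" for x
    using height_pos[OF that] by (simp add: height_def inner_vec_def sum_3)
  have mR: "a1 \<in> R" "a2 \<notin> R" "b1 \<notin> R" "b2 \<notin> R" using ab sub by auto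
  have mS: "a1 \<notin> S" "a2 \<in> S" "b1 \<notin> S" "b2 \<notin> S" using ab sub by auto
  have m1: "a1 \<in> T1" "a2 \<in> T1" "b1 \<in> T1" "b2 \<notin> T1" using ab sub by auto
  have m2: "a1 \<in> T2" "a2 \<in> T2" "b1 \<notin> T2" "b2 \<in> T2" using ab sub by auto
  have gg: "fR \<bullet> g > 0 \<and> fS \<bullet> g > 0 \<and> f1 \<bullet> g > 0 \<and> f2 \<bullet> g > 0 \<or>
            fR \<bullet> g < 0 \<and> fS \<bullet> g < 0 \<and> f1 \<bullet> g < 0 \<and> f2 \<bullet> g < 0"
    using g(2)
  proof
    assume "g \<in> R \<inter> S"
    then have "g \<in> R" "g \<in> S" "g \<in> T1" "g \<in> T2" using sub by auto
    then show ?thesis using R(1) S(1) T1(1) T2(1) inZ(5) by blast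
  next
    assume "g \<notin> T1 \<union> T2"
    then have "g \<notin> R" "g \<notin> S" "g \<notin> T1" "g \<notin> T2" using sub by auto
    then show ?thesis using R(2) S(2) T1(2) T2(2) inZ(5) by blast
  qed
  have pos: "0 < (x *\<^sub>R u + z *\<^sub>R v) \<bullet> y" if "0 \<le> x" "0 \<le> z" "x \<noteq> 0 \<or> z \<noteq> 0" "u \<bullet> y > 0" "v \<bullet> y > 0"
    for x z and u v y :: "real^3"
    using weighted_pos[OF that] by (simp add: inner_add_left)
  have neg: "(x *\<^sub>R u + z *\<^sub>R v) \<bullet> y < 0" if "0 \<le> x" "0 \<le> z" "x \<noteq> 0 \<or> z \<noteq> 0" "u \<bullet> y < 0" "v \<bullet> y < 0"
    for x z and u v y :: "real^3"
    using pos[of x z u "- y" v] that by simp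
  have final: thesis
    if e: "i *\<^sub>R fR + j *\<^sub>R f = k *\<^sub>R fS + l *\<^sub>R f'" and nn: "0 \<le> i" "0 \<le> j" "0 \<le> k" "0 \<le> l"
      and nz: "i \<noteq> 0 \<or> j \<noteq> 0" "k \<noteq> 0 \<or> l \<noteq> 0" and ff: "f = f1 \<and> f' = f2 \<or> f = f2 \<and> f' = f1" for i j k l f f'
  proof (rule found[of "i *\<^sub>R fR + j *\<^sub>R f"])
    fix y assume y: "y \<in> Y" "y \<in> R \<union> S"
    have yZ: "y \<in> Z" using y by (simp add: Z_def)
    have t: "f \<bullet> y > 0" "f' \<bullet> y > 0" using ff T1(1)[OF yZ] T2(1)[OF yZ] sub y by auto
    from y(2) show "(i *\<^sub>R fR + j *\<^sub>R f) \<bullet> y > 0"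
    proof
      assume "y \<in> R"
      then show ?thesis using pos nn nz t R(1)[OF yZ] by blast
    next
      assume "y \<in> S"
      then show ?thesis unfolding e using pos nn nz t S(1)[OF yZ] by blast
    qed
  next
    fix y assume y: "y \<in> Y" "y \<notin> T1 \<inter> T2"
    have yZ: "y \<in> Z" using y by (simp add: Z_def)
    have "y \<notin> R" "y \<notin> S" using y sub by auto
    then have t: "fR \<bullet> y < 0" "fS \<bullet> y < 0" using R(2)[OF yZ] S(2)[OF yZ] by auto
    have "f \<bullet> y < 0 \<or> f' \<bullet> y < 0" using y(2) ff T1(2)[OF yZ] T2(2)[OF yZ] by auto
    then show "(i *\<^sub>R fR + j *\<^sub>R f) \<bullet> y < 0"
    proof
      assume "f \<bullet> y < 0"
      then show ?thesis using neg nn nz t by blast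
    next
      assume "f' \<bullet> y < 0"
      then show ?thesis unfolding e using neg nn nz t by blast
    qed
  qed
  show thesis
  proof (rule crossing_functional[where h = 1 and ?a1.0 = a1 and ?a2.0 = a2 and ?b1.0 = b1 and ?b2.0 = b2
        and fR = fR and fS = fS and ?f1.0 = f1 and ?f2.0 = f2 and g = g])
    show "(1::real^3) \<bullet> a1 > 0" "(1::real^3) \<bullet> a2 > 0" "(1::real^3) \<bullet> b1 > 0" "(1::real^3) \<bullet> b2 > 0" using h p by blast+
    show "fR \<bullet> a1 > 0" "fR \<bullet> a2 < 0" "fR \<bullet> b1 < 0" "fR \<bullet> b2 < 0" using R inZ mR by blast+
    show "fS \<bullet> a1 < 0" "fS \<bullet> a2 > 0" "fS \<bullet> b1 < 0" "fS \<bullet> b2 < 0" using S inZ mS by blast+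
    show "f1 \<bullet> a1 > 0" "f1 \<bullet> a2 > 0" "f1 \<bullet> b1 > 0" "f1 \<bullet> b2 < 0" using T1 inZ m1 by blast+
    show "f2 \<bullet> a1 > 0" "f2 \<bullet> a2 > 0" "f2 \<bullet> b1 < 0" "f2 \<bullet> b2 > 0" using T2 inZ m2 by blast+
    fix i j k l :: real
    assume nn: "0 \<le> i" "0 \<le> j" "0 \<le> k" "0 \<le> l" "i \<noteq> 0 \<or> j \<noteq> 0" "k \<noteq> 0 \<or> l \<noteq> 0"
      and e: "i *\<^sub>R fR + j *\<^sub>R f2 = k *\<^sub>R fS + l *\<^sub>R f1 \<or> i *\<^sub>R fR + j *\<^sub>R f1 = k *\<^sub>R fS + l *\<^sub>R f2"
    from e show thesis
    proof
      assume "i *\<^sub>R fR + j *\<^sub>R f2 = k *\<^sub>R fS + l *\<^sub>R f1"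
      then show thesis by (rule final) (use nn in auto)
    next
      assume "i *\<^sub>R fR + j *\<^sub>R f1 = k *\<^sub>R fS + l *\<^sub>R f2"
      then show thesis by (rule final) (use nn in auto)
    qed
  qed (rule gg)
qed

text \<open>
  \<open>R\<close> and \<open>S\<close> contain simple roots, and \<open>T1\<close> and \<open>T2\<close> miss simple roots. Without agreement these would be four
  different simple roots, but there are only three.
\<close>
lemma agreed_simple_root:
  assumes bc: "biclosed R" "biclosed S" "biclosed T1" "biclosed T2"
    and sub: "R \<subseteq> T1" "R \<subseteq> T2" "S \<subseteq> T1" "S \<subseteq> T2"
    and ne: "R \<noteq> {}" "S \<noteq> {}" "T1 \<noteq> \<Phi>_pos" "T2 \<noteq> \<Phi>_pos"
  shows "\<exists>i. \<alpha> i \<in> R \<inter> S \<or> \<alpha> i \<notin> T1 \<union> T2"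
proof (rule ccontr)
  assume no: "\<not> ?thesis"
  obtain i j where ij: "\<alpha> i \<in> R" "\<alpha> j \<in> S" using biclosed_has_simple bc ne by metis
  have "\<Phi>_pos - T1 \<noteq> {}" "\<Phi>_pos - T2 \<noteq> {}" using ne bc biclosedD(1) by blast+
  then obtain k l where kl: "\<alpha> k \<notin> T1" "\<alpha> l \<notin> T2"
    using biclosed_has_simple[OF biclosed_complement[OF bc(3)]] biclosed_has_simple[OF biclosed_complement[OF bc(4)]] by blast
  have "i \<noteq> j" "k \<noteq> l" using no ij kl by auto
  moreover have "k \<noteq> i" "k \<noteq> j" "l \<noteq> i" "l \<noteq> j" using ij kl sub by auto
  ultimately show False using exhaust_3[of i] exhaust_3[of j] exhaust_3[of k] exhaust_3[of l] by auto
qed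

text \<open>
  If two of the sets are comparable, one of the four sets interpolates. Otherwise, every finite part of the
  set \<open>\<Theta>\<close> of roots that the interpolating orientation must contain lies in an open half-space.
\<close>
theorem biclosed_interpolation:
  assumes bc: "biclosed R" "biclosed S" "biclosed T1" "biclosed T2"
    and sub: "R \<subseteq> T1" "R \<subseteq> T2" "S \<subseteq> T1" "S \<subseteq> T2"
  obtains Q where "biclosed Q" "R \<union> S \<subseteq> Q" "Q \<subseteq> T1 \<inter> T2"
proof -
  consider "R \<subseteq> S" | "S \<subseteq> R" | "T1 \<subseteq> T2" | "T2 \<subseteq> T1" | a1 a2 b1 b2 where
    "a1 \<in> R - S" "a2 \<in> S - R" "b1 \<in> T1 - T2" "b2 \<in> T2 - T1" by blast
  then show thesis
  proof cases
    case 1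
    show thesis by (rule that[OF bc(2)]) (use 1 sub in auto)
  next
    case 2
    show thesis by (rule that[OF bc(1)]) (use 2 sub in auto)
  next
    case 3
    show thesis by (rule that[OF bc(3)]) (use 3 sub in auto)
  next
    case 4
    show thesis by (rule that[OF bc(4)]) (use 4 sub in auto)
  next
    case 5
    have ne: "R \<noteq> {}" "S \<noteq> {}" "T1 \<noteq> \<Phi>_pos" "T2 \<noteq> \<Phi>_pos"
      using 5 bc(3,4)[THEN biclosedD(1)] by auto
    obtain i where i: "\<alpha> i \<in> R \<inter> S \<or> \<alpha> i \<notin> T1 \<union> T2" using agreed_simple_root[OF bc sub ne] by blast
    define \<Theta> where "\<Theta> = R \<union> S \<union> uminus ` (\<Phi>_pos - T1 \<inter> T2)"
    have RS: "R \<union> S \<subseteq> \<Phi>_pos" using bc biclosedD(1) by blast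
    have "positively_independent \<Theta>"
    proof (rule positively_independentI)
      fix Y assume Y: "finite Y" "Y \<subseteq> \<Theta>"
      define Z where "Z = (Y \<union> uminus ` Y) \<inter> \<Phi>_pos"
      have "finite Z" "Z \<subseteq> \<Phi>_pos" using Y by (auto simp: Z_def)
      then obtain q where q: "\<And>y. y \<in> Z \<Longrightarrow> y \<in> R \<union> S \<Longrightarrow> q \<bullet> y > 0"
        "\<And>y. y \<in> Z \<Longrightarrow> y \<notin> T1 \<inter> T2 \<Longrightarrow> q \<bullet> y < 0"
        using interpolation_finite[OF bc sub 5 simple_pos i] by metis
      have "q \<bullet> y > 0" if "y \<in> Y" for y
      proof -
        have "y \<in> \<Theta>" using Y that by blast
        then consider "y \<in> R \<union> S" | "- y \<in> \<Phi>_pos - T1 \<inter> T2" by (auto simp: \<Theta>_def)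
        then show ?thesis
        proof cases
          case 1
          then show ?thesis using q(1)[of y] RS that by (auto simp: Z_def)
        next
          case 2
          then show ?thesis using q(2)[of "- y"] that by (auto simp: Z_def)
        qed
      qed
      moreover have "linear ((\<bullet>) q)" by (rule bounded_linear.linear[OF bounded_linear_inner_right])
      ultimately show "\<exists>g :: real^3 \<Rightarrow> real. linear g \<and> (\<forall>y\<in>Y. g y > 0)" by blast
    qed
    moreover have "\<Theta> \<subseteq> \<Phi>" using RS by (auto simp: \<Theta>_def positive_root_iff)
    ultimately obtain \<Psi> where \<Psi>: "\<Theta> \<subseteq> \<Psi>" "orientation \<Psi>" by (rule extend_to_orientation)
    interpret orientation \<Psi> by (rule \<Psi>)
    show thesis
    proof (rule that[OF orientation_biclosed[OF \<Psi>(2)]])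
      show "R \<union> S \<subseteq> \<Psi> \<inter> \<Phi>_pos" using \<Psi>(1) RS by (auto simp: \<Theta>_def)
      show "\<Psi> \<inter> \<Phi>_pos \<subseteq> T1 \<inter> T2"
      proof
        fix x assume x: "x \<in> \<Psi> \<inter> \<Phi>_pos"
        show "x \<in> T1 \<inter> T2"
        proof (rule ccontr)
          assume "x \<notin> T1 \<inter> T2"
          then have "- x \<in> \<Theta>" using x by (auto simp: \<Theta>_def)
          then show False using \<Psi>(1) x proper by blast
        qed
      qed
    qed
  qed
qed

section \<open>Suprema and infima\<close>

lemma biclosed_chain_Union:
  assumes C: "\<C> \<noteq> {}" "subset.chain \<A> \<C>" and bc: "\<And>R. R \<in> \<C> \<Longrightarrow> biclosed R"
  shows "biclosed (\<Union>\<C>)"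
proof -
  have "\<Union>\<C> \<subseteq> \<Phi>_pos" using bc biclosedD(1) by blast
  moreover have "closed_roots (\<Union>\<C>)"
    unfolding closed_roots_def
  proof (intro conjI ballI)
    fix x y assume "x \<in> \<Union>\<C>" "y \<in> \<Union>\<C>"
    then obtain B where B: "B \<in> \<C>" "{x, y} \<subseteq> B"
      using finite_subset_Union_chain[of "{x, y}" \<C> \<A>] C by auto
    then show "Span_nonneg {x, y} \<inter> \<Phi>_pos \<subseteq> \<Union>\<C>"
      using biclosedD(2)[OF bc[OF B(1)]] unfolding closed_roots_def by blast
  qed fact
  moreover have "closed_roots (\<Phi>_pos - \<Union>\<C>)"
    unfolding closed_roots_def
  proof (intro conjI ballI)
    fix x y assume xy: "x \<in> \<Phi>_pos - \<Union>\<C>" "y \<in> \<Phi>_pos - \<Union>\<C>"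
    have "z \<notin> B" if "z \<in> Span_nonneg {x, y}" "z \<in> \<Phi>_pos" "B \<in> \<C>" for z B
      using biclosedD(3)[OF bc[OF that(3)]] xy that unfolding closed_roots_def by blast
    then show "Span_nonneg {x, y} \<inter> \<Phi>_pos \<subseteq> \<Phi>_pos - \<Union>\<C>" by blast
  qed blast
  ultimately show ?thesis by (simp add: biclosed_def)
qed

text \<open>
  Interpolating between \<open>R, S\<close> and a minimal upper bound \<open>T\<close> together with any other upper bound \<open>U\<close> gives back
  \<open>T\<close>, so \<open>T \<subseteq> U\<close>. Minimal upper bounds are complements of maximal biclosed sets \<open>N\<close> that are disjoint from
  \<open>R \<union> S\<close>.
\<close>
lemma biclosed_supremum:
  assumes "biclosed R" "biclosed S"
  obtains T where "biclosed T" "R \<union> S \<subseteq> T" "\<And>U. biclosed U \<Longrightarrow> R \<union> S \<subseteq> U \<Longrightarrow> T \<subseteq> U"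
proof -
  define \<A> where "\<A> = {N. biclosed N \<and> N \<inter> (R \<union> S) = {}}"
  have "closed_roots {}" "closed_roots \<Phi>_pos" by (auto simp: closed_roots_def)
  then have "biclosed {}" by (simp add: biclosed_def)
  have "\<exists>N\<in>\<A>. \<forall>X\<in>\<A>. N \<subseteq> X \<longrightarrow> X = N"
  proof (rule subset_Zorn_nonempty)
    show "\<A> \<noteq> {}" using \<open>biclosed {}\<close> by (auto simp: \<A>_def)
    fix \<C> assume C: "\<C> \<noteq> {}" "subset.chain \<A> \<C>"
    then have CA: "\<C> \<subseteq> \<A>" by (simp add: subset.chain_def)
    then have "biclosed (\<Union>\<C>)" by (intro biclosed_chain_Union[OF C]) (auto simp: \<A>_def)
    then show "\<Union>\<C> \<in> \<A>" using CA by (auto simp: \<A>_def)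
  qed
  then obtain N where NA: "N \<in> \<A>" and max: "\<forall>X\<in>\<A>. N \<subseteq> X \<longrightarrow> X = N" by (elim bexE)
  have N: "biclosed N" "N \<inter> (R \<union> S) = {}" using NA by (simp_all add: \<A>_def)
  have RS: "R \<subseteq> \<Phi>_pos" "S \<subseteq> \<Phi>_pos" using assms biclosedD(1) by auto
  let ?T = "\<Phi>_pos - N"
  have T: "biclosed ?T" using biclosed_complement N(1) .
  show thesis
  proof (rule that[OF T])
    show "R \<union> S \<subseteq> ?T" using RS N by blast
    fix U assume U: "biclosed U" "R \<union> S \<subseteq> U"
    obtain Q where Q: "biclosed Q" "R \<union> S \<subseteq> Q" "Q \<subseteq> ?T \<inter> U"
      by (rule biclosed_interpolation[OF assms T U(1)]) (use RS N U in blast)+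
    have "\<Phi>_pos - Q \<in> \<A>" using biclosed_complement[OF Q(1)] Q(2) by (auto simp: \<A>_def)
    moreover have "N \<subseteq> \<Phi>_pos - Q" using Q(3) biclosedD(1)[OF N(1)] by blast
    ultimately have "\<Phi>_pos - Q = N" using max by blast
    then show "?T \<subseteq> U" using Q biclosedD(1)[OF Q(1)] by blast
  qed
qed

lemma biclosed_infimum:
  assumes "biclosed R" "biclosed S"
  obtains T where "biclosed T" "T \<subseteq> R \<inter> S" "\<And>U. biclosed U \<Longrightarrow> U \<subseteq> R \<inter> S \<Longrightarrow> U \<subseteq> T"
proof -
  obtain T where T: "biclosed T" "(\<Phi>_pos - R) \<union> (\<Phi>_pos - S) \<subseteq> T"
    "\<And>U. biclosed U \<Longrightarrow> (\<Phi>_pos - R) \<union> (\<Phi>_pos - S) \<subseteq> U \<Longrightarrow> T \<subseteq> U"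
    using biclosed_supremum[OF assms[THEN biclosed_complement]] by metis
  show thesis
  proof (rule that[OF biclosed_complement[OF T(1)]])
    show "\<Phi>_pos - T \<subseteq> R \<inter> S" using T(2) by blast
    fix U assume U: "biclosed U" "U \<subseteq> R \<inter> S"
    have "T \<subseteq> \<Phi>_pos - U" by (rule T(3)[OF biclosed_complement[OF U(1)]]) (use U in blast)
    then show "U \<subseteq> \<Phi>_pos - T" using biclosedD(1)[OF U(1)] by blast
  qed
qed

lemma lattice_extended_weak_order: "lattice extended_weak_order"
proof
  show "\<exists>s. least extended_weak_order s (Upper extended_weak_order {R, S})"
    if "R \<in> carrier extended_weak_order" "S \<in> carrier extended_weak_order" for R S
  proof -
    have "biclosed R" "biclosed S" using that by (simp_all add: extended_weak_order_def)
    then obtain T where "biclosed T" "R \<union> S \<subseteq> T" "\<And>U. biclosed U \<Longrightarrow> R \<union> S \<subseteq> U \<Longrightarrow> T \<subseteq> U"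
      using biclosed_supremum by metis
    then show ?thesis using that
      by (intro exI[of _ T]) (auto simp: least_def Upper_def extended_weak_order_def)
  qed
  show "\<exists>s. greatest extended_weak_order s (Lower extended_weak_order {R, S})"
    if "R \<in> carrier extended_weak_order" "S \<in> carrier extended_weak_order" for R S
  proof -
    have "biclosed R" "biclosed S" using that by (simp_all add: extended_weak_order_def)
    then obtain T where "biclosed T" "T \<subseteq> R \<inter> S" "\<And>U. biclosed U \<Longrightarrow> U \<subseteq> R \<inter> S \<Longrightarrow> U \<subseteq> T"
      using biclosed_infimum by metis
    then show ?thesis using that
      by (intro exI[of _ T]) (auto simp: greatest_def Lower_def extended_weak_order_def)
  qed
qed (auto simp: extended_weak_order_def)

theorem theorem1:
  shows "(\<forall>R. biclosed R \<longrightarrow> weakly_separable R) \<and> lattice extended_weak_order"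
  using biclosed_weakly_separable lattice_extended_weak_order by blast

end
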